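(* Let $f(x)=\frac12 x^\top Qx+g^\top x+h$ with $Q\in\mathbb{R}^{d\times d}$ symmetric positive definite, $g\in\mathbb{R}^d$, $h\in\mathbb{R}$. Consider the noisy generalized momentum method (GMM) with parameters $(\alpha,\beta,\nu)$ applied to $f$, where $\{w_{k+1}\}_{k\ge0}$ is i.i.d. with $w_{k+1}\sim\mathcal N(0,\frac{\sigma^2}{d}\mathsf I_d)$ for some $\sigma>0$, and assume $\rho(A_Q)<1$. Then the sequence $\Delta_K=S_K/(K+1)$, $K\ge0$, satisfies a large deviation principle with the rate function $$I(s)=\sup_{-\infty<\theta<\frac{d}{H_\infty^2}}\left[\frac{\theta}{2\sigma^2}\big(s-R(\theta)\big)\right],$$ which is a good rate function, where the risk-sensitive index admits the integral representation $$R(\theta)=\begin{cases}-\dfrac{\sigma^2}{2\pi\theta}\displaystyle\int_{-\pi}^{\pi}\log\det\Big(\mathsf I_d-\frac\theta d\,G(e^{i\omega})G(e^{i\omega})^*\Big)d\omega,&\text{if }-\infty<\theta<\frac{d}{H_\infty^2};\\ +\infty,&\text{if }\theta\ge\frac{d}{H_\infty^2},\end{cases}$$ with the value at $\theta=0$ interpreted by continuity as the limit $$R(0)=\lim_{\theta\to0}-\frac{\sigma^2}{2\pi\theta}\int_{-\pi}^{\pi}\log\det\Big(\mathsf I_d-\frac\theta dG(e^{i\omega})G(e^{i\omega})^*\Big)d\omega=\frac{\sigma^2}{2\pi d}\int_{-\pi}^{\pi}\operatorname{trace}\big(G(e^{i\omega})G(e^{i\omega})^*\big)d\omega.$$ Here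 $G(z)=T(z\mathsf I_{2d}-A_Q)^{-1}B\in\mathbb{C}^{d\times d}$ for $z\in\mathbb{C}\setminus\mathrm{Spec}(A_Q)$, and $^*$ is the conjugate transpose. Furthermore, for any $t>0$, with $\bar x_K=\frac{x_0+\dots+x_K}{K+1}$, $$\limsup_{K\to\infty}\frac1K\log\mathbb P\big(f(\bar x_K)-f_*>t\big)\le\lim_{K\to\infty}\frac1K\log\mathbb P\Big(\frac{S_K}{K+1}\ge t\Big)=-\inf_{s\in[t,\infty)}I(s).$$
   Context: Let $\lambda_1\le\dots\le\lambda_d$ be the eigenvalues of $Q$, $\mu=\lambda_1$, $L=\lambda_d$ (with $\mu<L$ assumed throughout), $Q=U\Lambda U^\top$ with $U$ orthogonal and $\Lambda=\mathrm{diag}(\lambda_1,\dots,\lambda_d)$; $x_*$ is the minimizer of $f$ and $f_*=f(x_* )$. $\rho(\cdot)$ of a matrix is its spectral radius and $\mathrm{Spec}(\cdot)$ its set of eigenvalues. Noisy GMM with parameters $\alpha>0$, $\beta,\nu\ge0$: from an arbitrary $x_0=x_{-1}\in\mathbb{R}^d$, for $k\ge0$, $$y_k=x_k+\nu(x_k-x_{k-1}),\qquad x_{k+1}=x_k-\alpha(\nabla f(y_k)+w_{k+1})+\beta(x_k-x_{k-1}).$$ System matrices: $A_Q=\begin{bmatrix}(1+\beta)\mathsf I_d-\alpha(1+\nu)Q&-\beta\mathsf I_d+\alpha\nu Q\\ \mathsf I_d&0_d\end{bmatrix}$, $B=\begin{bmatrix}-\alpha\mathsf I_d\\0_d\end{bmatrix}$,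 $T=\begin{bmatrix}\frac1{\sqrt2}\Lambda^{1/2}U^\top&0_d\end{bmatrix}$. $S_K=\sum_{k=0}^K[f(x_k)-f_*]$. For $\theta\neq0$, $R_K(\theta)=\frac{2\sigma^2}{\theta(K+1)}\log\mathbb{E}[e^{\frac{\theta}{2\sigma^2}S_K}]$ and the risk-sensitive index is $R(\theta)=\limsup_{K\to\infty}R_K(\theta)$. $H_\infty$ (the $H_\infty$-norm of the GMM system) is given by $$H_\infty=\frac{\alpha}{\sqrt2}\max_{1\le i\le d}\frac{\sqrt{\lambda_i}}{\tilde s_{\lambda_i}},\qquad \tilde s_\lambda=\begin{cases}|1-\tilde c_\lambda|\sqrt{1-\frac{\tilde b_\lambda^2}{4\tilde c_\lambda}}&\text{if }\tilde c_\lambda>0\text{ and }\frac{|\tilde b_\lambda|(1+\tilde c_\lambda)}{4\tilde c_\lambda}<1,\\ \big||1+\tilde c_\lambda|-|\tilde b_\lambda|\big|&\text{otherwise},\end{cases}$$ with $\tilde b_\lambda=\alpha\lambda(1+\nu)-(1+\beta)$, $\tilde c_\lambda=\beta-\alpha\lambda\nu$. Large deviation principle: real random variables $\{\Delta_K\}$ satisfy an LDP with rate function $I:\mathbb{R}\to[0,\infty]$ (non-negative, lower semi-continuous) if for every Borel set $E\subset\mathbb{R}$ with interior $E^o$ and closure $\bar E$, $$-\inf_{s\in E^o}I(s)\le\liminf_{K\to\infty}\frac1K\log\mathbb P(\Delta_K\in E)\le\limsup_{K\to\infty}\frac1K\log\mathbb P(\Delta_K\in E)\le-\inf_{s\in\bar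 E}I(s).$$ The rate function is good if it has compact level sets.
   Formalization: R(θ)=+∞ is stated only for θ>d/H_∞², not at θ=d/H_∞², where the limsup defining R can be finite (e.g. β=ν=0, Q=diag(1,2), α=1/4, x_0=x_* ), so the claim at that point is false. *)

theory Defs
  imports "HOL-Probability.Probability"
begin

section \<open>Matrices\<close>

definition hblock :: "'a^'n^'m \<Rightarrow> 'a^'p^'m \<Rightarrow> 'a^('n + 'p)^'m" where
  "hblock A B = (\<chi> i j. case j of Inl k \<Rightarrow> A $ i $ k | Inr k \<Rightarrow> B $ i $ k)"

definition vblock :: "'a^'n^'m \<Rightarrow> 'a^'n^'p \<Rightarrow> 'a^'n^('m + 'p)" where
  "vblock A B = (\<chi> i. case i of Inl k \<Rightarrow> A $ k | Inr k \<Rightarrow> B $ k)"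

definition diag_matrix :: "('n \<Rightarrow> 'a::zero) \<Rightarrow> 'a^'n^'n" where
  "diag_matrix l = (\<chi> i j. if i = j then l i else 0)"

definition cmatrix :: "real^'n^'m \<Rightarrow> complex^'n^'m" where
  "cmatrix A = (\<chi> i j. complex_of_real (A $ i $ j))"

definition conj_transpose :: "complex^'n^'m \<Rightarrow> complex^'m^'n" where
  "conj_transpose A = (\<chi> i j. cnj (A $ j $ i))"

definition eigenvals :: "complex^'n^'n \<Rightarrow> complex set" where
  "eigenvals A = {z. \<exists>v. v \<noteq> 0 \<and> A *v v = z *s v}"

definition spec_radius :: "complex^'n^'n \<Rightarrow> real" where
  "spec_radius A = Max (cmod ` eigenvals A)"

definition sym_pos_def :: "real^'n^'n \<Rightarrow> bool" where
  "sym_pos_def Q \<longleftrightarrow> transpose Q = Q \<and> (\<forall>v. v \<noteq> 0 \<longrightarrow> 0 < v \<bullet> (Q *v v))"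


section \<open>The generalized momentum method\<close>

definition grad :: "('a::real_inner \<Rightarrow> real) \<Rightarrow> 'a \<Rightarrow> 'a" where
  "grad f x = (THE D. GDERIV f x :> D)"

text \<open>The state after \<open>k\<close> steps is the pair of the \<open>k\<close>-th iterate and the one before it;
  the initial pair encodes the convention that the iterate with index \<open>-1\<close> equals \<open>x0\<close>.
  Here \<open>e k\<close> is a realization of the noise; only the values \<open>e 1, e 2, \<dots>\<close> are used.\<close>

primrec gmm_state ::
  "('a::real_inner \<Rightarrow> real) \<Rightarrow> real \<Rightarrow> real \<Rightarrow> real \<Rightarrow> 'a \<Rightarrow> (nat \<Rightarrow> 'a) \<Rightarrow> nat \<Rightarrow> 'a \<times> 'a"
where
  "gmm_state f \<alpha> \<beta> \<nu> x0 e 0 = (x0, x0)"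
| "gmm_state f \<alpha> \<beta> \<nu> x0 e (Suc k) =
    (let (x, xprev) = gmm_state f \<alpha> \<beta> \<nu> x0 e k;
         y = x + \<nu> *\<^sub>R (x - xprev)
     in (x - \<alpha> *\<^sub>R (grad f y + e (Suc k)) + \<beta> *\<^sub>R (x - xprev), x))"

definition gmm ::
  "('a::real_inner \<Rightarrow> real) \<Rightarrow> real \<Rightarrow> real \<Rightarrow> real \<Rightarrow> 'a \<Rightarrow> (nat \<Rightarrow> 'a) \<Rightarrow> nat \<Rightarrow> 'a"
where
  "gmm f \<alpha> \<beta> \<nu> x0 e k = fst (gmm_state f \<alpha> \<beta> \<nu> x0 e k)"

definition gmm_A :: "real \<Rightarrow> real \<Rightarrow> real \<Rightarrow> real^'n^'n \<Rightarrow> real^('n + 'n)^('n + 'n)" where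
  "gmm_A \<alpha> \<beta> \<nu> Q =
    vblock
      (hblock ((1 + \<beta>) *\<^sub>R mat 1 - (\<alpha> * (1 + \<nu>)) *\<^sub>R Q) ((- \<beta>) *\<^sub>R mat 1 + (\<alpha> * \<nu>) *\<^sub>R Q))
      (hblock (mat 1) 0)"

definition gmm_B :: "real \<Rightarrow> real^'n^('n + 'n)" where
  "gmm_B \<alpha> = vblock ((- \<alpha>) *\<^sub>R mat 1) 0"

definition gmm_T :: "real^'n^'n \<Rightarrow> ('n \<Rightarrow> real) \<Rightarrow> real^('n + 'n)^'n" where
  "gmm_T U l = hblock ((1 / sqrt 2) *\<^sub>R (diag_matrix (\<lambda>i. sqrt (l i)) ** transpose U)) 0"

text \<open>The transfer matrix; it is meaningful for \<open>z\<close> outside the spectrum of \<open>gmm_A\<close>.\<close>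

definition gmm_G ::
  "real \<Rightarrow> real \<Rightarrow> real \<Rightarrow> real^'n^'n \<Rightarrow> real^'n^'n \<Rightarrow> ('n \<Rightarrow> real) \<Rightarrow> complex \<Rightarrow> complex^'n^'n"
where
  "gmm_G \<alpha> \<beta> \<nu> Q U l z =
    cmatrix (gmm_T U l) ** matrix_inv (mat z - cmatrix (gmm_A \<alpha> \<beta> \<nu> Q)) ** cmatrix (gmm_B \<alpha>)"

definition b_tilde :: "real \<Rightarrow> real \<Rightarrow> real \<Rightarrow> real \<Rightarrow> real" where
  "b_tilde \<alpha> \<beta> \<nu> l = \<alpha> * l * (1 + \<nu>) - (1 + \<beta>)"

definition c_tilde :: "real \<Rightarrow> real \<Rightarrow> real \<Rightarrow> real \<Rightarrow> real" where
  "c_tilde \<alpha> \<beta> \<nu> l = \<beta> - \<alpha> * l * \<nu>"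

definition s_tilde :: "real \<Rightarrow> real \<Rightarrow> real \<Rightarrow> real \<Rightarrow> real" where
  "s_tilde \<alpha> \<beta> \<nu> l =
    (let b = b_tilde \<alpha> \<beta> \<nu> l; c = c_tilde \<alpha> \<beta> \<nu> l in
     if 0 < c \<and> \<bar>b\<bar> * (1 + c) / (4 * c) < 1
     then \<bar>1 - c\<bar> * sqrt (1 - b\<^sup>2 / (4 * c))
     else \<bar>\<bar>1 + c\<bar> - \<bar>b\<bar>\<bar>)"

definition H_inf :: "real \<Rightarrow> real \<Rightarrow> real \<Rightarrow> ('n::finite \<Rightarrow> real) \<Rightarrow> real" where
  "H_inf \<alpha> \<beta> \<nu> l = \<alpha> / sqrt 2 * Max (range (\<lambda>i. sqrt (l i) / s_tilde \<alpha> \<beta> \<nu> (l i)))"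


section \<open>Gaussian noise\<close>

text \<open>Density of the normal distribution with mean \<open>m\<close> and positive definite covariance \<open>C\<close>.\<close>

definition mvnormal_density :: "real^'n \<Rightarrow> real^'n^'n \<Rightarrow> real^'n \<Rightarrow> real" where
  "mvnormal_density m C x =
    exp (- ((x - m) \<bullet> (matrix_inv C *v (x - m))) / 2) / sqrt ((2 * pi) ^ CARD('n) * det C)"


section \<open>Large deviations\<close>

text \<open>Natural logarithm with the conventions \<open>ln 0 = -\<infinity>\<close> and \<open>ln \<infinity> = \<infinity>\<close>.\<close>

definition eln :: "ennreal \<Rightarrow> ereal" where
  "eln p = (if p = 0 then - \<infinity> else if p = \<infinity> then \<infinity> else ereal (ln (enn2real p)))"

definition rate_function :: "(real \<Rightarrow> ereal) \<Rightarrow> bool" where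
  "rate_function I \<longleftrightarrow> (\<forall>s. 0 \<le> I s) \<and> (\<forall>s. I s \<le> Liminf (at s) I)"

definition good_rate_function :: "(real \<Rightarrow> ereal) \<Rightarrow> bool" where
  "good_rate_function I \<longleftrightarrow> rate_function I \<and> (\<forall>a::real. compact {s. I s \<le> ereal a})"

definition log_prob_rate :: "'a measure \<Rightarrow> (nat \<Rightarrow> 'a set) \<Rightarrow> nat \<Rightarrow> ereal" where
  "log_prob_rate M A K = ereal (1 / real K) * eln (emeasure M (A K))"

definition satisfies_LDP ::
  "'a measure \<Rightarrow> (nat \<Rightarrow> 'a \<Rightarrow> real) \<Rightarrow> (real \<Rightarrow> ereal) \<Rightarrow> bool"
where
  "satisfies_LDP M \<Delta> I \<longleftrightarrow>
    (\<forall>K. \<Delta> K \<in> borel_measurable M) \<and> rate_function I \<and>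
    (\<forall>E \<in> sets borel.
      - (INF s \<in> interior E. I s) \<le> liminf (log_prob_rate M (\<lambda>K. {\<omega> \<in> space M. \<Delta> K \<omega> \<in> E})) \<and>
      liminf (log_prob_rate M (\<lambda>K. {\<omega> \<in> space M. \<Delta> K \<omega> \<in> E}))
        \<le> limsup (log_prob_rate M (\<lambda>K. {\<omega> \<in> space M. \<Delta> K \<omega> \<in> E})) \<and>
      limsup (log_prob_rate M (\<lambda>K. {\<omega> \<in> space M. \<Delta> K \<omega> \<in> E})) \<le> - (INF s \<in> closure E. I s))"


section \<open>The risk-sensitive index\<close>

text \<open>For positive \<open>\<theta>\<close> the exponential moment may be infinite, hence the extended reals.\<close>

definition risk_K :: "'a measure \<Rightarrow> real \<Rightarrow> (nat \<Rightarrow> 'a \<Rightarrow> real) \<Rightarrow> nat \<Rightarrow> real \<Rightarrow> ereal" where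
  "risk_K M \<sigma> S K \<theta> =
    ereal (2 * \<sigma>\<^sup>2 / (\<theta> * real (K + 1))) *
    eln (\<integral>\<^sup>+ \<omega>. ennreal (exp (\<theta> / (2 * \<sigma>\<^sup>2) * S K \<omega>)) \<partial>M)"

text \<open>At \<open>\<theta> = 0\<close>, where \<open>risk_K\<close> is meaningless, the index is extended by continuity.\<close>

definition risk_index :: "'a measure \<Rightarrow> real \<Rightarrow> (nat \<Rightarrow> 'a \<Rightarrow> real) \<Rightarrow> real \<Rightarrow> ereal" where
  "risk_index M \<sigma> S \<theta> =
    (if \<theta> = 0 then Lim (at 0) (\<lambda>t. limsup (\<lambda>K. risk_K M \<sigma> S K t))
     else limsup (\<lambda>K. risk_K M \<sigma> S K \<theta>))"

text \<open>The matrix \<open>I - (\<theta>/d) G(exp(i\<omega>)) G(exp(i\<omega>))\<^sup>*\<close>. It is Hermitian, so its determinant is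
  real and \<open>Re\<close> below only changes the type.\<close>

definition risk_matrix :: "(complex \<Rightarrow> complex^'n^'n) \<Rightarrow> real \<Rightarrow> real \<Rightarrow> complex^'n^'n" where
  "risk_matrix G \<theta> \<omega> =
    mat 1 - (\<theta> / real CARD('n)) *\<^sub>R (G (cis \<omega>) ** conj_transpose (G (cis \<omega>)))"

definition risk_integral :: "(complex \<Rightarrow> complex^'n^'n) \<Rightarrow> real \<Rightarrow> real \<Rightarrow> real" where
  "risk_integral G \<sigma> \<theta> =
    - (\<sigma>\<^sup>2 / (2 * pi * \<theta>)) * integral {-pi..pi} (\<lambda>\<omega>. ln (Re (det (risk_matrix G \<theta> \<omega>))))"

definition risk_integral_0 :: "(complex \<Rightarrow> complex^'n^'n) \<Rightarrow> real \<Rightarrow> real" where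
  "risk_integral_0 G \<sigma> =
    \<sigma>\<^sup>2 / (2 * pi * real CARD('n)) *
    integral {-pi..pi} (\<lambda>\<omega>. Re (trace (G (cis \<omega>) ** conj_transpose (G (cis \<omega>)))))"

text \<open>The rate function: the supremum is over \<open>\<theta> < \<theta>\<^sub>c\<close>, and \<open>R\<close> is the risk-sensitive index.\<close>

definition risk_rate :: "real \<Rightarrow> real \<Rightarrow> (real \<Rightarrow> ereal) \<Rightarrow> real \<Rightarrow> ereal" where
  "risk_rate \<sigma> \<theta>\<^sub>c R s = (SUP \<theta>\<in>{..<\<theta>\<^sub>c}. ereal (\<theta> / (2 * \<sigma>\<^sup>2)) * (ereal s - R \<theta>))"

text \<open>Pitfall at the critical value \<open>\<theta>\<^sub>c = d / H_inf\<^sup>2\<close>. The limsup defining \<open>risk_index\<close> is infinite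
  for \<open>\<theta> > \<theta>\<^sub>c\<close>, but in general finite at \<open>\<theta> = \<theta>\<^sub>c\<close>. For gradient descent (\<open>\<beta> = \<nu> = 0\<close>) started at
  the minimizer with \<open>\<alpha> \<cdot> lambda_max < 1\<close> and a simple least eigenvalue, put \<open>r = 1 - \<alpha> \<cdot> lambda_min\<close>.
  The exponential moment at \<open>\<theta>\<^sub>c\<close> factors over the eigenvalues; the critical factor is
  \<open>(r ^ K * (K + 1 - r * K)) powr (-1/2)\<close>, whose logarithm divided by \<open>K + 1\<close> tends to \<open>- ln r / 2\<close>, and
  the other factors are subcritical.\<close>

end

theory Submission
  imports Defs "HOL-Complex_Analysis.Complex_Analysis"
begin

text \<open>
  In the eigenbasis of \<open>Q\<close> the iterates split into independent scalar recursions
  \<open>u\<^sub>k\<^sub>+\<^sub>1 + b u\<^sub>k + c u\<^sub>k\<^sub>-\<^sub>1 = - \<alpha> \<xi>\<^sub>k\<^sub>+\<^sub>1\<close>, so the moment generating function of \<open>S\<^sub>K\<close> is a product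
  of iterates of one-dimensional Gaussian integral operators. Let \<open>p(z) = z\<^sup>2 + b z + c\<close> and
  \<open>\<tau> = \<theta> \<alpha>\<^sup>2 \<lambda> / (2 d)\<close>. Below the critical value of \<open>\<theta>\<close> the symbol has a spectral factorization
  \<open>|p|\<^sup>2 - \<tau> = A |q|\<^sup>2\<close> on the unit circle with \<open>q\<close> monic and stable, which is explicit for polynomials of
  degree two. It yields Gaussian left and right eigenfunctions of the operator for the eigenvalue
  \<open>A powr (-1/2)\<close>, hence the growth rate \<open>- ln A / 2\<close>; by Jensen's formula \<open>ln A\<close> is the mean of
  \<open>ln (1 - \<tau> / |p|\<^sup>2)\<close> over the circle. The explicit formula also shows that the limit is
  differentiable and steep at the critical value, so the large deviation principle follows by an
  elementary one-dimensional Gartner-Ellis argument. Steepness and convexity together force the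
  index to be infinite beyond the critical value.
\<close>

section \<open>Large deviations from limits of moment generating functions\<close>

text \<open>The recursion starts at a fixed point and the iterated function is the constant 1.
  Neither is an eigenvector of the integral operator, so the eigenvalue alone does not give the
  growth rate. The right eigenfunction \<open>exp (- k * Nf)\<close> is in general neither bounded
  nor bounded away from 0, so it cannot simply be compared with 1. The left eigenmeasure, however,
  is finite, and two steps from any point are dominated by a multiple of it; this gives the upper
  bound. For the lower bound the right eigenfunction is cut off where it is large, and the same
  domination shows that the removed part accounts for at most half of the iterate. The constants
  depend on the starting point; only the rate survives in the limit. The slopes of the limit are
  only shown to cover the positive reals. Points \<open>s \<le> 0\<close> are handled separately:
  the limit diverges at minus infinity, so the rate is infinite there. The convexity argument needs
  room between the critical value and \<open>\<theta>\<close>; it gives nothing at the critical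
  value itself.\<close>

lemma eln_ennreal: "0 < r \<Longrightarrow> eln (ennreal r) = ereal (ln r)"
  by (simp add: eln_def)

lemma eln_mono: assumes "p \<le> q" shows "eln p \<le> eln q"
proof (cases "p = 0 \<or> q = \<infinity>")
  case True
  then show ?thesis by (auto simp: eln_def)
next
  case False
  then have "0 < p" "q < top" by (simp_all add: less_top zero_less_iff_neq_zero)
  moreover have "p < top" "0 < q" using le_less_trans[OF assms] less_le_trans[OF _ assms] calculation by auto
  ultimately have "0 < enn2real p" "enn2real p \<le> enn2real q"
    using assms by (auto simp: enn2real_positive_iff intro: enn2real_mono)
  then show ?thesis using False assms by (auto simp: eln_def)
qed

lemma ereal_le_uminus_swap: "a \<le> - b \<longleftrightarrow> b \<le> - a" for a b :: ereal
  by (cases a; cases b) auto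

text \<open>Gartner-Ellis hypotheses adapted to this process: slopes have to cover the positive
  reals, while \<open>\<Lambda>_bot\<close> settles \<open>s \<le> 0\<close>. Finiteness is asked
  eventually, since the moment bounds obtained later start at index 2. Limits are taken relative to
  \<open>n\<close> while the mean divides by \<open>n + 1\<close>; the discrepancy costs terms of
  order \<open>1 / n\<close>.\<close>

locale mgf_limit = prob_space M for M :: "'a measure" +
  fixes S :: "nat \<Rightarrow> 'a \<Rightarrow> real" and c :: real and \<Lambda> D :: "real \<Rightarrow> real"
  assumes S_measurable [measurable]: "\<And>n. S n \<in> borel_measurable M"
    and c_pos: "0 < c"
    and mgf_finite: "\<And>\<theta>. \<theta> < c \<Longrightarrow> \<forall>\<^sub>F n in sequentially. integrable M (\<lambda>\<omega>. exp (\<theta> * S n \<omega>))"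
    and mgf_lim: "\<And>\<theta>. \<theta> < c \<Longrightarrow> (\<lambda>n. ln (expectation (\<lambda>\<omega>. exp (\<theta> * S n \<omega>))) / real n) \<longlonglongrightarrow> \<Lambda> \<theta>"
    and deriv: "\<And>\<theta>. \<theta> < c \<Longrightarrow> (\<Lambda> has_real_derivative D \<theta>) (at \<theta>)"
    and D_range: "\<And>s. 0 < s \<Longrightarrow> \<exists>\<theta><c. D \<theta> = s"
    and \<Lambda>_bot: "filterlim \<Lambda> at_bot at_bot"
begin

definition Z :: "nat \<Rightarrow> real \<Rightarrow> real" where
  "Z n \<theta> = expectation (\<lambda>\<omega>. exp (\<theta> * S n \<omega>))"

definition rate :: "real \<Rightarrow> ereal" where
  "rate s = (SUP \<theta>\<in>{..<c}. ereal (\<theta> * s - \<Lambda> \<theta>))"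

abbreviation mean_in :: "real set \<Rightarrow> nat \<Rightarrow> 'a set" where
  "mean_in E n \<equiv> {\<omega> \<in> space M. S n \<omega> / real (n + 1) \<in> E}"

lemma Z_pos: assumes "integrable M (\<lambda>\<omega>. exp (\<theta> * S n \<omega>))" shows "0 < Z n \<theta>"
  unfolding Z_def
  by (rule integral_less_AE_space[of "\<lambda>_. 0" , simplified, OF assms]) (auto simp: emeasure_space_1)

lemma ln_Z_lim: "\<theta> < c \<Longrightarrow> (\<lambda>n. ln (Z n \<theta>) / real n) \<longlonglongrightarrow> \<Lambda> \<theta>"
  using mgf_lim by (simp add: Z_def)

lemma \<Lambda>_0: "\<Lambda> 0 = 0"
proof -
  have "(\<lambda>n. ln (Z n 0) / real n) \<longlonglongrightarrow> 0" by (simp add: Z_def prob_space)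
  then show ?thesis using ln_Z_lim[of 0] c_pos LIMSEQ_unique by blast
qed

text \<open>Hoelder's inequality: convexity of \<open>exp\<close> is applied pointwise to the
  exponents shifted by \<open>ln (Z n \<theta>1)\<close> and \<open>ln (Z n \<theta>2)\<close>,
  whose exponentials then integrate to 1.\<close>

lemma ln_mgf_convex:
  assumes i1: "integrable M (\<lambda>\<omega>. exp (\<theta>1 * S n \<omega>))" and i2: "integrable M (\<lambda>\<omega>. exp (\<theta>2 * S n \<omega>))"
    and i3: "integrable M (\<lambda>\<omega>. exp (((1 - t) * \<theta>1 + t * \<theta>2) * S n \<omega>))"
    and t: "0 \<le> t" "t \<le> 1"
  shows "ln (Z n ((1 - t) * \<theta>1 + t * \<theta>2)) \<le> (1 - t) * ln (Z n \<theta>1) + t * ln (Z n \<theta>2)"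
proof -
  let ?m = "(1 - t) * \<theta>1 + t * \<theta>2"
  define l where "l = (1 - t) * ln (Z n \<theta>1) + t * ln (Z n \<theta>2)"
  have p1: "0 < Z n \<theta>1" and p2: "0 < Z n \<theta>2" and p3: "0 < Z n ?m"
    using Z_pos i1 i2 i3 by auto
  have cv: "convex_on UNIV (exp :: real \<Rightarrow> real)" by (rule exp_convex)
  have "exp (?m * S n \<omega>) * exp (- l) \<le>
      (1 - t) * (exp (\<theta>1 * S n \<omega>) / Z n \<theta>1) + t * (exp (\<theta>2 * S n \<omega>) / Z n \<theta>2)" for \<omega>
  proof -
    have *: "(1 - t) *\<^sub>R (\<theta>1 * S n \<omega> - ln (Z n \<theta>1)) + t *\<^sub>R (\<theta>2 * S n \<omega> - ln (Z n \<theta>2))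
      = ?m * S n \<omega> + (- l)" by (simp add: l_def algebra_simps)
    have "exp ((1 - t) *\<^sub>R (\<theta>1 * S n \<omega> - ln (Z n \<theta>1)) + t *\<^sub>R (\<theta>2 * S n \<omega> - ln (Z n \<theta>2)))
      \<le> (1 - t) * exp (\<theta>1 * S n \<omega> - ln (Z n \<theta>1)) + t * exp (\<theta>2 * S n \<omega> - ln (Z n \<theta>2))"
      using t by (intro convex_onD[OF cv]) auto
    then show ?thesis unfolding * exp_add exp_diff using p1 p2 by simp
  qed
  then have "expectation (\<lambda>\<omega>. exp (?m * S n \<omega>) * exp (- l)) \<le>
     expectation (\<lambda>\<omega>. (1 - t) * (exp (\<theta>1 * S n \<omega>) / Z n \<theta>1) + t * (exp (\<theta>2 * S n \<omega>) / Z n \<theta>2))"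
    using i1 i2 i3 by (intro integral_mono) auto
  also have "\<dots> = (1 - t) * (Z n \<theta>1 / Z n \<theta>1) + t * (Z n \<theta>2 / Z n \<theta>2)"
    using i1 i2 by (simp add: Z_def)
  also have "\<dots> = 1" using p1 p2 by simp
  finally have "Z n ?m * exp (- l) \<le> 1" by (simp add: Z_def)
  then have "Z n ?m \<le> exp l" by (simp add: exp_minus field_simps)
  then show ?thesis using p3 unfolding l_def[symmetric] by (metis ln_exp ln_le_cancel_iff exp_gt_zero)
qed

lemma convex_\<Lambda>: "convex_on {..<c} \<Lambda>"
proof (rule convex_onI)
  fix t x y :: real
  assume t: "0 < t" "t < 1" and "x \<in> {..<c}" and "y \<in> {..<c}"
  then have x: "x < c" and y: "y < c" by auto
  let ?m = "(1 - t) * x + t * y"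
  have m: "?m < c"
    using t x y convex_bound_lt[of x c y "1 - t" t] by simp
  have "\<forall>\<^sub>F n in sequentially. ln (Z n ?m) / real n
     \<le> (1 - t) * (ln (Z n x) / real n) + t * (ln (Z n y) / real n)"
    using mgf_finite[OF x] mgf_finite[OF y] mgf_finite[OF m] eventually_gt_at_top[of 0]
  proof eventually_elim
    case (elim n)
    then have "ln (Z n ?m) / n \<le> ((1 - t) * ln (Z n x) + t * ln (Z n y)) / n"
      using t by (intro divide_right_mono ln_mgf_convex) auto
    then show ?case by (simp add: add_divide_distrib)
  qed
  then have "\<Lambda> ?m \<le> (1 - t) * \<Lambda> x + t * \<Lambda> y"
    by (intro tendsto_le[OF _ tendsto_add[OF tendsto_mult_left[OF ln_Z_lim[OF x]] tendsto_mult_left[OF ln_Z_lim[OF y]]] ln_Z_lim[OF m]]) auto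
  then show "\<Lambda> ((1 - t) *\<^sub>R x + t *\<^sub>R y) \<le> (1 - t) * \<Lambda> x + t * \<Lambda> y" by simp
qed simp

lemma tangent: assumes "\<theta> < c" "\<theta>0 < c" shows "\<Lambda> \<theta>0 + (\<theta> - \<theta>0) * D \<theta>0 \<le> \<Lambda> \<theta>"
proof -
  have "\<Lambda> \<theta> - \<Lambda> \<theta>0 \<ge> D \<theta>0 * (\<theta> - \<theta>0)"
    by (rule convex_on_imp_above_tangent[OF convex_\<Lambda>])
      (use assms in \<open>auto intro!: DERIV_subset[OF deriv] simp: interior_open\<close>)
  then show ?thesis by (simp add: algebra_simps)
qed

section \<open>The Legendre transform as a good rate function\<close>

lemma rate_ge: "\<theta> < c \<Longrightarrow> ereal (\<theta> * s - \<Lambda> \<theta>) \<le> rate s"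
  unfolding rate_def by (rule SUP_upper) auto

lemma rate_nonneg: "0 \<le> rate s"
  using rate_ge[of 0 s] c_pos \<Lambda>_0 by (simp add: zero_ereal_def)

text \<open>The tangent line at \<open>\<theta>\<close> shows that \<open>\<theta>\<close> itself
  maximizes \<open>x * D \<theta> - \<Lambda> x\<close>. By \<open>D_range\<close> the transform is
  therefore attained at every positive point.\<close>

lemma rate_at_D: assumes "\<theta> < c" shows "rate (D \<theta>) = ereal (\<theta> * D \<theta> - \<Lambda> \<theta>)"
proof (rule antisym)
  show "rate (D \<theta>) \<le> ereal (\<theta> * D \<theta> - \<Lambda> \<theta>)"
    unfolding rate_def
  proof (rule SUP_least)
    fix x assume "x \<in> {..<c}"
    then show "ereal (x * D \<theta> - \<Lambda> x) \<le> ereal (\<theta> * D \<theta> - \<Lambda> \<theta>)"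
      using tangent[of x \<theta>] assms by (simp add: algebra_simps)
  qed
qed (rule rate_ge[OF assms])

text \<open>Let the exponent tend to minus infinity: \<open>\<theta> * s\<close> stays nonnegative
  while \<open>- \<Lambda> \<theta>\<close> exceeds every bound.\<close>

lemma rate_nonpos: assumes "s \<le> 0" shows "rate s = \<infinity>"
proof (rule ereal_top)
  fix B :: real
  have "\<forall>\<^sub>F \<theta> in at_bot. \<Lambda> \<theta> \<le> - B"
    using \<Lambda>_bot by (simp add: filterlim_at_bot)
  then have "\<forall>\<^sub>F \<theta> in at_bot. \<Lambda> \<theta> \<le> - B \<and> \<theta> \<le> 0 \<and> \<theta> < c"
    using eventually_le_at_bot[of 0] by eventually_elim (use c_pos in auto)
  then obtain \<theta> where "\<Lambda> \<theta> \<le> - B" "\<theta> \<le> 0" "\<theta> < c"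
    using eventually_happens'[OF trivial_limit_at_bot_linorder] by blast
  moreover then have "0 \<le> \<theta> * s" using assms by (simp add: mult_nonpos_nonpos)
  ultimately have "ereal B \<le> ereal (\<theta> * s - \<Lambda> \<theta>)" by simp
  also have "\<dots> \<le> rate s" by (rule rate_ge) fact
  finally show "ereal B \<le> rate s" .
qed

lemma rate_function_rate: "rate_function rate"
  unfolding rate_function_def
proof (intro conjI allI rate_nonneg)
  fix s
  show "rate s \<le> Liminf (at s) rate"
    unfolding rate_def[of s]
  proof (rule SUP_least)
    fix \<theta> assume \<theta>: "\<theta> \<in> {..<c}"
    have "((\<lambda>x. ereal (\<theta> * x - \<Lambda> \<theta>)) \<longlongrightarrow> ereal (\<theta> * s - \<Lambda> \<theta>)) (at s)"
      by (intro tendsto_intros)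
    then have "ereal (\<theta> * s - \<Lambda> \<theta>) = Liminf (at s) (\<lambda>x. ereal (\<theta> * x - \<Lambda> \<theta>))"
      by (intro lim_imp_Liminf[symmetric]) auto
    also have "\<dots> \<le> Liminf (at s) rate"
      by (intro Liminf_mono always_eventually allI rate_ge) (use \<theta> in auto)
    finally show "ereal (\<theta> * s - \<Lambda> \<theta>) \<le> Liminf (at s) rate" .
  qed
qed

lemma good_rate: "good_rate_function rate"
  unfolding good_rate_function_def
proof (intro conjI allI rate_function_rate)
  fix a :: real
  have eq: "{s. rate s \<le> ereal a} = (\<Inter>\<theta>\<in>{..<c}. {s. \<theta> * s - \<Lambda> \<theta> \<le> a})"
    unfolding rate_def by (auto simp: SUP_le_iff)
  have "closed {s. rate s \<le> ereal a}"
    unfolding eq by (intro closed_INT ballI closed_Collect_le continuous_intros)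
  \<comment> \<open>Sublevel sets lie to the right of 0 by \<open>rate_nonpos\<close>; the single
    positive exponent \<open>c/2\<close> bounds them from above.\<close>
  moreover have "{s. rate s \<le> ereal a} \<subseteq> {0..(a + \<Lambda> (c/2)) / (c/2)}"
  proof safe
    fix s assume s: "rate s \<le> ereal a"
    have "0 < s" using rate_nonpos[of s] s by (cases "0 < s") auto
    moreover have "c/2 * s - \<Lambda> (c/2) \<le> a"
      using order_trans[OF rate_ge[of "c/2" s] s] c_pos by simp
    ultimately show "s \<in> {0..(a + \<Lambda> (c/2)) / (c/2)}" using c_pos by (auto simp: field_simps)
  qed
  ultimately show "compact {s. rate s \<le> ereal a}"
    by (meson bounded_closed_interval bounded_subset compact_eq_bounded_closed)
qed

section \<open>Exponential Chebyshev bounds and the upper bound\<close>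

lemma exp_bound_eventually:
  assumes "\<theta> < c" "y < \<theta> * a - \<Lambda> \<theta>"
  shows "\<forall>\<^sub>F n in sequentially. exp (- (\<theta> * a * real (n + 1))) * Z n \<theta> \<le> exp (- (real n * y))"
proof -
  \<comment> \<open>The strict gap in \<open>y < \<theta> * a - \<Lambda> \<theta>\<close> absorbs
    the error of the limit together with the extra \<open>\<theta> * a\<close> that comes from
    \<open>n + 1\<close>.\<close>
  have "(\<lambda>n. ln (Z n \<theta>) / real n - \<theta> * a - \<theta> * a * (1 / real n)) \<longlonglongrightarrow> \<Lambda> \<theta> - \<theta> * a - \<theta> * a * 0"
    by (intro tendsto_intros ln_Z_lim lim_1_over_n assms)
  then have "\<forall>\<^sub>F n in sequentially. ln (Z n \<theta>) / real n - \<theta> * a - \<theta> * a * (1 / real n) < - y"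
    using assms by (intro order_tendstoD) auto
  then show ?thesis using mgf_finite[OF assms(1)] eventually_gt_at_top[of 0]
  proof eventually_elim
    case (elim n)
    then have "n * (ln (Z n \<theta>) / real n - \<theta> * a - \<theta> * a * (1 / real n)) < n * (- y)"
      by (intro mult_strict_left_mono) auto
    then have "ln (Z n \<theta>) - \<theta> * a * (n + 1) \<le> - (n * y)" using elim by (simp add: algebra_simps)
    moreover have "exp (- (\<theta> * a * real (n + 1))) * Z n \<theta> = exp (ln (Z n \<theta>) - \<theta> * a * (n + 1))"
      using Z_pos[OF elim(2)] by (simp add: exp_diff exp_minus divide_inverse mult.commute del: of_nat_Suc of_nat_add)
    ultimately show ?case by simp
  qed
qed

text \<open>The hypothesis \<open>\<theta> * a \<le> \<theta> * x\<close> serves both signs of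
  \<open>\<theta>\<close>, hence right and left half-lines alike.\<close>

lemma chernoff:
  assumes int: "integrable M (\<lambda>\<omega>. exp (\<theta> * S n \<omega>))" and E[measurable]: "E \<in> sets borel"
    and le: "\<And>x. x \<in> E \<Longrightarrow> \<theta> * a \<le> \<theta> * x"
  shows "prob (mean_in E n) \<le> exp (- (\<theta> * a * real (n + 1))) * Z n \<theta>"
proof -
  let ?E = "mean_in E n"
  have "prob ?E = expectation (indicator ?E)" by simp
  also have "\<dots> \<le> expectation (\<lambda>\<omega>. exp (- (\<theta> * a * real (n + 1))) * exp (\<theta> * S n \<omega>))"
  proof (rule integral_mono)
    fix \<omega>
    show "indicator ?E \<omega> \<le> exp (- (\<theta> * a * real (n + 1))) * exp (\<theta> * S n \<omega>)"
    proof (cases "\<omega> \<in> ?E")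
      case True
      then have "\<theta> * a \<le> \<theta> * (S n \<omega> / real (n + 1))"
        by (intro le) (simp del: of_nat_Suc of_nat_add)
      then have "\<theta> * a * real (n + 1) \<le> \<theta> * (S n \<omega> / real (n + 1)) * real (n + 1)"
        by (rule mult_right_mono) simp
      then have "0 \<le> - (\<theta> * a * real (n + 1)) + \<theta> * S n \<omega>" by (simp del: of_nat_Suc of_nat_add)
      then show ?thesis using True by (simp add: mult_exp_exp del: of_nat_Suc of_nat_add)
    qed simp
    show "integrable M (indicat_real ?E)" by (intro integrable_real_indicator) (auto simp: less_top[symmetric])
  qed (use int in auto)
  also have "\<dots> = exp (- (\<theta> * a * real (n + 1))) * Z n \<theta>" by (simp add: Z_def)
  finally show ?thesis .
qed

lemma log_prob_rate_upperI:
  assumes "\<forall>\<^sub>F n in sequentially. emeasure M (A n) \<le> ennreal (C * exp (- (real n * y)))" and C: "0 < C"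
  shows "limsup (log_prob_rate M A) \<le> ereal (- y)"
proof -
  have "\<forall>\<^sub>F n in sequentially. log_prob_rate M A n \<le> ereal (ln C * (1 / real n) - y)"
    using assms(1) eventually_gt_at_top[of 0]
  proof eventually_elim
    case (elim n)
    have "eln (emeasure M (A n)) \<le> eln (ennreal (C * exp (- (real n * y))))" by (rule eln_mono) fact
    also have "\<dots> = ereal (ln C - n * y)" using C by (subst eln_ennreal) (auto simp: ln_mult)
    finally have "log_prob_rate M A n \<le> ereal (1 / n) * ereal (ln C - n * y)"
      unfolding log_prob_rate_def by (intro ereal_mult_left_mono) auto
    also have "\<dots> = ereal (ln C * (1 / real n) - y)" using elim by (simp add: field_simps)
    finally show ?case .
  qed
  then have "limsup (log_prob_rate M A) \<le> limsup (\<lambda>n. ereal (ln C * (1 / real n) - y))" by (rule Limsup_mono)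
  also have "(\<lambda>n. ereal (ln C * (1 / real n) - y)) \<longlonglongrightarrow> ereal (ln C * 0 - y)"
    by (intro tendsto_intros lim_1_over_n)
  then have "limsup (\<lambda>n. ereal (ln C * (1 / real n) - y)) = ereal (ln C * 0 - y)"
    by (intro lim_imp_Limsup) auto
  finally show ?thesis by simp
qed

lemma log_prob_rate_lowerI:
  assumes "\<forall>\<^sub>F n in sequentially. emeasure M (A n) \<ge> ennreal (exp (real n * a n))"  and a: "a \<longlonglongrightarrow> - y"
  shows "ereal (- y) \<le> liminf (log_prob_rate M A)"
proof -
  have "\<forall>\<^sub>F n in sequentially. log_prob_rate M A n \<ge> ereal (a n)"
    using assms(1) eventually_gt_at_top[of 0]
  proof eventually_elim
    case (elim n)
    have "ereal (a n) = ereal (1 / n) * ereal (n * a n)" using elim by (simp add: field_simps)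
    also have "ereal (n * a n) = eln (ennreal (exp (n * a n)))" by (subst eln_ennreal) auto
    also have "ereal (1 / n) * eln (ennreal (exp (n * a n))) \<le> log_prob_rate M A n"
      unfolding log_prob_rate_def by (intro ereal_mult_left_mono eln_mono elim) auto
    finally show ?case .
  qed
  then have "liminf (\<lambda>n. ereal (a n)) \<le> liminf (log_prob_rate M A)" by (rule Liminf_mono)
  moreover have "liminf (\<lambda>n. ereal (a n)) = ereal (- y)"
    using a by (intro lim_imp_Liminf) auto
  ultimately show ?thesis by simp
qed

text \<open>The point \<open>D 0\<close> separates positive from negative exponents, and
  \<open>sg\<close> selects the side. It is enough to look at the point \<open>a\<close> of
  \<open>G\<close> nearest to \<open>D 0\<close>: since
  \<open>\<theta> * D 0 \<le> \<Lambda> \<theta>\<close> and \<open>0 \<le> y\<close>, an exponent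
  that witnesses \<open>y < rate a\<close> must have the sign of \<open>sg\<close>, and then the
  Chernoff bound at \<open>a\<close> covers all of \<open>G\<close>.\<close>

lemma half_line_bound:
  assumes F: "closed F" and y: "0 \<le> y" "\<And>x. x \<in> F \<Longrightarrow> ereal y < rate x"
    and sgn: "sg = 1 \<or> sg = (-1::real)"
    and G: "G = {x \<in> F. sg * D 0 \<le> sg * x}"
  shows "\<forall>\<^sub>F n in sequentially. prob (mean_in G n) \<le> exp (- (real n * y))"
proof (cases "G = {}")
  case True then show ?thesis by simp
next
  case False
  have clG: "closed G"
  proof -
    have "G = F \<inter> {x. sg * D 0 \<le> sg * x}" using G by auto
    then show ?thesis using F by (auto intro!: closed_Int closed_Collect_le continuous_intros)
  qed
  have [measurable]: "G \<in> sets borel" using clG by (rule borel_closed)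
  obtain a where a: "a \<in> G" "\<And>x. x \<in> G \<Longrightarrow> dist (D 0) a \<le> dist (D 0) x"
    using distance_attains_inf[OF clG False] by metis
  have a': "sg * a \<le> sg * x" if "x \<in> G" for x
    using a(2)[OF that] a(1) that sgn G by (auto simp: dist_real_def)
  obtain \<theta> where \<theta>: "\<theta> < c" "y < \<theta> * a - \<Lambda> \<theta>"
    using y(2)[of a] a(1) G unfolding rate_def less_SUP_iff by auto
  have "\<theta> * D 0 \<le> \<Lambda> \<theta>" using tangent[of \<theta> 0] c_pos \<theta>(1) \<Lambda>_0 by simp
  then have pos: "0 < \<theta> * (a - D 0)" using \<theta>(2) y(1) by (simp add: algebra_simps)
  have "0 \<le> sg * (a - D 0)" using a(1) G by (auto simp: algebra_simps)
  then have sg\<theta>: "0 \<le> sg * \<theta>" using pos sgn by (auto simp: zero_less_mult_iff)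
  have "\<theta> * a \<le> \<theta> * x" if "x \<in> G" for x
    using a'[OF that] sg\<theta> sgn by (auto intro: mult_left_mono mult_left_mono_neg)
  then have *: "integrable M (\<lambda>\<omega>. exp (\<theta> * S n \<omega>)) \<Longrightarrow>
    prob (mean_in G n) \<le> exp (- (\<theta> * a * real (n + 1))) * Z n \<theta>" for n
    by (intro chernoff) auto
  show ?thesis using exp_bound_eventually[OF \<theta>] mgf_finite[OF \<theta>(1)]
    by eventually_elim (use * in \<open>auto intro: order_trans\<close>)
qed

lemma LDP_upper:
  assumes E[measurable]: "E \<in> sets borel"
  shows "limsup (log_prob_rate M (mean_in E)) \<le> - (INF s\<in>closure E. rate s)"
    (is "?L \<le> - ?m")
proof -
  have triv: "?L \<le> ereal (- 0)"
    by (rule log_prob_rate_upperI[of _ 1]) (auto intro!: always_eventually simp: one_ennreal_def[symmetric] emeasure_le_1)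
  \<comment> \<open>Both halves of \<open>closure E\<close> are bounded at a level \<open>y\<close>
    below the infimum; the resulting factor 2 disappears on the exponential scale. Working with
    finite \<open>y\<close> also covers an infinite infimum.\<close>
  have main: "?L \<le> - ereal y" if y: "0 \<le> y" "ereal y < ?m" for y
  proof -
    have yr: "ereal y < rate x" if "x \<in> closure E" for x
      using y(2) that by (meson INF_lower less_le_trans)
    let ?G = "\<lambda>sg. {x \<in> closure E. sg * D 0 \<le> sg * x}"
    have [measurable]: "?G sg \<in> sets borel" for sg
    proof -
      have "?G sg = closure E \<inter> {x. sg * D 0 \<le> sg * x}" by auto
      then show ?thesis by (auto intro!: borel_closed closed_Int closed_Collect_le continuous_intros)
    qed
    let ?P = "\<lambda>n G. (mean_in G n)"
    have half: "\<forall>\<^sub>F n in sequentially. prob (?P n (?G sg)) \<le> exp (- (real n * y))" if "sg = 1 \<or> sg = - 1" for sg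
      by (rule half_line_bound[OF closed_closure y(1) yr that refl])
    have "\<forall>\<^sub>F n in sequentially. emeasure M (?P n E) \<le> ennreal (2 * exp (- (real n * y)))"
      using half[of 1, OF disjI1[OF refl]] half[of "- 1", OF disjI2[OF refl]]
    proof eventually_elim
      case (elim n)
      have "prob (?P n E) \<le> prob (?P n (?G 1) \<union> ?P n (?G (-1)))"
        using closure_subset[of E] by (intro finite_measure_mono sets.Un) (force, measurable)
      also have "\<dots> \<le> prob (?P n (?G 1)) + prob (?P n (?G (-1)))"
        by (rule measure_subadditive; (measurable | simp add: emeasure_eq_measure))
      also have "\<dots> \<le> 2 * exp (- (real n * y))" using elim by simp
      finally show ?case by (simp add: emeasure_eq_measure)
    qed
    from log_prob_rate_upperI[OF this] show ?thesis by simp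
  qed
  show ?thesis
  proof (cases "?m \<le> 0")
    case True
    have "0 \<le> ?m" by (intro INF_greatest rate_nonneg)
    then have "?m = 0" using True by simp
    then show ?thesis using triv by (simp add: zero_ereal_def)
  next
    case False
    have "?m \<le> - ?L"
    proof (rule dense_le_bounded[of "0::ereal"])
      show "0 < ?m" using False by simp
      fix w :: ereal assume w: "0 < w" "w < ?m"
      then obtain y where "w = ereal y" "0 < y" by (cases w) auto
      then show "w \<le> - ?L" using main[of y] w by (subst ereal_le_uminus_swap) auto
    qed
    then show ?thesis by (subst ereal_le_uminus_swap)
  qed
qed

section \<open>The lower bound by exponential tilting\<close>

lemma tilt_gap:
  assumes "\<theta> < c" "0 < \<delta>"
  obtains \<eta> where "0 < \<eta>" "\<theta> + \<eta> < c" "\<Lambda> (\<theta> + \<eta>) - \<eta> * (D \<theta> + \<delta>) < \<Lambda> \<theta>"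
    "\<Lambda> (\<theta> - \<eta>) + \<eta> * (D \<theta> - \<delta>) < \<Lambda> \<theta>"
proof -
  \<comment> \<open>Differentiability at \<open>\<theta>\<close> is what makes the law tilted by
    \<open>\<theta>\<close> concentrate at \<open>D \<theta>\<close>: for small
    \<open>\<eta>\<close> the difference quotients on both sides are within \<open>\<delta>\<close>
    of \<open>D \<theta>\<close>.\<close>
  have lim: "((\<lambda>h. (\<Lambda> (\<theta> + h) - \<Lambda> \<theta>) / h) \<longlongrightarrow> D \<theta>) (at 0)"
    using deriv[OF assms(1)] by (simp add: DERIV_def)
  then have "\<forall>\<^sub>F h in at 0. dist ((\<Lambda> (\<theta> + h) - \<Lambda> \<theta>) / h) (D \<theta>) < \<delta>"
    using assms(2) by (rule tendstoD)
  then obtain d where d: "0 < d" "\<And>h. h \<noteq> 0 \<Longrightarrow> dist h 0 < d \<Longrightarrow> dist ((\<Lambda> (\<theta> + h) - \<Lambda> \<theta>) / h) (D \<theta>) < \<delta>"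
    unfolding eventually_at by auto
  define \<eta> where "\<eta> = min (d/2) ((c - \<theta>)/2)"
  have \<eta>: "0 < \<eta>" "\<eta> < d" "\<theta> + \<eta> < c" using d(1) assms(1) by (auto simp: \<eta>_def min_def field_simps)
  have "dist ((\<Lambda> (\<theta> + \<eta>) - \<Lambda> \<theta>) / \<eta>) (D \<theta>) < \<delta>" "dist ((\<Lambda> (\<theta> + -\<eta>) - \<Lambda> \<theta>) / (-\<eta>)) (D \<theta>) < \<delta>"
    using \<eta> by (intro d(2); simp)+
  then have "(\<Lambda> (\<theta> + \<eta>) - \<Lambda> \<theta>) / \<eta> < D \<theta> + \<delta>" "(\<Lambda> \<theta> - \<Lambda> (\<theta> - \<eta>)) / \<eta> > D \<theta> - \<delta>"
    by (auto simp: dist_real_def abs_less_iff diff_divide_distrib)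
  then have "\<Lambda> (\<theta> + \<eta>) - \<eta> * (D \<theta> + \<delta>) < \<Lambda> \<theta>" "\<Lambda> (\<theta> - \<eta>) + \<eta> * (D \<theta> - \<delta>) < \<Lambda> \<theta>"
    using \<eta>(1) by (auto simp: field_simps)
  then show ?thesis using that \<eta> by blast
qed

text \<open>A change of measure without constructing the tilted law. \<open>Z n \<theta>\<close> is
  split into the part with mean in the ball and two tails; tilting further by \<open>\<eta>\<close>
  or \<open>- \<eta>\<close> shows that each tail is at most a quarter of
  \<open>Z n \<theta>\<close>, so at least half comes from the ball, where the exponential is
  bounded.\<close>

lemma local_lower:
  assumes \<theta>: "\<theta> < c" and \<delta>: "0 < \<delta>"
  shows "\<forall>\<^sub>F n in sequentially. exp (- (\<theta> * D \<theta> + \<bar>\<theta>\<bar> * \<delta>) * real (n + 1)) * (Z n \<theta> / 2)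
     \<le> prob (mean_in (ball (D \<theta>) \<delta>) n)"
proof -
  let ?s = "D \<theta>"
  obtain \<eta> where \<eta>: "0 < \<eta>" "\<theta> + \<eta> < c" "\<Lambda> (\<theta> + \<eta>) - \<eta> * (?s + \<delta>) < \<Lambda> \<theta>"
    "\<Lambda> (\<theta> - \<eta>) + \<eta> * (?s - \<delta>) < \<Lambda> \<theta>"
    using tilt_gap[OF assms] by blast
  define g1 where "g1 = (\<lambda>n. exp (- (\<eta> * (?s + \<delta>) * real (n + 1))) * Z n (\<theta> + \<eta>))"
  define g2 where "g2 = (\<lambda>n. exp (\<eta> * (?s - \<delta>) * real (n + 1)) * Z n (\<theta> - \<eta>))"
  have \<eta>2: "\<theta> - \<eta> < c" using \<theta> \<eta> by simp
  \<comment> \<open>Here \<open>r\<close> is the exponent per step in front of a tail integral. The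
    strict inequality between the limits beats the factor 4, whose logarithm is negligible against
    \<open>n\<close>.\<close>
  have small: "\<forall>\<^sub>F n in sequentially. exp (r * real (n + 1)) * Z n \<theta>' \<le> Z n \<theta> / 4"
    if "\<theta>' < c" "\<Lambda> \<theta>' + r < \<Lambda> \<theta>" for \<theta>' r
  proof -
    have "(\<lambda>n. ln (Z n \<theta>') / n + r + r * (1 / real n) - ln (Z n \<theta>) / n + ln 4 * (1 / n)) \<longlonglongrightarrow> \<Lambda> \<theta>' + r + r * 0 - \<Lambda> \<theta> + ln 4 * 0"
      by (intro tendsto_intros ln_Z_lim lim_1_over_n that \<theta>)
    then have "\<forall>\<^sub>F n in sequentially. ln (Z n \<theta>') / n + r + r * (1 / real n) - ln (Z n \<theta>) / n + ln 4 * (1 / n) < 0"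
      using that by (intro order_tendstoD) auto
    then show ?thesis using mgf_finite[OF \<theta>] mgf_finite[OF that(1)] eventually_gt_at_top[of 0]
    proof eventually_elim
      case (elim n)
      have "n * (ln (Z n \<theta>') / n + r + r * (1 / real n) - ln (Z n \<theta>) / n + ln 4 * (1 / n)) < real n * 0"
        using elim by (intro mult_strict_left_mono) auto
      then have "r * (n + 1) + ln (Z n \<theta>') < ln (Z n \<theta>) - ln 4" using elim by (simp add: algebra_simps)
      then have "exp (r * (n + 1) + ln (Z n \<theta>')) \<le> exp (ln (Z n \<theta>) - ln 4)" by simp
      then show ?case using Z_pos[OF elim(2)] Z_pos[OF elim(3)] by (simp add: exp_add exp_diff)
    qed
  qed
  have s1: "\<forall>\<^sub>F n in sequentially. g1 n \<le> Z n \<theta> / 4"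
    using small[of "\<theta> + \<eta>" "- (\<eta> * (?s + \<delta>))"] \<eta> by (simp add: g1_def)
  have s2: "\<forall>\<^sub>F n in sequentially. g2 n \<le> Z n \<theta> / 4"
    using small[of "\<theta> - \<eta>" "\<eta> * (?s - \<delta>)"] \<eta> \<eta>2 by (simp add: g2_def)
  show ?thesis
    using s1 s2 mgf_finite[OF \<theta>] mgf_finite[OF \<eta>(2)] mgf_finite[OF \<eta>2]
  proof eventually_elim
    case (elim n)
    let ?N = "(mean_in (ball ?s \<delta>) n)"
    let ?k = "exp ((\<theta> * ?s + \<bar>\<theta>\<bar> * \<delta>) * real (n + 1))"
    have "Z n \<theta> \<le> expectation (\<lambda>\<omega>. ?k * indicator ?N \<omega> +
       (exp (- (\<eta> * (?s + \<delta>) * real (n + 1))) * exp ((\<theta> + \<eta>) * S n \<omega>)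
      + exp (\<eta> * (?s - \<delta>) * real (n + 1)) * exp ((\<theta> - \<eta>) * S n \<omega>)))"
      unfolding Z_def
    proof (rule integral_mono)
      have iN: "integrable M (indicat_real ?N)" by (intro integrable_real_indicator) (auto simp: less_top[symmetric])
      show "integrable M (\<lambda>\<omega>. ?k * indicator ?N \<omega> +
       (exp (- (\<eta> * (?s + \<delta>) * real (n + 1))) * exp ((\<theta> + \<eta>) * S n \<omega>)
      + exp (\<eta> * (?s - \<delta>) * real (n + 1)) * exp ((\<theta> - \<eta>) * S n \<omega>)))"
        by (intro Bochner_Integration.integrable_add integrable_mult_right iN elim)
    next
      fix \<omega> assume \<omega>: "\<omega> \<in> space M"
      define x where "x = S n \<omega> / real (n + 1)"
      have x: "S n \<omega> = x * real (n + 1)" by (simp add: x_def del: of_nat_Suc of_nat_add)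
      consider "\<omega> \<in> ?N" | "x \<ge> ?s + \<delta>" | "x \<le> ?s - \<delta>"
      proof -
        have "\<omega> \<in> ?N \<longleftrightarrow> \<bar>x - ?s\<bar> < \<delta>" using \<omega> unfolding x_def by (simp add: dist_real_def abs_minus_commute del: of_nat_Suc of_nat_add)
        then show thesis using that by linarith
      qed
      then show "exp (\<theta> * S n \<omega>) \<le> ?k * indicator ?N \<omega> +
       (exp (- (\<eta> * (?s + \<delta>) * real (n + 1))) * exp ((\<theta> + \<eta>) * S n \<omega>)
      + exp (\<eta> * (?s - \<delta>) * real (n + 1)) * exp ((\<theta> - \<eta>) * S n \<omega>))" (is "_ \<le> _ + (?a + ?b)")
      proof cases
        case 1
        then have "\<bar>x - ?s\<bar> \<le> \<delta>" unfolding x_def by (simp add: dist_real_def abs_minus_commute del: of_nat_Suc of_nat_add)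
        then have "\<bar>\<theta>\<bar> * \<bar>x - ?s\<bar> \<le> \<bar>\<theta>\<bar> * \<delta>" by (intro mult_left_mono) auto
        moreover have "\<theta> * (x - ?s) \<le> \<bar>\<theta>\<bar> * \<bar>x - ?s\<bar>" by (metis abs_ge_self abs_mult)
        ultimately have "\<theta> * x \<le> \<theta> * ?s + \<bar>\<theta>\<bar> * \<delta>" by (simp add: algebra_simps)
        then have "\<theta> * x * real (n + 1) \<le> (\<theta> * ?s + \<bar>\<theta>\<bar> * \<delta>) * real (n + 1)" by (intro mult_right_mono) auto
        then have "exp (\<theta> * S n \<omega>) \<le> ?k" by (simp add: x mult.assoc del: of_nat_Suc of_nat_add)
        moreover have "0 \<le> ?a" "0 \<le> ?b" by auto
        moreover have "?k * indicator ?N \<omega> = ?k" using 1 by simp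
        ultimately show ?thesis by linarith
      next
        case 2
        have "\<theta> * S n \<omega> \<le> - (\<eta> * (?s + \<delta>) * real (n + 1)) + (\<theta> + \<eta>) * S n \<omega>"
          using mult_right_mono[OF mult_left_mono[OF 2, of \<eta>], of "real (n + 1)"] \<eta>(1)
          unfolding x by (simp add: algebra_simps del: of_nat_Suc of_nat_add)
        then have "exp (\<theta> * S n \<omega>) \<le> ?a" by (simp add: mult_exp_exp del: of_nat_Suc of_nat_add)
        moreover have "0 \<le> ?b" "0 \<le> ?k * indicator ?N \<omega>" by auto
        ultimately show ?thesis by linarith
      next
        case 3
        have "\<theta> * S n \<omega> \<le> \<eta> * (?s - \<delta>) * real (n + 1) + (\<theta> - \<eta>) * S n \<omega>"
          using mult_right_mono[OF mult_left_mono[OF 3, of \<eta>], of "real (n + 1)"] \<eta>(1)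
          unfolding x by (simp add: algebra_simps del: of_nat_Suc of_nat_add)
        then have "exp (\<theta> * S n \<omega>) \<le> ?b" by (simp add: mult_exp_exp del: of_nat_Suc of_nat_add)
        moreover have "0 \<le> ?a" "0 \<le> ?k * indicator ?N \<omega>" by auto
        ultimately show ?thesis by linarith
      qed
    qed (use elim in auto)
    also have "\<dots> = ?k * prob ?N + (g1 n + g2 n)"
    proof -
      have iN: "integrable M (indicat_real ?N)" by (intro integrable_real_indicator) (auto simp: less_top[symmetric])
      show ?thesis
        unfolding Z_def g1_def g2_def
        by (subst Bochner_Integration.integral_add integral_mult_right_zero, (intro Bochner_Integration.integrable_add integrable_mult_right iN elim)+)+
          simp
    qed
    also have "\<dots> \<le> ?k * prob ?N + Z n \<theta> / 2" using elim by simp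
    finally have "Z n \<theta> / 2 \<le> ?k * prob ?N" by simp
    then have "inverse ?k * (Z n \<theta> / 2) \<le> inverse ?k * (?k * prob ?N)" by (intro mult_left_mono) auto
    then have "exp (- ((\<theta> * ?s + \<bar>\<theta>\<bar> * \<delta>) * real (n + 1))) * (Z n \<theta> / 2) \<le> prob ?N"
      by (simp add: exp_minus[symmetric] mult_exp_exp mult.assoc[symmetric] del: of_nat_Suc of_nat_add)
    then show ?case by (simp only: mult_minus_left)
  qed
qed

lemma LDP_lower_point:
  assumes E[measurable]: "E \<in> sets borel" and s: "s \<in> interior E"
  shows "- rate s \<le> liminf (log_prob_rate M (mean_in E))" (is "_ \<le> ?L")
proof (cases "0 < s")
  case False
  then show ?thesis by (simp add: rate_nonpos)
next
  case True
  then obtain \<theta> where \<theta>: "\<theta> < c" "D \<theta> = s" using D_range by blast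
  obtain e where e: "0 < e" "ball s e \<subseteq> E"
    using s by (meson mem_interior)
  have main: "ereal (- (\<theta> * s - \<Lambda> \<theta> + \<bar>\<theta>\<bar> * \<delta>)) \<le> ?L" if \<delta>: "0 < \<delta>" "\<delta> \<le> e" for \<delta>
  proof (rule log_prob_rate_lowerI)
    define q where "q = - (\<theta> * s + \<bar>\<theta>\<bar> * \<delta>)"
    define a where "a = (\<lambda>n. q + q * (1 / real n) + ln (Z n \<theta>) / real n - ln 2 * (1 / real n))"
    have "a \<longlonglongrightarrow> q + q * 0 + \<Lambda> \<theta> - ln 2 * 0"
      unfolding a_def by (intro tendsto_intros ln_Z_lim lim_1_over_n \<theta>)
    moreover have "q + q * 0 + \<Lambda> \<theta> - ln 2 * 0 = - (\<theta> * s - \<Lambda> \<theta> + \<bar>\<theta>\<bar> * \<delta>)" by (simp add: q_def)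
    ultimately show "a \<longlonglongrightarrow> - (\<theta> * s - \<Lambda> \<theta> + \<bar>\<theta>\<bar> * \<delta>)" by metis
    show "\<forall>\<^sub>F n in sequentially. ennreal (exp (real n * a n)) \<le> emeasure M (mean_in E n)"
      using local_lower[OF \<theta>(1) \<delta>(1)] mgf_finite[OF \<theta>(1)] eventually_gt_at_top[of 0]
    proof eventually_elim
      case (elim n)
      have "exp (n * a n) = exp (q * (n + 1) + ln (Z n \<theta>) - ln 2)"
        using elim(3) by (simp add: a_def field_simps)
      also have "\<dots> = exp (q * real (n + 1)) * (Z n \<theta> / 2)"
        using Z_pos[OF elim(2)] by (simp add: exp_diff exp_add del: of_nat_Suc of_nat_add)
      also have "\<dots> \<le> prob (mean_in (ball s \<delta>) n)"
        using elim(1) by (simp add: q_def \<theta> del: of_nat_Suc of_nat_add)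
      also have "\<dots> \<le> prob (mean_in E n)"
        using e(2) \<delta>(2) by (intro finite_measure_mono) (auto simp del: of_nat_Suc of_nat_add)
      finally show ?case by (simp add: emeasure_eq_measure)
    qed
  qed
  \<comment> \<open>The radius shrinks only after \<open>n\<close> has tended to infinity; this
    removes the loss \<open>\<bar>\<theta>\<bar> * \<delta>\<close>.\<close>
  have "((\<lambda>\<delta>. ereal (- (\<theta> * s - \<Lambda> \<theta> + \<bar>\<theta>\<bar> * \<delta>))) \<longlongrightarrow> ereal (- (\<theta> * s - \<Lambda> \<theta> + \<bar>\<theta>\<bar> * 0))) (at_right 0)"
    by (intro tendsto_intros)
  moreover have "\<forall>\<^sub>F \<delta> in at_right 0. ereal (- (\<theta> * s - \<Lambda> \<theta> + \<bar>\<theta>\<bar> * \<delta>)) \<le> ?L"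
    using eventually_at_right_real[OF e(1)] by eventually_elim (use main in auto)
  ultimately have "ereal (- (\<theta> * s - \<Lambda> \<theta> + \<bar>\<theta>\<bar> * 0)) \<le> ?L"
    by (intro tendsto_upperbound) auto
  then show ?thesis using rate_at_D[OF \<theta>(1)] \<theta>(2) by simp
qed

lemma LDP: "satisfies_LDP M (\<lambda>n \<omega>. S n \<omega> / real (n + 1)) rate"
  unfolding satisfies_LDP_def
proof (intro conjI allI ballI rate_function_rate)
  fix E :: "real set" assume E: "E \<in> sets borel"
  show "- (INF s\<in>interior E. rate s) \<le> liminf (log_prob_rate M (\<lambda>K. {\<omega> \<in> space M. S K \<omega> / real (K + 1) \<in> E}))"
    using LDP_lower_point[OF E] by (subst ereal_uminus_le_reorder, intro INF_greatest, subst ereal_uminus_le_reorder) blast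
qed (rule LDP_upper Liminf_le_Limsup sequentially_bot | simp | assumption)+

section \<open>Tail probabilities, and exponents beyond \<open>c\<close>\<close>

lemma rate_right_cont:
  assumes t: "0 < t" "t < s"
  shows "rate s \<le> rate t + ereal (c * (s - t))"
proof -
  \<comment> \<open>The exponent that is optimal at \<open>s\<close> lies below \<open>c\<close>, so
    moving from \<open>t\<close> to \<open>s\<close> raises the rate with slope at most
    \<open>c\<close>.\<close>
  obtain \<theta> where \<theta>: "\<theta> < c" "D \<theta> = s" using D_range t by (meson less_trans)
  have "rate s = ereal (\<theta> * s - \<Lambda> \<theta>)" using rate_at_D \<theta> by blast
  also have "\<dots> = ereal (\<theta> * t - \<Lambda> \<theta>) + ereal (\<theta> * (s - t))" by (simp add: algebra_simps)
  also have "\<dots> \<le> rate t + ereal (c * (s - t))"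
    using \<theta> t by (intro add_mono rate_ge) (auto intro: mult_right_mono)
  finally show ?thesis .
qed

lemma tail_limit:
  assumes t: "0 < t"
  shows "log_prob_rate M (\<lambda>n. {\<omega> \<in> space M. S n \<omega> / real (n + 1) \<ge> t}) \<longlonglongrightarrow> - (INF s\<in>{t..}. rate s)"
    (is "?r \<longlonglongrightarrow> - ?m")
proof -
  have r: "?r = log_prob_rate M (\<lambda>n. {\<omega> \<in> space M. S n \<omega> / real (n + 1) \<in> {t..}})" by simp
  have up: "limsup ?r \<le> - ?m" unfolding r using LDP_upper[of "{t..}"] by simp
  have low: "- rate s \<le> liminf ?r" if "t < s" for s
    unfolding r using that by (intro LDP_lower_point) (auto simp: interior_Ici[of "t - 1"])
  have "- liminf ?r \<le> ?m"
  proof (rule INF_greatest)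
    fix s assume s: "s \<in> {t..}"
    show "- liminf ?r \<le> rate s"
    proof (cases "t = s")
      case False
      then show ?thesis using low[of s] s by (simp add: ereal_uminus_le_reorder)
    next
      case True
      \<comment> \<open>The interior of \<open>{t..}\<close> omits \<open>t\<close>, so the bound at
        \<open>t\<close> is obtained from the points \<open>t + e\<close> through
        \<open>rate_right_cont\<close>.\<close>
      have "((\<lambda>e. rate t + ereal (c * e)) \<longlongrightarrow> rate t + ereal (c * 0)) (at_right 0)"
        by (intro tendsto_add_ereal_general tendsto_intros) (auto)
      moreover have "\<forall>\<^sub>F e in at_right 0. - liminf ?r \<le> rate t + ereal (c * e)"
        using eventually_at_right_real[OF zero_less_one]
      proof eventually_elim
        case (elim e)
        have "- liminf ?r \<le> rate (t + e)" using low[of "t + e"] elim by (simp add: ereal_uminus_le_reorder)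
        also have "\<dots> \<le> rate t + ereal (c * e)" using rate_right_cont[of t "t + e"] t elim by simp
        finally show ?case .
      qed
      ultimately have "- liminf ?r \<le> rate t + ereal (c * 0)"
        by (intro tendsto_lowerbound) auto
      then show ?thesis using True by (simp flip: zero_ereal_def)
    qed
  qed
  then have "- ?m \<le> liminf ?r" by (simp add: ereal_uminus_le_reorder)
  moreover have "liminf ?r \<le> limsup ?r" by (rule Liminf_le_Limsup) simp
  ultimately show ?thesis using up by (intro Liminf_eq_Limsup) auto
qed

text \<open>A finite limit superior beyond \<open>c\<close> would, by convexity, bound the slopes \<open>D\<close> on \<open>{..<c}\<close>,
  contradicting \<open>D_range\<close>.\<close>

lemma supercritical:
  assumes \<theta>: "c < \<theta>"
  shows "limsup (\<lambda>n. ereal (1 / real n) * eln (\<integral>\<^sup>+ \<omega>. ennreal (exp (\<theta> * S n \<omega>)) \<partial>M)) = \<infinity>" (is "limsup ?f = _")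
proof (rule ccontr)
  assume "limsup ?f \<noteq> \<infinity>"
  then obtain C where C: "limsup ?f < ereal C"
    using less_PInf_Ex_of_nat[of "limsup ?f"] by auto
  have ev: "\<forall>\<^sub>F n in sequentially. integrable M (\<lambda>\<omega>. exp (\<theta> * S n \<omega>)) \<and> ln (Z n \<theta>) / n \<le> C"
    using Limsup_lessD[OF C] eventually_gt_at_top[of 0]
  proof eventually_elim
    case (elim n)
    let ?J = "\<integral>\<^sup>+ \<omega>. ennreal (exp (\<theta> * S n \<omega>)) \<partial>M"
    have fin: "?J < \<infinity>"
    proof (rule ccontr)
      assume "\<not> ?J < \<infinity>"
      then have "?J = \<infinity>" by (simp add: less_top[symmetric])
      then show False using elim by (simp add: eln_def)
    qed
    have int: "integrable M (\<lambda>\<omega>. exp (\<theta> * S n \<omega>))"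
      using fin by (intro integrableI_nonneg) auto
    have J: "?J = ennreal (Z n \<theta>)" unfolding Z_def using int by (intro nn_integral_eq_integral) auto
    have "ereal (1 / n) * ereal (ln (Z n \<theta>)) < ereal C"
      using elim Z_pos[OF int] unfolding J by (simp add: eln_ennreal)
    then show ?case using int by simp
  qed
  have bd: "(\<theta> - \<theta>0) * D \<theta>0 + \<Lambda> \<theta>0 \<le> C" if \<theta>0: "\<theta>0 < c" for \<theta>0
  proof -
    \<comment> \<open>With this \<open>t\<close> the point \<open>m\<close> is the midpoint of
      \<open>\<theta>0\<close> and \<open>c\<close>, where the limit is known.\<close>
    define t where "t = (c - \<theta>0) / (2 * (\<theta> - \<theta>0))"
    have t: "0 < t" "t \<le> 1" and ts: "t * (\<theta> - \<theta>0) = (c - \<theta>0) / 2" using \<theta>0 \<theta> by (auto simp: t_def field_simps)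
    define m where "m = (1 - t) * \<theta>0 + t * \<theta>"
    have m': "m = \<theta>0 + t * (\<theta> - \<theta>0)" by (simp add: m_def algebra_simps)
    have m: "m < c" using \<theta>0 unfolding m' ts by (simp add: field_simps)
    have "\<forall>\<^sub>F n in sequentially. ln (Z n m) / n \<le> (1 - t) * (ln (Z n \<theta>0) / n) + t * C"
      using ev mgf_finite[OF \<theta>0] mgf_finite[OF m]
    proof eventually_elim
      case (elim n)
      then have "ln (Z n m) \<le> (1 - t) * ln (Z n \<theta>0) + t * ln (Z n \<theta>)"
        using t unfolding m_def by (intro ln_mgf_convex) auto
      then have "ln (Z n m) / n \<le> ((1 - t) * ln (Z n \<theta>0) + t * ln (Z n \<theta>)) / n" by (intro divide_right_mono) auto
      also have "\<dots> = (1 - t) * (ln (Z n \<theta>0) / n) + t * (ln (Z n \<theta>) / n)" by (simp add: add_divide_distrib)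
      also have "\<dots> \<le> (1 - t) * (ln (Z n \<theta>0) / n) + t * C" using elim t by (intro add_left_mono mult_left_mono) auto
      finally show ?case .
    qed
    then have "\<Lambda> m \<le> (1 - t) * \<Lambda> \<theta>0 + t * C"
      by (intro tendsto_le[OF _ tendsto_add[OF tendsto_mult_left[OF ln_Z_lim[OF \<theta>0]] tendsto_const] ln_Z_lim[OF m]]) auto
    moreover have "\<Lambda> \<theta>0 + (m - \<theta>0) * D \<theta>0 \<le> \<Lambda> m" by (rule tangent[OF m \<theta>0])
    ultimately have "t * ((\<theta> - \<theta>0) * D \<theta>0 + \<Lambda> \<theta>0) \<le> t * C" unfolding m' by (simp add: algebra_simps)
    then show ?thesis using t by simp
  qed
  \<comment> \<open>The value makes \<open>(\<theta> - c) * s\<close> strictly larger than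
    \<open>\<bar>C\<bar> + c * \<bar>D 0\<bar>\<close>, which contradicts the extended tangent bound
    \<open>bd\<close>. Exceeding \<open>D 0\<close> forces the exponent with slope \<open>s\<close>
    to be nonnegative.\<close>
  define s where "s = \<bar>D 0\<bar> + 1 + (\<bar>C\<bar> + c * \<bar>D 0\<bar>) / (\<theta> - c)"
  have frac: "0 \<le> (\<bar>C\<bar> + c * \<bar>D 0\<bar>) / (\<theta> - c)" using \<theta> c_pos by simp
  then have s: "0 < s" "D 0 < s" by (auto simp: s_def)
  obtain \<theta>0 where \<theta>0: "\<theta>0 < c" "D \<theta>0 = s" using D_range s by blast
  have t1: "\<theta>0 * D 0 \<le> \<Lambda> \<theta>0" using tangent[of \<theta>0 0] \<theta>0 c_pos \<Lambda>_0 by simp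
  have t2: "\<Lambda> \<theta>0 - \<theta>0 * s \<le> 0" using tangent[of 0 \<theta>0] \<theta>0 c_pos \<Lambda>_0 by simp
  have "0 \<le> \<theta>0 * (s - D 0)" using t1 t2 by (simp add: algebra_simps)
  then have "0 \<le> \<theta>0" using s by (simp add: zero_le_mult_iff)
  have "- (c * \<bar>D 0\<bar>) \<le> \<theta>0 * D 0"
  proof -
    have "\<theta>0 * \<bar>D 0\<bar> \<le> c * \<bar>D 0\<bar>" using \<theta>0 by (intro mult_right_mono) auto
    moreover have "\<theta>0 * (- \<bar>D 0\<bar>) \<le> \<theta>0 * D 0" using \<open>0 \<le> \<theta>0\<close> by (intro mult_left_mono) auto
    ultimately show ?thesis by simp
  qed
  then have "(\<theta> - \<theta>0) * s - c * \<bar>D 0\<bar> \<le> C" using bd[OF \<theta>0(1)] t1 \<theta>0 by simp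
  moreover have "(\<theta> - c) * s \<le> (\<theta> - \<theta>0) * s" using s \<theta>0 by (intro mult_right_mono) auto
  moreover have "(\<theta> - c) * s = (\<theta> - c) * (\<bar>D 0\<bar> + 1) + (\<bar>C\<bar> + c * \<bar>D 0\<bar>)"
    using \<theta> by (simp add: s_def field_simps)
  moreover have "0 < (\<theta> - c) * (\<bar>D 0\<bar> + 1)" using \<theta> by (intro mult_pos_pos) auto
  ultimately show False by linarith
qed

end

section \<open>The scalar recursion with a quadratic exponential weight\<close>

lemma nn_integral_gauss:
  assumes "0 < a"
  shows "(\<integral>\<^sup>+ y. ennreal (exp (- (a * (y + m)\<^sup>2))) \<partial>lborel) = ennreal (sqrt (pi / a))"
proof -
  let ?s = "sqrt (1 / (2 * a))"
  have s: "?s > 0" "2 * ?s\<^sup>2 = 1 / a" using assms by auto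
  have "exp (- (a * (y + m)\<^sup>2)) = sqrt (pi / a) * normal_density (- m) ?s y" for y
    using s assms by (simp add: normal_density_def real_sqrt_divide real_sqrt_mult)
  then have "(\<integral>\<^sup>+ y. ennreal (exp (- (a * (y + m)\<^sup>2))) \<partial>lborel)
      = (\<integral>\<^sup>+ y. ennreal (sqrt (pi / a)) * ennreal (normal_density (- m) ?s y) \<partial>lborel)"
    using assms by (intro nn_integral_cong) (simp add: ennreal_mult)
  also have "\<dots> = ennreal (sqrt (pi / a)) * (\<integral>\<^sup>+ y. ennreal (normal_density (- m) ?s y) \<partial>lborel)"
    by (rule nn_integral_cmult) simp
  also have "(\<integral>\<^sup>+ y. ennreal (normal_density (- m) ?s y) \<partial>lborel) = 1"
    using s by (subst nn_integral_eq_integral) (auto simp: integrable_normal_density integral_normal_density)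
  finally show ?thesis by simp
qed

lemma nn_integral_gauss2_finite:
  assumes k: "0 < k" and r: "0 < r" and det: "0 < p * r - q\<^sup>2"
  shows "(\<integral>\<^sup>+ z. ennreal (exp (- (k * (p * (fst z)\<^sup>2 + 2 * q * fst z * snd z + r * (snd z)\<^sup>2)))) \<partial>(lborel \<Otimes>\<^sub>M lborel)) < \<infinity>"
    (is "?I < _")
proof -
  let ?d = "(p * r - q\<^sup>2) / r"
  have eq: "p * u\<^sup>2 + 2 * q * u * v + r * v\<^sup>2 = r * (v + q * u / r)\<^sup>2 + ?d * (u + 0)\<^sup>2" for u v :: real
    using r by (simp add: power2_eq_square field_simps)
  have "?I = (\<integral>\<^sup>+ u. \<integral>\<^sup>+ v. ennreal (exp (- (k * (p * u\<^sup>2 + 2 * q * u * v + r * v\<^sup>2)))) \<partial>lborel \<partial>lborel)"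
    by (subst lborel.nn_integral_fst[symmetric]) auto
  also have "\<dots> = (\<integral>\<^sup>+ u. ennreal (exp (- (k * ?d * (u + 0)\<^sup>2))) * ennreal (sqrt (pi / (k * r))) \<partial>lborel)"
  proof (rule nn_integral_cong)
    fix u :: real
    have "(\<integral>\<^sup>+ v. ennreal (exp (- (k * (p * u\<^sup>2 + 2 * q * u * v + r * v\<^sup>2)))) \<partial>lborel) =
       (\<integral>\<^sup>+ v. ennreal (exp (- (k * ?d * (u + 0)\<^sup>2))) * ennreal (exp (- (k * r * (v + q * u / r)\<^sup>2))) \<partial>lborel)"
      unfolding eq by (intro nn_integral_cong) (simp add: ennreal_mult[symmetric] mult_exp_exp algebra_simps)
    then show "(\<integral>\<^sup>+ v. ennreal (exp (- (k * (p * u\<^sup>2 + 2 * q * u * v + r * v\<^sup>2)))) \<partial>lborel) =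
       ennreal (exp (- (k * ?d * (u + 0)\<^sup>2))) * ennreal (sqrt (pi / (k * r)))"
      using k r by (simp add: nn_integral_cmult nn_integral_gauss)
  qed
  also have "\<dots> = ennreal (sqrt (pi / (k * ?d))) * ennreal (sqrt (pi / (k * r)))"
  proof -
    have "0 < k * ?d" using k r det by simp
    from nn_integral_gauss[OF this, of 0] show ?thesis by (subst nn_integral_multc) auto
  qed
  also have "\<dots> < \<infinity>" by (simp add: ennreal_mult_less_top)
  finally show ?thesis .
qed

lemma ennreal_rearrange: "a * b = c * d \<Longrightarrow> a * (s * b * p) = s * c * p * (d :: ennreal)"
  by (metis mult.assoc mult.commute)

text \<open>Transition operator of the scalar recursion, with \<open>u\<close> the current and
  \<open>v\<close> the previous value: for \<open>k > 0\<close> the next value \<open>y\<close> is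
  Gaussian with mean \<open>- (b * u + c * v)\<close> and variance \<open>1 / (2 * k)\<close>,
  weighted by \<open>exp (k * \<tau> * y\<^sup>2)\<close>. Values in \<open>ennreal\<close> keep it
  meaningful when the weighted integral diverges.\<close>

definition ar_step :: "real \<Rightarrow> real \<Rightarrow> real \<Rightarrow> real \<Rightarrow> (real \<Rightarrow> real \<Rightarrow> ennreal) \<Rightarrow> real \<Rightarrow> real \<Rightarrow> ennreal" where
  "ar_step b c k \<tau> \<psi> u v =
    (\<integral>\<^sup>+ y. ennreal (sqrt (k / pi) * exp (- (k * ((y + b * u + c * v)\<^sup>2 - \<tau> * y\<^sup>2)))) * \<psi> y u \<partial>lborel)"

lemma ar_step_measurable [measurable]:
  assumes [measurable]: "case_prod \<psi> \<in> borel_measurable (borel \<Otimes>\<^sub>M borel)"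
  shows "case_prod (ar_step b c k \<tau> \<psi>) \<in> borel_measurable (borel \<Otimes>\<^sub>M borel)"
proof -
  have [measurable]: "(\<lambda>(p, y). \<psi> y (fst p)) \<in> borel_measurable ((borel \<Otimes>\<^sub>M borel) \<Otimes>\<^sub>M lborel)"
    using assms by measurable
  show ?thesis
    unfolding ar_step_def case_prod_beta by measurable
qed

lemma ar_iter_measurable [measurable]:
  assumes "case_prod \<psi> \<in> borel_measurable (borel \<Otimes>\<^sub>M borel)"
  shows "case_prod ((ar_step b c k \<tau> ^^ n) \<psi>) \<in> borel_measurable (borel \<Otimes>\<^sub>M borel)"
  by (induction n) (use assms in \<open>auto intro: ar_step_measurable\<close>)

lemma ar_step_mono:
  assumes "\<And>u v. \<psi> u v \<le> \<psi>' u v"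
  shows "ar_step b c k \<tau> \<psi> u v \<le> ar_step b c k \<tau> \<psi>' u v"
  unfolding ar_step_def by (intro nn_integral_mono mult_left_mono assms) auto

lemma ar_iter_mono:
  assumes "\<And>u v. \<psi> u v \<le> \<psi>' u v"
  shows "(ar_step b c k \<tau> ^^ n) \<psi> u v \<le> (ar_step b c k \<tau> ^^ n) \<psi>' u v"
  by (induction n arbitrary: u v) (auto intro: assms ar_step_mono)

lemma measurable_sections:
  fixes \<psi> :: "real \<Rightarrow> real \<Rightarrow> ennreal"
  assumes "case_prod \<psi> \<in> borel_measurable (borel \<Otimes>\<^sub>M borel)"
  shows "(\<lambda>y. \<psi> y u) \<in> borel_measurable borel" "(\<lambda>y. \<psi> u y) \<in> borel_measurable borel"
    "(\<lambda>z. \<psi> (fst z) (snd z)) \<in> borel_measurable (borel \<Otimes>\<^sub>M borel)"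
    "(\<lambda>z. \<psi> (snd z) (fst z)) \<in> borel_measurable (borel \<Otimes>\<^sub>M borel)"
    "(\<lambda>z. \<psi> (fst z) (snd z)) \<in> borel_measurable (lborel \<Otimes>\<^sub>M lborel)"
    "(\<lambda>z. \<psi> (snd z) (fst z)) \<in> borel_measurable (lborel \<Otimes>\<^sub>M lborel)"
proof -
  have *: "(\<lambda>x. \<psi> (f x) (g x)) \<in> borel_measurable N"
    if "f \<in> borel_measurable N" "g \<in> borel_measurable N" for f g and N :: "'z measure"
    using measurable_compose[OF measurable_Pair[OF that] assms] by simp
  show "(\<lambda>y. \<psi> y u) \<in> borel_measurable borel" "(\<lambda>y. \<psi> u y) \<in> borel_measurable borel"
    by (rule *; measurable)+
  show "(\<lambda>z. \<psi> (fst z) (snd z)) \<in> borel_measurable (borel \<Otimes>\<^sub>M borel)"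
    "(\<lambda>z. \<psi> (snd z) (fst z)) \<in> borel_measurable (borel \<Otimes>\<^sub>M borel)"
    "(\<lambda>z. \<psi> (fst z) (snd z)) \<in> borel_measurable (lborel \<Otimes>\<^sub>M lborel)"
    "(\<lambda>z. \<psi> (snd z) (fst z)) \<in> borel_measurable (lborel \<Otimes>\<^sub>M lborel)"
    by (rule *; measurable)+
qed

lemma ar_step_cmult:
  assumes "case_prod \<psi> \<in> borel_measurable (borel \<Otimes>\<^sub>M borel)"
  shows "ar_step b c k \<tau> (\<lambda>u v. a * \<psi> u v) = (\<lambda>u v. a * ar_step b c k \<tau> \<psi> u v)"
proof -
  note [measurable] = measurable_sections[OF assms]
  show ?thesis unfolding ar_step_def by (intro ext) (simp add: nn_integral_cmult[symmetric] mult.left_commute)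
qed

lemma ar_step_add:
  assumes "case_prod \<psi> \<in> borel_measurable (borel \<Otimes>\<^sub>M borel)"
    "case_prod \<psi>' \<in> borel_measurable (borel \<Otimes>\<^sub>M borel)"
  shows "ar_step b c k \<tau> (\<lambda>u v. \<psi> u v + \<psi>' u v) = (\<lambda>u v. ar_step b c k \<tau> \<psi> u v + ar_step b c k \<tau> \<psi>' u v)"
proof -
  note [measurable] = measurable_sections[OF assms(1)] measurable_sections[OF assms(2)]
  show ?thesis unfolding ar_step_def by (intro ext) (simp add: nn_integral_add[symmetric] distrib_left)
qed

lemma ar_iter_cmult:
  assumes "case_prod \<psi> \<in> borel_measurable (borel \<Otimes>\<^sub>M borel)"
  shows "(ar_step b c k \<tau> ^^ n) (\<lambda>u v. a * \<psi> u v) = (\<lambda>u v. a * (ar_step b c k \<tau> ^^ n) \<psi> u v)"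
  by (induction n) (auto simp: ar_step_cmult ar_iter_measurable[OF assms])

lemma ar_iter_add:
  assumes "case_prod \<psi> \<in> borel_measurable (borel \<Otimes>\<^sub>M borel)" "case_prod \<psi>' \<in> borel_measurable (borel \<Otimes>\<^sub>M borel)"
  shows "(ar_step b c k \<tau> ^^ n) (\<lambda>u v. \<psi> u v + \<psi>' u v)
    = (\<lambda>u v. (ar_step b c k \<tau> ^^ n) \<psi> u v + (ar_step b c k \<tau> ^^ n) \<psi>' u v)"
  by (induction n) (auto simp: ar_step_add ar_iter_measurable assms)

text \<open>The Jury criterion: both roots of \<open>z\<^sup>2 + b * z + c\<close> lie in the open
  unit disc (\<open>stable2_root\<close>, \<open>stable2I\<close>).\<close>

definition stable2 :: "real \<Rightarrow> real \<Rightarrow> bool" where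
  "stable2 b c \<longleftrightarrow> \<bar>c\<bar> < 1 \<and> \<bar>b\<bar> < 1 + c"

text \<open>\<open>A_eq\<close> compares the constant Fourier coefficients after \<open>B\<close>
  and \<open>C\<close> have been eliminated by means of the other two coefficients.
  \<open>A_gt\<close> and \<open>A_stab\<close> say that the polynomial with coefficients
  \<open>B\<close> and \<open>C\<close> is again stable.\<close>

locale spectral_factor =
  fixes b c \<tau> A :: real
  assumes stable: "stable2 b c"
    and A_gt: "\<bar>c\<bar> < A" and A_stab: "A * (\<bar>b\<bar> * (1 + c)) < (A + c)\<^sup>2"
    and A_eq: "(1 + c)\<^sup>2 + b\<^sup>2 - \<tau> = (A + c)\<^sup>2 / A + (b * (1 + c))\<^sup>2 * A / (A + c)\<^sup>2"
begin

definition B where "B = b * (1 + c) / (A + c)"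
definition C where "C = c / A"

lemma A_pos: "0 < A" and Ac_pos: "0 < A + c" using A_gt by auto

lemma AC: "A * C = c" using A_pos by (simp add: C_def)

lemma AB: "A * B * (1 + C) = b * (1 + c)"
proof -
  have "1 + C = (A + c) / A" using A_pos by (simp add: C_def field_simps)
  then show ?thesis using A_pos Ac_pos by (simp add: B_def)
qed

lemma f0: "A + A * B\<^sup>2 + A * C\<^sup>2 = 1 + b\<^sup>2 + c\<^sup>2 - \<tau>"
proof -
  have "A * B\<^sup>2 = (b * (1 + c))\<^sup>2 * A / (A + c)\<^sup>2" by (simp add: B_def power_divide)
  moreover have "(A + c)\<^sup>2 / A = A + 2 * c + A * C\<^sup>2"
    using A_pos by (simp add: C_def power2_eq_square field_simps)
  ultimately show ?thesis using A_eq by (simp add: power2_eq_square algebra_simps)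
qed

lemma stable_BC: "stable2 B C"
proof -
  have "\<bar>C\<bar> < 1" using A_gt A_pos by (simp add: C_def)
  moreover have "\<bar>B\<bar> < 1 + C"
  proof -
    have "\<bar>1 + c\<bar> = 1 + c" using stable by (auto simp: stable2_def)
    then have "\<bar>B\<bar> = \<bar>b\<bar> * (1 + c) / (A + c)"
      using Ac_pos by (simp add: B_def abs_mult)
    also have "\<dots> < (A + c) / A" using A_stab A_pos Ac_pos by (simp add: field_simps power2_eq_square)
    also have "\<dots> = 1 + C" using A_pos by (simp add: C_def field_simps)
    finally show ?thesis .
  qed
  ultimately show ?thesis by (simp add: stable2_def)
qed

text \<open>\<open>Nf\<close> and \<open>Mf\<close> are the quadratic forms left over when the sum of \<open>|p u|\<^sup>2 - \<tau> u\<^sup>2\<close> along a path is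
  written as \<open>A\<close> times the sum of squares of \<open>q u\<close>, read forwards and backwards in time respectively.
  The stationary Gaussian law of the recursion with polynomial \<open>q\<close> has exponent \<open>Mf + Nf\<close>.\<close>

definition Nf where "Nf u v = (A - 1 + \<tau>) * u\<^sup>2 + 2 * (A * B - b) * u * v + (c\<^sup>2 - A * C\<^sup>2) * v\<^sup>2"
definition Mf where "Mf u v = (1 - \<tau> - A * C\<^sup>2) * u\<^sup>2 + 2 * (A * B - b * c) * u * v + (A - c\<^sup>2) * v\<^sup>2"

text \<open>Written out, the difference of the two sides is a combination of the coefficient
  equations \<open>AC\<close>, \<open>AB\<close> and \<open>f0\<close>: this is the spectral
  factorization read in the time domain. It completes the square in the newest value
  \<open>y\<close>; \<open>left_identity\<close> does so in the oldest value
  \<open>v\<close>.\<close>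

lemma right_identity:
  "(y + b * u + c * v)\<^sup>2 - \<tau> * y\<^sup>2 + Nf y u = A * (y + B * u + C * v)\<^sup>2 + Nf u v"
proof -
  have "((y + b * u + c * v)\<^sup>2 - \<tau> * y\<^sup>2 + Nf y u) - (A * (y + B * u + C * v)\<^sup>2 + Nf u v)
    = u\<^sup>2 * ((1 + b\<^sup>2 + c\<^sup>2 - \<tau>) - (A + A * B\<^sup>2 + A * C\<^sup>2)) + 2 * u * v * (b * (1 + c) - A * B * (1 + C))
      + 2 * y * v * (c - A * C)"
    unfolding Nf_def by (simp add: power2_eq_square algebra_simps)
  then show ?thesis using AC AB f0 by simp
qed

lemma left_identity:
  "Mf u v + ((y + b * u + c * v)\<^sup>2 - \<tau> * y\<^sup>2) = A * (v + B * u + C * y)\<^sup>2 + Mf y u"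
proof -
  have "(Mf u v + ((y + b * u + c * v)\<^sup>2 - \<tau> * y\<^sup>2)) - (A * (v + B * u + C * y)\<^sup>2 + Mf y u)
    = u\<^sup>2 * ((1 + b\<^sup>2 + c\<^sup>2 - \<tau>) - (A + A * B\<^sup>2 + A * C\<^sup>2)) + 2 * u * y * (b * (1 + c) - A * B * (1 + C))
      + 2 * y * v * (c - A * C)"
    unfolding Mf_def by (simp add: power2_eq_square algebra_simps)
  then show ?thesis using AC AB f0 by simp
qed

lemma A_gt_csq: "c\<^sup>2 < A"
proof -
  have "c\<^sup>2 = \<bar>c\<bar> * \<bar>c\<bar>" by (simp add: power2_eq_square)
  also have "\<dots> \<le> \<bar>c\<bar> * 1" using stable by (intro mult_left_mono) (auto simp: stable2_def)
  finally show ?thesis using A_gt by simp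
qed

text \<open>Multiplication by \<open>(A + c)\<^sup>2\<close> clears the denominator of
  \<open>B\<close> and turns the determinant into
  \<open>(A - c\<^sup>2)\<^sup>2 * ((A + c)\<^sup>2 - A * b\<^sup>2)\<close>, positive by
  \<open>A_stab\<close> and \<open>\<bar>b\<bar> < 1 + c\<close>. Together with
  \<open>A_gt_csq\<close> this makes \<open>Mf\<close> positive definite, so the left eigenmeasure
  is finite.\<close>

lemma Mf_det: "0 < (1 - \<tau> - A * C\<^sup>2) * (A - c\<^sup>2) - (A * B - b * c)\<^sup>2"
proof -
  define D where "D = A + c"
  have D: "0 < D" using Ac_pos by (simp add: D_def)
  have BD: "B * D = b * (1 + c)" using D by (simp add: B_def D_def)
  have m11: "1 - \<tau> - A * C\<^sup>2 = A + A * B\<^sup>2 - b\<^sup>2 - c\<^sup>2" using f0 by simp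
  have m12: "(A * B - b * c) * D = b * (A - c\<^sup>2)"
  proof -
    have "(A * B - b * c) * D = A * (B * D) - b * c * D" by (simp add: algebra_simps)
    then show ?thesis unfolding BD by (simp add: D_def power2_eq_square algebra_simps)
  qed
  have m11D: "(1 - \<tau> - A * C\<^sup>2) * D\<^sup>2 = (A - c\<^sup>2) * (D\<^sup>2 + b\<^sup>2 * (1 - A))"
  proof -
    have "(1 - \<tau> - A * C\<^sup>2) * D\<^sup>2 = (A - b\<^sup>2 - c\<^sup>2) * D\<^sup>2 + A * (B * D)\<^sup>2"
      unfolding m11 by (simp add: power2_eq_square algebra_simps)
    then show ?thesis unfolding BD by (simp add: D_def power2_eq_square algebra_simps)
  qed
  have "((1 - \<tau> - A * C\<^sup>2) * (A - c\<^sup>2) - (A * B - b * c)\<^sup>2) * D\<^sup>2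
    = (A - c\<^sup>2) * ((1 - \<tau> - A * C\<^sup>2) * D\<^sup>2) - ((A * B - b * c) * D)\<^sup>2"
    by (simp add: power2_eq_square algebra_simps)
  also have "\<dots> = (A - c\<^sup>2)\<^sup>2 * (D\<^sup>2 - A * b\<^sup>2)"
    unfolding m12 m11D by (simp add: power2_eq_square algebra_simps)
  also have "\<dots> > 0"
  proof -
    have "A * b\<^sup>2 = A * (\<bar>b\<bar> * \<bar>b\<bar>)" by (simp add: power2_eq_square)
    also have "\<dots> \<le> A * (\<bar>b\<bar> * (1 + c))"
      using stable A_pos by (intro mult_left_mono) (auto simp: stable2_def)
    also have "\<dots> < D\<^sup>2" using A_stab by (simp add: D_def)
    finally show ?thesis using A_gt_csq by simp
  qed
  finally show ?thesis using D by (simp add: zero_less_mult_iff)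
qed

lemma MN_form: "Mf u v + Nf u v = A * (1 - C\<^sup>2) * u\<^sup>2 + 2 * (A * B * (1 - C)) * u * v + A * (1 - C\<^sup>2) * v\<^sup>2"
proof -
  have "(Mf u v + Nf u v) - (A * (1 - C\<^sup>2) * u\<^sup>2 + 2 * (A * B * (1 - C)) * u * v + A * (1 - C\<^sup>2) * v\<^sup>2)
    = 2 * u * v * (A * B * (1 + C) - b * (1 + c))"
    unfolding Mf_def Nf_def by (simp add: power2_eq_square algebra_simps)
  then show ?thesis using AB by simp
qed

lemma MN_det: "0 < (A * (1 - C\<^sup>2)) * (A * (1 - C\<^sup>2)) - (A * B * (1 - C))\<^sup>2" "0 < A * (1 - C\<^sup>2)"
proof -
  have C: "\<bar>C\<bar> < 1" "\<bar>B\<bar> < 1 + C" using stable_BC by (auto simp: stable2_def)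
  have "B\<^sup>2 < (1 + C)\<^sup>2" using C by (metis abs_ge_zero abs_le_square_iff abs_of_nonneg less_imp_le not_le order.strict_trans1 power2_abs)
  then have "0 < A\<^sup>2 * ((1 - C)\<^sup>2 * ((1 + C)\<^sup>2 - B\<^sup>2))" using C A_pos by (intro mult_pos_pos) auto
  also have "\<dots> = (A * (1 - C\<^sup>2)) * (A * (1 - C\<^sup>2)) - (A * B * (1 - C))\<^sup>2"
    by (simp add: power2_eq_square algebra_simps)
  finally show "0 < (A * (1 - C\<^sup>2)) * (A * (1 - C\<^sup>2)) - (A * B * (1 - C))\<^sup>2" .
  have "C\<^sup>2 < 1" using C by (simp add: abs_square_less_1)
  then show "0 < A * (1 - C\<^sup>2)" using A_pos by simp
qed

lemma Mf_measurable [measurable]: "(\<lambda>z. Mf (f z) (g z)) \<in> borel_measurable N"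
  if [measurable]: "f \<in> borel_measurable N" "g \<in> borel_measurable N"
  unfolding Mf_def by measurable

lemma Nf_measurable [measurable]: "(\<lambda>z. Nf (f z) (g z)) \<in> borel_measurable N"
  if [measurable]: "f \<in> borel_measurable N" "g \<in> borel_measurable N"
  unfolding Nf_def by measurable

lemma Nf_sublevel: "{z. Nf (fst z) (snd z) < r} \<in> sets (borel \<Otimes>\<^sub>M borel)"
proof -
  have "{z \<in> space (borel \<Otimes>\<^sub>M borel). Nf (fst z) (snd z) < r} \<in> sets (borel \<Otimes>\<^sub>M borel)" by measurable
  then show ?thesis by (simp add: space_pair_measure)
qed

section \<open>Left and right eigenvectors and geometric bounds for the iterates\<close>

definition eigenfn where "eigenfn k u v = ennreal (exp (- (k * Nf u v)))"

text \<open>Integration against the left eigenmeasure of \<open>ar_step\<close>; the eigenvalue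
  equation is \<open>J_ar_step\<close>.\<close>

definition J where "J k \<psi> = (\<integral>\<^sup>+ z. ennreal (exp (- (k * Mf (fst z) (snd z)))) * \<psi> (fst z) (snd z) \<partial>(lborel \<Otimes>\<^sub>M lborel))"

lemma J_one_finite: assumes "0 < k" shows "J k (\<lambda>_ _. 1) < \<infinity>"
  using nn_integral_gauss2_finite[OF assms, of "A - c\<^sup>2" "1 - \<tau> - A * C\<^sup>2" "A * B - b * c"] A_gt_csq Mf_det
  by (simp add: J_def Mf_def)

lemma J_eigenfn_finite: assumes "0 < k" shows "J k (eigenfn k) < \<infinity>"
proof -
  have "J k (eigenfn k) = (\<integral>\<^sup>+ z. ennreal (exp (- (k * (Mf (fst z) (snd z) + Nf (fst z) (snd z))))) \<partial>(lborel \<Otimes>\<^sub>M lborel))"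
    unfolding J_def eigenfn_def
    by (intro nn_integral_cong) (simp add: ennreal_mult[symmetric] mult_exp_exp algebra_simps)
  then show ?thesis unfolding MN_form
    using nn_integral_gauss2_finite[OF assms MN_det(2) MN_det(1)] by simp
qed

lemma eigenfn_measurable [measurable]: "case_prod (eigenfn k) \<in> borel_measurable (borel \<Otimes>\<^sub>M borel)"
  unfolding eigenfn_def case_prod_beta by measurable

lemma gauss_const: assumes "0 < k" shows "sqrt (k / pi) * sqrt (pi / (k * A)) = 1 / sqrt A"
proof -
  have "k / pi * (pi / (k * A)) = 1 / A" using assms by simp
  then show ?thesis unfolding real_sqrt_mult[symmetric] by (simp add: real_sqrt_divide)
qed

text \<open>By \<open>right_identity\<close> the kernel times the eigenfunction equals
  \<open>eigenfn k u v\<close> times a Gaussian in \<open>y\<close> whose precision is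
  \<open>A\<close> times that of the noise; the ratio of the normalizations is
  \<open>1 / sqrt A\<close>.\<close>

lemma ar_step_eigenfn:
  assumes k: "0 < k"
  shows "ar_step b c k \<tau> (eigenfn k) = (\<lambda>u v. ennreal (1 / sqrt A) * eigenfn k u v)"
proof (intro ext)
  fix u v
  have "ar_step b c k \<tau> (eigenfn k) u v =
     (\<integral>\<^sup>+ y. ennreal (sqrt (k / pi) * exp (- (k * Nf u v))) * ennreal (exp (- (k * A * (y + (B * u + C * v))\<^sup>2))) \<partial>lborel)"
    unfolding ar_step_def eigenfn_def
  proof (rule nn_integral_cong)
    fix y
    have "- (k * ((y + b * u + c * v)\<^sup>2 - \<tau> * y\<^sup>2)) + - (k * Nf y u) = - (k * Nf u v) + - (k * A * (y + (B * u + C * v))\<^sup>2)"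
      using arg_cong[OF right_identity[of y u v], of "\<lambda>x. - (k * x)"] by (simp add: distrib_left add.assoc mult.assoc)
    then show "ennreal (sqrt (k / pi) * exp (- (k * ((y + b * u + c * v)\<^sup>2 - \<tau> * y\<^sup>2)))) * ennreal (exp (- (k * Nf y u))) =
      ennreal (sqrt (k / pi) * exp (- (k * Nf u v))) * ennreal (exp (- (k * A * (y + (B * u + C * v))\<^sup>2)))"
      using k by (simp add: ennreal_mult[symmetric] mult.assoc mult_exp_exp)
  qed
  also have "\<dots> = ennreal (sqrt (k / pi) * exp (- (k * Nf u v))) * ennreal (sqrt (pi / (k * A)))"
    using k A_pos by (simp add: nn_integral_cmult nn_integral_gauss)
  also have "\<dots> = ennreal (sqrt (k / pi) * sqrt (pi / (k * A)) * exp (- (k * Nf u v)))"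
    using k A_pos by (simp add: ennreal_mult[symmetric] mult_ac)
  finally show "ar_step b c k \<tau> (eigenfn k) u v = ennreal (1 / sqrt A) * eigenfn k u v"
    unfolding gauss_const[OF k] using A_pos by (simp add: eigenfn_def ennreal_mult[symmetric])
qed

lemma J_ar_step:
  assumes k: "0 < k" and \<psi>: "case_prod \<psi> \<in> borel_measurable (borel \<Otimes>\<^sub>M borel)"
  shows "J k (ar_step b c k \<tau> \<psi>) = ennreal (1 / sqrt A) * J k \<psi>"
proof -
  note [measurable] = measurable_sections[OF \<psi>] measurable_sections[OF ar_step_measurable[OF \<psi>]]
  let ?g = "\<lambda>u v y. ennreal (exp (- (k * Mf u v))) * (ennreal (sqrt (k / pi) * exp (- (k * ((y + b * u + c * v)\<^sup>2 - \<tau> * y\<^sup>2)))) * \<psi> y u)"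
  have "J k (ar_step b c k \<tau> \<psi>) = (\<integral>\<^sup>+ u. \<integral>\<^sup>+ v. ennreal (exp (- (k * Mf u v))) * ar_step b c k \<tau> \<psi> u v \<partial>lborel \<partial>lborel)"
    unfolding J_def by (subst lborel.nn_integral_fst[symmetric]) auto
  also have "\<dots> = (\<integral>\<^sup>+ u. \<integral>\<^sup>+ v. \<integral>\<^sup>+ y. ?g u v y \<partial>lborel \<partial>lborel \<partial>lborel)"
    unfolding ar_step_def by (simp add: nn_integral_cmult)
  \<comment> \<open>This brings \<open>v\<close> innermost, the variable in which
    \<open>left_identity\<close> completes the square; the remaining pair \<open>(y, u)\<close> is
    the shifted state.\<close>
  also have "\<dots> = (\<integral>\<^sup>+ u. \<integral>\<^sup>+ y. \<integral>\<^sup>+ v. ?g u v y \<partial>lborel \<partial>lborel \<partial>lborel)"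
    by (intro nn_integral_cong lborel_pair.Fubini') measurable
  also have "\<dots> = (\<integral>\<^sup>+ u. \<integral>\<^sup>+ y. ennreal (1 / sqrt A) * (ennreal (exp (- (k * Mf y u))) * \<psi> y u) \<partial>lborel \<partial>lborel)"
  proof (intro nn_integral_cong)
    fix u y :: real
    have "(\<integral>\<^sup>+ v. ?g u v y \<partial>lborel) =
       (\<integral>\<^sup>+ v. (ennreal (sqrt (k / pi)) * ennreal (exp (- (k * Mf y u))) * \<psi> y u) * ennreal (exp (- (k * A * (v + (B * u + C * y))\<^sup>2))) \<partial>lborel)"
    proof (rule nn_integral_cong)
      fix v
      have "- (k * Mf u v) + - (k * ((y + b * u + c * v)\<^sup>2 - \<tau> * y\<^sup>2)) = - (k * Mf y u) + - (k * A * (v + (B * u + C * y))\<^sup>2)"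
        using arg_cong[OF left_identity[of u v y], of "\<lambda>x. - (k * x)"] by (simp add: distrib_left add.assoc mult.assoc)
      then have "exp (- (k * Mf u v)) * exp (- (k * ((y + b * u + c * v)\<^sup>2 - \<tau> * y\<^sup>2))) = exp (- (k * Mf y u)) * exp (- (k * A * (v + (B * u + C * y))\<^sup>2))"
        by (simp only: mult_exp_exp)
      then have "ennreal (exp (- (k * Mf u v))) * ennreal (exp (- (k * ((y + b * u + c * v)\<^sup>2 - \<tau> * y\<^sup>2)))) = ennreal (exp (- (k * Mf y u))) * ennreal (exp (- (k * A * (v + (B * u + C * y))\<^sup>2)))"
        by (simp add: ennreal_mult[symmetric])
      then show "?g u v y = (ennreal (sqrt (k / pi)) * ennreal (exp (- (k * Mf y u))) * \<psi> y u) * ennreal (exp (- (k * A * (v + (B * u + C * y))\<^sup>2)))"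
        using k ennreal_rearrange by (simp add: ennreal_mult)
    qed
    also have "\<dots> = (ennreal (sqrt (k / pi)) * ennreal (exp (- (k * Mf y u))) * \<psi> y u) * ennreal (sqrt (pi / (k * A)))"
      using k A_pos by (simp add: nn_integral_cmult nn_integral_gauss)
    also have "\<dots> = ennreal (sqrt (k / pi)) * ennreal (sqrt (pi / (k * A))) * (ennreal (exp (- (k * Mf y u))) * \<psi> y u)"
      by (simp add: mult_ac)
    also have "ennreal (sqrt (k / pi)) * ennreal (sqrt (pi / (k * A))) = ennreal (1 / sqrt A)"
      using k A_pos by (subst ennreal_mult[symmetric]) (auto simp only: gauss_const[OF k] , auto)
    finally show "(\<integral>\<^sup>+ v. ?g u v y \<partial>lborel) = ennreal (1 / sqrt A) * (ennreal (exp (- (k * Mf y u))) * \<psi> y u)" .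
  qed
  also have "\<dots> = (\<integral>\<^sup>+ y. \<integral>\<^sup>+ u. ennreal (1 / sqrt A) * (ennreal (exp (- (k * Mf y u))) * \<psi> y u) \<partial>lborel \<partial>lborel)"
    by (rule lborel_pair.Fubini') measurable
  also have "\<dots> = ennreal (1 / sqrt A) * (\<integral>\<^sup>+ y. \<integral>\<^sup>+ u. (ennreal (exp (- (k * Mf y u))) * \<psi> y u) \<partial>lborel \<partial>lborel)"
    by (simp add: nn_integral_cmult)
  also have "(\<integral>\<^sup>+ y. \<integral>\<^sup>+ u. (ennreal (exp (- (k * Mf y u))) * \<psi> y u) \<partial>lborel \<partial>lborel) = J k \<psi>"
    unfolding J_def by (subst lborel.nn_integral_fst[symmetric]) auto
  finally show ?thesis .
qed

lemma J_ar_iter: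
  assumes k: "0 < k" and \<psi>: "case_prod \<psi> \<in> borel_measurable (borel \<Otimes>\<^sub>M borel)"
  shows "J k ((ar_step b c k \<tau> ^^ n) \<psi>) = ennreal (1 / sqrt A) ^ n * J k \<psi>"
  by (induction n) (auto simp: J_ar_step[OF k ar_iter_measurable[OF \<psi>]] mult.assoc)

lemma ar_iter_eigenfn:
  assumes k: "0 < k"
  shows "(ar_step b c k \<tau> ^^ n) (eigenfn k) u v = ennreal (1 / sqrt A) ^ n * eigenfn k u v"
  by (induction n arbitrary: u v)
    (simp_all add: ar_step_eigenfn[OF k] ar_iter_cmult funpow_swap1 mult.assoc del: funpow.simps add: funpow_Suc_right funpow_0)

text \<open>Two steps smear a point mass into a density dominated by the left eigenmeasure of
  \<open>ar_step\<close>, by using \<open>left_identity\<close> twice and dropping squares.\<close>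

lemma ar_two_steps_le:
  assumes k: "0 < k" and \<psi>: "case_prod \<psi> \<in> borel_measurable (borel \<Otimes>\<^sub>M borel)"
  shows "ar_step b c k \<tau> (ar_step b c k \<tau> \<psi>) x1 x2 \<le> ennreal (k / pi * exp (k * Mf x1 x2)) * J k \<psi>"
proof -
  note [measurable] = measurable_sections[OF \<psi>]
  let ?K = "k / pi * exp (k * Mf x1 x2)"
  let ?w = "\<lambda>y u v. ennreal (sqrt (k / pi) * exp (- (k * ((y + b * u + c * v)\<^sup>2 - \<tau> * y\<^sup>2))))"
  have "ar_step b c k \<tau> (ar_step b c k \<tau> \<psi>) x1 x2 = (\<integral>\<^sup>+ v. \<integral>\<^sup>+ u. ?w v x1 x2 * (?w u v x1 * \<psi> u v) \<partial>lborel \<partial>lborel)"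
    unfolding ar_step_def by (simp add: nn_integral_cmult)
  also have "\<dots> \<le> (\<integral>\<^sup>+ v. \<integral>\<^sup>+ u. ennreal ?K * (ennreal (exp (- (k * Mf u v))) * \<psi> u v) \<partial>lborel \<partial>lborel)"
  proof (intro nn_integral_mono)
    fix u v :: real
    let ?e1 = "(v + b * x1 + c * x2)\<^sup>2 - \<tau> * v\<^sup>2" and ?e2 = "(u + b * v + c * x1)\<^sup>2 - \<tau> * u\<^sup>2"
    have "Mf u v - Mf x1 x2 \<le> ?e1 + ?e2"
    proof -
      have "m3 - m1 \<le> e1 + e2" if "m1 + e1 = q1 + m2" "m2 + e2 = q2 + m3" "0 \<le> q1" "0 \<le> q2"
        for m1 m2 m3 e1 e2 q1 q2 :: real using that by linarith
      from this[OF left_identity[of x1 x2 v] left_identity[of v x1 u]] show ?thesis using A_pos by simp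
    qed
    then have "k * (Mf u v - Mf x1 x2) \<le> k * (?e1 + ?e2)" using k by (intro mult_left_mono) auto
    then have *: "- (k * ?e1) + - (k * ?e2) \<le> k * Mf x1 x2 + - (k * Mf u v)" by (simp add: algebra_simps)
    have "sqrt (k / pi) * exp (- (k * ?e1)) * (sqrt (k / pi) * exp (- (k * ?e2))) = k / pi * exp (- (k * ?e1) + - (k * ?e2))"
    proof -
      have "sqrt (k / pi) * sqrt (k / pi) = k / pi" using k by simp
      then have "sqrt (k / pi) * x * (sqrt (k / pi) * y) = k / pi * (x * y)" for x y by (metis mult.assoc mult.left_commute)
      then show ?thesis by (simp only: mult_exp_exp)
    qed
    also have "\<dots> \<le> k / pi * exp (k * Mf x1 x2 + - (k * Mf u v))" using * k by (intro mult_left_mono) auto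
    also have "\<dots> = ?K * exp (- (k * Mf u v))" by (simp only: mult_exp_exp[symmetric] mult.assoc)
    finally have "?w v x1 x2 * ?w u v x1 \<le> ennreal ?K * ennreal (exp (- (k * Mf u v)))"
      using k by (simp add: ennreal_mult[symmetric] ennreal_leI)
    then show "?w v x1 x2 * (?w u v x1 * \<psi> u v) \<le> ennreal ?K * (ennreal (exp (- (k * Mf u v))) * \<psi> u v)"
      by (simp add: mult.assoc[symmetric] mult_right_mono)
  qed
  also have "\<dots> = (\<integral>\<^sup>+ u. \<integral>\<^sup>+ v. ennreal ?K * (ennreal (exp (- (k * Mf u v))) * \<psi> u v) \<partial>lborel \<partial>lborel)"
    by (rule lborel_pair.Fubini') measurable
  also have "\<dots> = ennreal ?K * (\<integral>\<^sup>+ u. \<integral>\<^sup>+ v. (ennreal (exp (- (k * Mf u v))) * \<psi> u v) \<partial>lborel \<partial>lborel)"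
    by (simp add: nn_integral_cmult)
  also have "(\<integral>\<^sup>+ u. \<integral>\<^sup>+ v. (ennreal (exp (- (k * Mf u v))) * \<psi> u v) \<partial>lborel \<partial>lborel) = J k \<psi>"
    unfolding J_def by (subst lborel.nn_integral_fst[symmetric]) auto
  finally show ?thesis .
qed

text \<open>The two outermost applications are the first two time steps from the start
  \<open>(x1, x2)\<close>. They replace the start by a multiple of the left eigenmeasure, on which
  the other \<open>n\<close> steps act by an exact factor; hence the index
  \<open>n + 2\<close>.\<close>

lemma ar_iter_le:
  assumes k: "0 < k" and \<psi>: "case_prod \<psi> \<in> borel_measurable (borel \<Otimes>\<^sub>M borel)"
  shows "(ar_step b c k \<tau> ^^ (n + 2)) \<psi> x1 x2 \<le> ennreal (k / pi * exp (k * Mf x1 x2)) * (ennreal (1 / sqrt A) ^ n * J k \<psi>)"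
proof -
  have eq: "(ar_step b c k \<tau> ^^ (n + 2)) \<psi> = ar_step b c k \<tau> (ar_step b c k \<tau> ((ar_step b c k \<tau> ^^ n) \<psi>))"
    by simp
  show ?thesis
    unfolding eq J_ar_iter[OF k \<psi>, symmetric] by (rule ar_two_steps_le[OF k ar_iter_measurable[OF \<psi>]])
qed

lemma ar_iter_upper:
  assumes k: "0 < k"
  obtains K where "0 < K" "\<And>n. (ar_step b c k \<tau> ^^ (n + 2)) (\<lambda>_ _. 1) x1 x2 \<le> ennreal (K * (1 / sqrt A) ^ n)"
proof -
  define j where "j = enn2real (J k (\<lambda>_ _. 1))"
  have j: "J k (\<lambda>_ _. 1) = ennreal j" using J_one_finite[OF k] by (simp add: j_def)
  have j0: "0 \<le> j" by (simp add: j_def)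
  \<comment> \<open>Adding 1 to \<open>j\<close> makes the constant positive without a lower bound
    on the mass of the eigenmeasure.\<close>
  let ?K = "k / pi * exp (k * Mf x1 x2) * (j + 1)"
  have "(ar_step b c k \<tau> ^^ (n + 2)) (\<lambda>_ _. 1) x1 x2 \<le> ennreal (?K * (1 / sqrt A) ^ n)" for n
  proof -
    have "(ar_step b c k \<tau> ^^ (n + 2)) (\<lambda>_ _. 1) x1 x2 \<le> ennreal (k / pi * exp (k * Mf x1 x2)) * (ennreal (1 / sqrt A) ^ n * ennreal j)"
      using ar_iter_le[OF k, of "\<lambda>_ _. 1" n x1 x2] by (simp add: j)
    also have "\<dots> = ennreal (k / pi * exp (k * Mf x1 x2) * ((1 / sqrt A) ^ n * j))"
      using k A_pos j0 by (simp add: ennreal_mult[symmetric] ennreal_power)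
    also have "\<dots> \<le> ennreal (?K * (1 / sqrt A) ^ n)"
    proof (rule ennreal_leI)
      have "k / pi * exp (k * Mf x1 x2) * ((1 / sqrt A) ^ n * j) \<le> k / pi * exp (k * Mf x1 x2) * ((1 / sqrt A) ^ n * (j + 1))"
        using k A_pos by (intro mult_left_mono) auto
      then show "k / pi * exp (k * Mf x1 x2) * ((1 / sqrt A) ^ n * j) \<le> ?K * (1 / sqrt A) ^ n" by (simp only: mult_ac)
    qed
    finally show ?thesis .
  qed
  moreover have "0 < ?K" using k j0 by (intro mult_pos_pos) auto
  ultimately show ?thesis using that by blast
qed

text \<open>The eigenfunction may be unbounded, but it is integrable against the left eigenmeasure
  because \<open>Mf + Nf\<close> is positive definite. The regions where it is large decrease to the
  empty set, so dominated convergence applies.\<close>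

lemma J_tail:
  assumes k: "0 < k" and e: "0 < e"
  obtains R :: nat where "J k (\<lambda>u v. eigenfn k u v * indicator {z. Nf (fst z) (snd z) < - real R} (u, v)) < ennreal e"
proof -
  note [measurable] = measurable_sections[OF eigenfn_measurable]
  let ?M = "lborel \<Otimes>\<^sub>M lborel :: (real \<times> real) measure"
  let ?g = "\<lambda>z. ennreal (exp (- (k * Mf (fst z) (snd z)))) * eigenfn k (fst z) (snd z)"
  let ?f = "\<lambda>(i::nat) z. ennreal (exp (- (k * Mf (fst z) (snd z)))) * (eigenfn k (fst z) (snd z) * indicator {z. Nf (fst z) (snd z) < - real i} (fst z, snd z))"
  note [measurable] = Nf_sublevel
  have "(\<lambda>i. \<integral>\<^sup>+ z. ?f i z \<partial>?M) \<longlonglongrightarrow> (\<integral>\<^sup>+ z. 0 \<partial>?M)"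
  proof (rule nn_integral_dominated_convergence[where w="?g"])
    show "?f i \<in> borel_measurable ?M" for i by (simp add: measurable_lborel2) measurable
    show "?g \<in> borel_measurable ?M" by measurable
    show "AE z in ?M. ?f i z \<le> ?g z" for i
      by (rule AE_I2) (auto intro!: mult_left_mono simp: indicator_def)
    show "(\<integral>\<^sup>+ z. ?g z \<partial>?M) < \<infinity>" using J_eigenfn_finite[OF k] by (simp add: J_def)
    show "AE z in ?M. (\<lambda>i. ?f i z) \<longlonglongrightarrow> 0"
    proof (rule AE_I2, rule tendsto_eventually)
      fix z
      obtain m :: nat where m: "- Nf (fst z) (snd z) \<le> real m" using real_arch_simple by blast
      show "\<forall>\<^sub>F i in sequentially. ?f i z = 0"
        using eventually_ge_at_top[of m] by eventually_elim (use m in \<open>auto simp: indicator_def\<close>)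
    qed
  qed auto
  then have "(\<lambda>i. \<integral>\<^sup>+ z. ?f i z \<partial>?M) \<longlonglongrightarrow> 0" by simp
  then have "\<forall>\<^sub>F i in sequentially. (\<integral>\<^sup>+ z. ?f i z \<partial>?M) < ennreal e"
    using e by (intro order_tendstoD(2)) auto
  then obtain R where "(\<integral>\<^sup>+ z. ?f R z \<partial>?M) < ennreal e" by (meson eventually_happens' sequentially_bot)
  then show ?thesis using that by (simp add: J_def)
qed

text \<open>The iterate of the full eigenfunction is known exactly. Its part above the level
  \<open>exp (k * R)\<close> is controlled by \<open>ar_iter_le\<close> and \<open>J_tail\<close>;
  the rest is at most \<open>exp (k * R)\<close> times the constant 1, whose iterate is thereby
  bounded from below.\<close>

lemma ar_iter_lower:
  assumes k: "0 < k"
  obtains K where "0 < K" "\<And>n. ennreal (K * (1 / sqrt A) ^ n) \<le> (ar_step b c k \<tau> ^^ (n + 2)) (\<lambda>_ _. 1) x1 x2"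
proof -
  let ?r = "1 / sqrt A"
  let ?T = "\<lambda>n. ar_step b c k \<tau> ^^ (n + 2)"
  \<comment> \<open>\<open>p\<close> is the constant in the exact iterate of the eigenfunction, with
    the two extra steps folded in, and \<open>q\<close> is the prefactor in
    \<open>ar_iter_le\<close>. A tail below \<open>p / (2 * q)\<close> therefore leaves at least
    half.\<close>
  define p where "p = exp (- (k * Nf x1 x2)) * ?r ^ 2"
  define q where "q = k / pi * exp (k * Mf x1 x2)"
  have pq: "0 < p" "0 < q" using k A_pos by (auto simp: p_def q_def)
  obtain R :: nat where R: "J k (\<lambda>u v. eigenfn k u v * indicator {z. Nf (fst z) (snd z) < - real R} (u, v)) < ennreal (p / (2 * q))"
    using J_tail[OF k, of "p / (2 * q)"] pq by auto
  let ?E = "{z. Nf (fst z) (snd z) < - real R}"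
  note E[measurable] = Nf_sublevel[of "- real R"]
  let ?b = "\<lambda>u v. eigenfn k u v * indicator ?E (u, v)" and ?g = "\<lambda>u v. eigenfn k u v * indicator (- ?E) (u, v)"
  have mb: "case_prod ?b \<in> borel_measurable (borel \<Otimes>\<^sub>M borel)" and mg: "case_prod ?g \<in> borel_measurable (borel \<Otimes>\<^sub>M borel)"
    using measurable_sections[OF eigenfn_measurable[of k]] E unfolding case_prod_beta prod.collapse
    by (auto simp: Compl_eq_Diff_UNIV intro!: borel_measurable_times_ennreal borel_measurable_indicator)
  have "ennreal (exp (- (k * R)) * (p / 2) * ?r ^ n) \<le> ?T n (\<lambda>_ _. 1) x1 x2" for n
  proof -
    have split: "eigenfn k = (\<lambda>u v. ?b u v + ?g u v)" by (intro ext) (auto simp: indicator_def)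
    have r2: "?r ^ (n + 2) = ?r ^ n * ?r ^ 2" by (rule power_add)
    have "ennreal (p * ?r ^ n) = ?T n (eigenfn k) x1 x2"
      unfolding ar_iter_eigenfn[OF k] using A_pos
      by (simp only: eigenfn_def ennreal_mult[symmetric] ennreal_power p_def r2 mult_ac zero_le_power exp_ge_zero zero_le_divide_1_iff real_sqrt_ge_zero less_imp_le mult_nonneg_nonneg)
    also have "\<dots> = ?T n ?b x1 x2 + ?T n ?g x1 x2"
      by (subst split, subst ar_iter_add[OF mb mg]) simp
    also have "\<dots> \<le> ennreal (p / 2 * ?r ^ n) + ?T n ?g x1 x2"
    proof (rule add_right_mono)
      have "?T n ?b x1 x2 \<le> ennreal q * (ennreal ?r ^ n * J k ?b)"
        unfolding q_def by (rule ar_iter_le[OF k mb])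
      also have "\<dots> \<le> ennreal q * (ennreal ?r ^ n * ennreal (p / (2 * q)))"
        using R by (intro mult_left_mono) auto
      also have "\<dots> = ennreal (q * (?r ^ n * (p / (2 * q))))"
        using pq A_pos by (simp add: ennreal_mult[symmetric] ennreal_power del: power_divide)
      also have "q * (?r ^ n * (p / (2 * q))) = p / 2 * ?r ^ n" using pq by simp
      finally show "?T n ?b x1 x2 \<le> ennreal (p / 2 * ?r ^ n)" .
    qed
    finally have "ennreal (p * ?r ^ n) - ennreal (p / 2 * ?r ^ n) \<le> ?T n ?g x1 x2"
      by (simp add: ennreal_minus_le_iff)
    moreover have "ennreal (p * ?r ^ n) - ennreal (p / 2 * ?r ^ n) = ennreal (p / 2 * ?r ^ n)"
      using pq A_pos by (subst ennreal_minus) (auto intro!: arg_cong[where f=ennreal] simp: field_simps)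
    ultimately have g: "ennreal (p / 2 * ?r ^ n) \<le> ?T n ?g x1 x2" by simp
    have "?T n ?g x1 x2 \<le> ?T n (\<lambda>_ _. ennreal (exp (k * R)) * 1) x1 x2"
    proof (rule ar_iter_mono)
      fix u v
      show "?g u v \<le> ennreal (exp (k * R)) * 1"
        using k by (auto simp: indicator_def eigenfn_def intro!: ennreal_leI)
          (metis mult_left_mono less_imp_le mult_minus_right minus_le_iff not_less)
    qed
    also have "\<dots> = ennreal (exp (k * R)) * ?T n (\<lambda>_ _. 1) x1 x2"
      by (subst ar_iter_cmult) auto
    finally have "ennreal (exp (- (k * R))) * ennreal (p / 2 * ?r ^ n) \<le> ennreal (exp (- (k * R))) * (ennreal (exp (k * R)) * ?T n (\<lambda>_ _. 1) x1 x2)"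
      using g by (intro mult_left_mono) auto
    also have "\<dots> = ?T n (\<lambda>_ _. 1) x1 x2"
      by (simp add: mult.assoc[symmetric] ennreal_mult[symmetric] mult_exp_exp)
    finally show ?thesis using pq A_pos by (simp add: ennreal_mult[symmetric] mult.assoc)
  qed
  moreover have "0 < exp (- (k * R)) * (p / 2)" using pq by simp
  ultimately show ?thesis using that by blast
qed

end

section \<open>Spectral factorization of the shifted symbol\<close>

abbreviation charpoly2 :: "real \<Rightarrow> real \<Rightarrow> real \<Rightarrow> complex" where
  "charpoly2 b c \<omega> \<equiv> (cis \<omega>)\<^sup>2 + of_real b * cis \<omega> + of_real c"

lemma cmod_quadratic_cis:
  fixes b c \<omega> :: real
  shows "(cmod (charpoly2 b c \<omega>))\<^sup>2
    = 1 + b\<^sup>2 + c\<^sup>2 + 2 * (b * (1 + c)) * cos \<omega> + 2 * c * cos (2 * \<omega>)"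
proof -
  have cis2: "(cis \<omega>)\<^sup>2 = cis (2 * \<omega>)" by (simp add: power2_eq_square cis_mult)
  have poly: "(p + b * x + c)\<^sup>2 + (q + b * y)\<^sup>2
    = (q * q + p * p) + b\<^sup>2 * (y * y + x * x) + c\<^sup>2 + 2 * b * (p * x + q * y) + 2 * c * p + 2 * b * c * x" for p q x y :: real
    by (simp add: power2_eq_square algebra_simps)
  have "cos (2 * \<omega>) * cos \<omega> + sin (2 * \<omega>) * sin \<omega> = cos \<omega>"
    using cos_diff[of "2 * \<omega>" \<omega>] by simp
  then show ?thesis unfolding cis2 cmod_power2
    using poly[of "cos (2 * \<omega>)" "cos \<omega>" "sin (2 * \<omega>)" "sin \<omega>"]
    by (simp add: algebra_simps flip: power2_eq_square)
qed

text \<open>A non-real root has squared modulus \<open>c\<close>, the product of a conjugate pair.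
  For real \<open>x\<close> with \<open>\<bar>x\<bar> \<ge> 1\<close> the polynomial exceeds
  \<open>(\<bar>x\<bar> - 1) * (\<bar>x\<bar> - c) \<ge> 0\<close>.\<close>

lemma stable2_root:
  fixes z :: complex
  assumes st: "stable2 b c" and z: "z\<^sup>2 + of_real b * z + of_real c = 0"
  shows "cmod z < 1"
proof (cases "Im z = 0")
  case True
  define x where "x = Re z"
  have zx: "z = of_real x" using True by (simp add: x_def complex_eq_iff)
  have "of_real (x\<^sup>2 + b * x + c) = (0 :: complex)" using z by (simp add: zx)
  then have x0: "x\<^sup>2 + b * x + c = 0" using of_real_eq_0_iff by blast
  have "\<bar>x\<bar> < 1"
  proof (rule ccontr)
    assume "\<not> \<bar>x\<bar> < 1"
    then have x1: "1 \<le> \<bar>x\<bar>" by simp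
    have "\<bar>b\<bar> * \<bar>x\<bar> < (1 + c) * \<bar>x\<bar>" using st x1 by (intro mult_strict_right_mono) (auto simp: stable2_def)
    moreover have "- (\<bar>b\<bar> * \<bar>x\<bar>) \<le> b * x" by (metis abs_ge_minus_self abs_mult minus_le_iff)
    moreover have "0 \<le> (\<bar>x\<bar> - 1) * (\<bar>x\<bar> - c)" using x1 st by (intro mult_nonneg_nonneg) (auto simp: stable2_def)
    moreover have "x\<^sup>2 = \<bar>x\<bar> * \<bar>x\<bar>" by (simp add: power2_eq_square)
    ultimately have "0 < x\<^sup>2 + b * x + c" by (simp add: algebra_simps)
    then show False using x0 by simp
  qed
  then show ?thesis by (simp add: zx)
next
  case False
  define x y where "x = Re z" and "y = Im z"
  have zx: "z = Complex x y" by (simp add: x_def y_def)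
  have "x\<^sup>2 - y\<^sup>2 + b * x + c = 0" "2 * x * y + b * y = 0"
    using arg_cong[OF z, of Re] arg_cong[OF z, of Im] by (simp_all add: zx power2_eq_square)
  moreover from this(2) have "y * (2 * x + b) = 0" by (simp add: algebra_simps)
  then have "2 * x + b = 0" using False by (simp add: y_def)
  then have "b = - 2 * x" by linarith
  ultimately have "x\<^sup>2 + y\<^sup>2 = c" by (simp add: power2_eq_square)
  then have "(cmod z)\<^sup>2 = c" by (simp add: cmod_power2 x_def y_def)
  then have "(cmod z)\<^sup>2 < 1\<^sup>2" using st by (auto simp: stable2_def)
  then show ?thesis by (rule power2_less_imp_less) simp
qed

lemma quadratic_cis_nonzero:
  assumes "stable2 b c" shows "charpoly2 b c \<omega> \<noteq> 0"
  using stable2_root[OF assms, of "cis \<omega>"] by auto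

text \<open>The reciprocal polynomial has a holomorphic logarithm on a neighbourhood of the closed disc, so
  this special case of Jensen's formula is the mean value property at \<open>0\<close>.\<close>

lemma mean_log_stable_polynomial:
  assumes st: "stable2 b c"
  shows "((\<lambda>\<omega>. ln ((cmod (charpoly2 b c \<omega>))\<^sup>2)) has_integral 0) {-pi..pi}"
proof -
  \<comment> \<open>The reciprocal polynomial at \<open>- z\<close>. The sign is undone by the
    rotation by \<open>pi\<close> that carries the range \<open>{0..2 * pi}\<close> of the circle
    path to \<open>{-pi..pi}\<close>.\<close>
  define g where "g = (\<lambda>z::complex. 1 - of_real b * z + of_real c * z\<^sup>2)"
  have st': "stable2 (- b) c" using st by (simp add: stable2_def)
  have g_nz: "g z \<noteq> 0" if "z \<in> cball 0 1" for z
  proof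
    assume 0: "g z = 0"
    then have z: "z \<noteq> 0" by (auto simp: g_def)
    have "(1 / z)\<^sup>2 + of_real (- b) * (1 / z) + of_real c = g z / z\<^sup>2"
      using z by (simp add: g_def field_simps power2_eq_square)
    then have "cmod (1 / z) < 1" using stable2_root[OF st'] 0 by simp
    then show False using that z by (simp add: norm_divide field_simps)
  qed
  have "open {z. g z \<noteq> 0}" unfolding g_def by (intro open_Collect_neq continuous_intros)
  moreover have "cball 0 1 \<subseteq> {z. g z \<noteq> 0}" using g_nz by blast
  ultimately obtain e where e: "e > 0" "(\<Union>x\<in>cball 0 1. ball x e) \<subseteq> {z. g z \<noteq> 0}"
    using compact_subset_open_imp_ball_epsilon_subset[OF compact_cball] by blast
  \<comment> \<open>A slightly larger disc is still free of zeros, and its convexity provides the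
    logarithm. For a point outside the closed unit disc, \<open>sgn z\<close> is the nearest point
    of that disc.\<close>
  have ball: "ball 0 (1 + e) \<subseteq> {z. g z \<noteq> 0}"
  proof
    fix z :: complex assume z: "z \<in> ball 0 (1 + e)"
    show "z \<in> {z. g z \<noteq> 0}"
    proof (cases "cmod z \<le> 1")
      case True then show ?thesis using g_nz by simp
    next
      case False
      have "z \<in> ball (sgn z) e"
      proof -
        have "(1 - cmod z) * inverse (cmod z) = inverse (cmod z) - 1"
        proof -
          have "cmod z \<noteq> 0" using False by linarith
          from right_inverse[OF this] show ?thesis by (simp only: left_diff_distrib mult_1)
        qed
        then have "sgn z - z = (1 - cmod z) *\<^sub>R sgn z"
          by (simp add: scaleR_diff_left sgn_div_norm)
        then have "cmod (sgn z - z) = cmod z - 1" using False by (auto simp: norm_sgn)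
        then show ?thesis using z by (simp add: dist_norm)
      qed
      moreover have "sgn z \<in> cball 0 1" by (simp add: norm_sgn)
      ultimately show ?thesis using e(2) by blast
    qed
  qed
  obtain L where L: "L holomorphic_on ball 0 (1 + e)" "\<And>x. x \<in> ball 0 (1 + e) \<Longrightarrow> exp (L x) = g x"
  proof (rule holomorphic_logarithm_exists[of "ball 0 (1 + e)" g 0])
    show "g holomorphic_on ball 0 (1 + e)" unfolding g_def by (intro holomorphic_intros)
  qed (use ball e in auto)
  have sub: "cball 0 1 \<subseteq> ball (0::complex) (1 + e)" using e(1) by auto
  have "((\<lambda>u. L u / (u - 0)) has_contour_integral (2 * of_real pi * \<i> * L 0)) (circlepath 0 1)"
  proof (rule Cauchy_integral_circlepath)
    show "continuous_on (cball 0 1) L"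
      using L(1) sub by (meson continuous_on_subset holomorphic_on_imp_continuous_on)
    show "L holomorphic_on ball 0 1"
      using L(1) sub by (meson ball_subset_cball holomorphic_on_subset order_trans)
  qed simp
  then have "((\<lambda>t. L (0 + 1 * cis t) / (0 + 1 * cis t - 0) * 1 * \<i> * cis t) has_integral (2 * of_real pi * \<i> * L 0)) {0..2 * pi}"
    unfolding circlepath_def by (subst (asm) has_contour_integral_part_circlepath_iff) (auto)
  then have "((\<lambda>t. L (cis t) * \<i>) has_integral (2 * of_real pi * \<i> * L 0)) {0..2 * pi}"
    by (rule has_integral_eq[rotated]) (simp add: field_simps)
  \<comment> \<open>The factor \<open>\<i>\<close> from the parametrization turns the imaginary part
    of the contour integral into the integral of \<open>Re L\<close>, which is
    \<open>ln (cmod g)\<close>.\<close>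
  from has_integral_Im[OF this]
  have i1: "((\<lambda>t. Re (L (cis t))) has_integral (2 * pi * Re (L 0))) {0..2 * pi}" by simp
  have Re_L: "Re (L z) = ln (cmod (g z))" if "z \<in> ball 0 (1 + e)" for z
    using L(2)[OF that, symmetric] by simp
  have L0: "Re (L 0) = 0" using Re_L[of 0] e by (simp add: g_def)
  have "((\<lambda>t. ln (cmod (g (cis t)))) has_integral 0) {- pi + pi..pi + pi}"
    using i1 unfolding L0 using e(1) by (auto elim!: has_integral_eq[rotated] simp: Re_L)
  then have "((\<lambda>t. ln (cmod (g (cis t)))) \<circ> (+) pi has_integral 0) {-pi..pi}"
    by (subst has_integral_shift_Icc_real) simp
  from has_integral_mult_right[OF this, of 2]
  have "((\<lambda>\<omega>. 2 * ln (cmod (g (cis (pi + \<omega>))))) has_integral 0) {-pi..pi}" by (simp add: o_def)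
  moreover have "2 * ln (cmod (g (cis (pi + \<omega>)))) = ln ((cmod (charpoly2 b c \<omega>))\<^sup>2)" for \<omega>
  proof -
    have cn: "cis (- \<omega>) = cnj (cis \<omega>)" by (simp add: cis_cnj)
    have "g (cis (pi + \<omega>)) = 1 + of_real b * cis \<omega> + of_real c * (cis \<omega>)\<^sup>2"
      by (simp add: g_def cis_mult[symmetric])
    also have "\<dots> = (cis \<omega>)\<^sup>2 * cnj (charpoly2 b c \<omega>)"
      using cis_mult[of \<omega> "- \<omega>"] by (simp add: cn power2_eq_square algebra_simps)
    finally have "cmod (g (cis (pi + \<omega>))) = cmod (charpoly2 b c \<omega>)"
      by (simp only: norm_mult norm_power norm_cis complex_mod_cnj) simp
    then show ?thesis using quadratic_cis_nonzero[OF st, of \<omega>] by (simp add: ln_realpow)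
  qed
  ultimately show ?thesis by simp
qed

context spectral_factor
begin

lemma spectral_identity:
  "(cmod (charpoly2 b c \<omega>))\<^sup>2 - \<tau> = A * (cmod (charpoly2 B C \<omega>))\<^sup>2"
proof -
  have "A * (cmod (charpoly2 B C \<omega>))\<^sup>2
    = (A + A * B\<^sup>2 + A * C\<^sup>2) + 2 * (A * B * (1 + C)) * cos \<omega> + 2 * (A * C) * cos (2 * \<omega>)"
    unfolding cmod_quadratic_cis by (simp add: algebra_simps)
  then show ?thesis unfolding cmod_quadratic_cis f0 AB AC by simp
qed

lemma ratio_eq:
  "1 - \<tau> / (cmod (charpoly2 b c \<omega>))\<^sup>2
    = A * (cmod (charpoly2 B C \<omega>))\<^sup>2 / (cmod (charpoly2 b c \<omega>))\<^sup>2"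
  unfolding spectral_identity[symmetric] using quadratic_cis_nonzero[OF stable, of \<omega>] by (simp add: diff_divide_distrib)

lemma ratio_pos: "0 < 1 - \<tau> / (cmod (charpoly2 b c \<omega>))\<^sup>2"
  unfolding ratio_eq using quadratic_cis_nonzero[OF stable, of \<omega>] quadratic_cis_nonzero[OF stable_BC, of \<omega>] A_pos
  by (intro divide_pos_pos mult_pos_pos) auto

lemma log_ratio_integral:
  "((\<lambda>\<omega>. ln (1 - \<tau> / (cmod (charpoly2 b c \<omega>))\<^sup>2)) has_integral (2 * pi * ln A)) {-pi..pi}"
proof -
  have "ln (1 - \<tau> / (cmod (charpoly2 b c \<omega>))\<^sup>2)
     = ln A + ln ((cmod (charpoly2 B C \<omega>))\<^sup>2) - ln ((cmod (charpoly2 b c \<omega>))\<^sup>2)" for \<omega>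
    unfolding ratio_eq using quadratic_cis_nonzero[OF stable, of \<omega>] quadratic_cis_nonzero[OF stable_BC, of \<omega>] A_pos
    by (subst ln_div) (auto simp: ln_mult)
  moreover have "((\<lambda>\<omega>. ln A + ln ((cmod (charpoly2 B C \<omega>))\<^sup>2) - ln ((cmod (charpoly2 b c \<omega>))\<^sup>2))
     has_integral (2 * pi * ln A + 0 - 0)) {-pi..pi}"
    using has_integral_const_real[of "ln A" "-pi" pi]
    by (intro has_integral_diff has_integral_add mean_log_stable_polynomial stable stable_BC) simp
  ultimately show ?thesis by simp
qed

end

text \<open>Comparing coefficients in \<open>|p|\<^sup>2 - \<tau> = A |q|\<^sup>2\<close> and eliminating \<open>q\<close>, one finds that
  \<open>h = (A + c)\<^sup>2 / A\<close> solves \<open>h + k\<^sup>2 / h = E\<close>; the larger root of each quadratic equation is the stable one.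
  \<open>sf_dl\<close> is minus the derivative of \<open>ln A\<close> with respect to \<open>\<tau>\<close>.\<close>

definition sf_k :: "real \<Rightarrow> real \<Rightarrow> real" where "sf_k b c = \<bar>b\<bar> * (1 + c)"
definition sf_E :: "real \<Rightarrow> real \<Rightarrow> real \<Rightarrow> real" where "sf_E b c \<tau> = (1 + c)\<^sup>2 + b\<^sup>2 - \<tau>"
definition sf_s :: "real \<Rightarrow> real \<Rightarrow> real \<Rightarrow> real" where "sf_s b c \<tau> = sqrt ((sf_E b c \<tau>)\<^sup>2 - 4 * (sf_k b c)\<^sup>2)"
definition sf_h :: "real \<Rightarrow> real \<Rightarrow> real \<Rightarrow> real" where "sf_h b c \<tau> = (sf_E b c \<tau> + sf_s b c \<tau>) / 2"
definition sf_r :: "real \<Rightarrow> real \<Rightarrow> real \<Rightarrow> real" where "sf_r b c \<tau> = sqrt (sf_h b c \<tau> * (sf_h b c \<tau> - 4 * c))"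
definition sf_A :: "real \<Rightarrow> real \<Rightarrow> real \<Rightarrow> real" where "sf_A b c \<tau> = (sf_h b c \<tau> - 2 * c + sf_r b c \<tau>) / 2"
definition sf_dl :: "real \<Rightarrow> real \<Rightarrow> real \<Rightarrow> real" where "sf_dl b c \<tau> = sf_h b c \<tau> / (sf_s b c \<tau> * sf_r b c \<tau>)"
text \<open>For stable coefficients this is the minimum of \<open>|p|^2\<close> over the unit
  circle, a quadratic in \<open>cos \<omega>\<close>: in the first case its vertex lies strictly
  between -1 and 1, in the second the minimum is at an endpoint.\<close>

definition sf_crit :: "real \<Rightarrow> real \<Rightarrow> real" where
  "sf_crit b c = (if sf_k b c < 4 * c then (1 - c)\<^sup>2 * (1 - b\<^sup>2 / (4 * c)) else (1 + c - \<bar>b\<bar>)\<^sup>2)"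

section \<open>The explicit spectral factor and its steepness at the critical value\<close>

lemma sf_k_nonneg: "stable2 b c \<Longrightarrow> 0 \<le> sf_k b c"
  by (auto simp: sf_k_def stable2_def)

text \<open>Criticality has two forms, matching the cases of \<open>sf_crit\<close>. At
  \<open>E = 2 * k\<close> the two solutions of \<open>h + k\<^sup>2 / h = E\<close> merge; at
  \<open>E = 4 * c + k\<^sup>2 / (4 * c)\<close>, the subject of \<open>sf_E_crit2\<close>,
  \<open>h\<close> reaches \<open>4 * c\<close> and the two solutions for \<open>A\<close>
  merge.\<close>

lemma sf_E_crit1: "sf_E b c \<tau> - 2 * sf_k b c = (1 + c - \<bar>b\<bar>)\<^sup>2 - \<tau>"
  by (simp add: sf_E_def sf_k_def power2_eq_square algebra_simps)

lemma sf_E_crit2: "sf_k b c < 4 * c \<Longrightarrow> stable2 b c \<Longrightarrow> sf_E b c \<tau> - (4 * c + (sf_k b c)\<^sup>2 / (4 * c)) = sf_crit b c - \<tau>"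
  using sf_k_nonneg[of b c] by (simp add: sf_E_def sf_k_def sf_crit_def power2_eq_square field_simps)

lemma sf_crit_le: assumes "stable2 b c" shows "sf_crit b c \<le> (1 + c - \<bar>b\<bar>)\<^sup>2"
proof (cases "sf_k b c < 4 * c")
  case True
  then have c: "0 < c" using sf_k_nonneg[OF assms] by simp
  have "0 \<le> (4 * c - sf_k b c)\<^sup>2 / (4 * c)" using c by simp
  also have "\<dots> = 4 * c + (sf_k b c)\<^sup>2 / (4 * c) - 2 * sf_k b c"
    using c by (simp add: power2_eq_square field_simps)
  finally show ?thesis using sf_E_crit1[of b c 0] sf_E_crit2[OF True assms, of 0] by simp
qed (simp add: sf_crit_def)

context
  fixes b c \<tau> :: real
  assumes st: "stable2 b c" and sub: "\<tau> < sf_crit b c"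
begin

lemma sf_E_gt: "2 * sf_k b c < sf_E b c \<tau>"
  using sf_E_crit1[of b c \<tau>] sf_crit_le[OF st] sub by simp

lemma sf_disc_pos: "0 < (sf_E b c \<tau>)\<^sup>2 - 4 * (sf_k b c)\<^sup>2"
proof -
  have "(sf_E b c \<tau>)\<^sup>2 - 4 * (sf_k b c)\<^sup>2 = (sf_E b c \<tau> - 2 * sf_k b c) * (sf_E b c \<tau> + 2 * sf_k b c)"
    by (simp add: power2_eq_square algebra_simps)
  also have "0 < \<dots>" using sf_E_gt sf_k_nonneg[OF st] by (intro mult_pos_pos) auto
  finally show ?thesis .
qed

lemma sf_s_pos: "0 < sf_s b c \<tau>" using sf_disc_pos by (simp add: sf_s_def)

lemma sf_s_sq: "(sf_s b c \<tau>)\<^sup>2 = (sf_E b c \<tau>)\<^sup>2 - 4 * (sf_k b c)\<^sup>2"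
  using sf_disc_pos by (simp add: sf_s_def)

lemma sf_h_ge: "sf_E b c \<tau> / 2 \<le> sf_h b c \<tau>" "sf_k b c < sf_h b c \<tau>" "0 < sf_h b c \<tau>"
  using sf_s_pos sf_E_gt sf_k_nonneg[OF st] by (simp_all add: sf_h_def)

lemma sf_h_quad: "sf_h b c \<tau> * sf_h b c \<tau> + (sf_k b c)\<^sup>2 = sf_E b c \<tau> * sf_h b c \<tau>"
  using sf_s_sq by (simp add: sf_h_def power2_eq_square field_simps)

lemma sf_h_eq: "sf_h b c \<tau> + (sf_k b c)\<^sup>2 / sf_h b c \<tau> = sf_E b c \<tau>"
  using sf_h_quad sf_h_ge(3) by (simp add: field_simps)

text \<open>The increment of \<open>h + k\<^sup>2 / h\<close> between \<open>4 * c\<close> and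
  \<open>h\<close>, in factored form. The second factor is positive because \<open>h\<close> and
  \<open>4 * c\<close> both exceed \<open>k\<close>, so \<open>h - 4 * c\<close> has the sign of the
  distance to criticality.\<close>

lemma sf_h_gap:
  assumes "sf_k b c < 4 * c"
  shows "(sf_h b c \<tau> - 4 * c) * (1 - (sf_k b c)\<^sup>2 / (4 * c * sf_h b c \<tau>)) = sf_crit b c - \<tau>"
proof -
  have c: "0 < c" using assms sf_k_nonneg[OF st] by simp
  have "(sf_h b c \<tau> - 4 * c) * (1 - (sf_k b c)\<^sup>2 / (4 * c * sf_h b c \<tau>))
    = sf_h b c \<tau> + (sf_k b c)\<^sup>2 / sf_h b c \<tau> - (4 * c + (sf_k b c)\<^sup>2 / (4 * c))"
    using c sf_h_ge(3) by (simp add: field_simps)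
  then show ?thesis using sf_h_eq sf_E_crit2[OF assms st, of \<tau>] by simp
qed

lemma sf_h_gt_4c: "4 * c < sf_h b c \<tau>"
proof (cases "sf_k b c < 4 * c")
  case True
  have "0 < 1 - (sf_k b c)\<^sup>2 / (4 * c * sf_h b c \<tau>)"
  proof -
    have "(sf_k b c)\<^sup>2 < 4 * c * sf_h b c \<tau>"
      unfolding power2_eq_square using True sf_h_ge(2) sf_k_nonneg[OF st] by (intro mult_strict_mono) auto
    moreover have "0 < 4 * c * sf_h b c \<tau>" using True sf_k_nonneg[OF st] sf_h_ge(3) by simp
    ultimately show ?thesis by (simp add: divide_less_eq)
  qed
  moreover have "0 < (sf_h b c \<tau> - 4 * c) * (1 - (sf_k b c)\<^sup>2 / (4 * c * sf_h b c \<tau>))"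
    using sf_h_gap[OF True] sub by simp
  ultimately show ?thesis by (simp add: zero_less_mult_iff)
qed (use sf_h_ge in auto)

lemma sf_r_pos: "0 < sf_r b c \<tau>" using sf_h_gt_4c sf_h_ge(3) by (simp add: sf_r_def)

lemma sf_r_sq: "(sf_r b c \<tau>)\<^sup>2 = sf_h b c \<tau> * (sf_h b c \<tau> - 4 * c)"
  using sf_h_gt_4c sf_h_ge(3) by (simp add: sf_r_def)

lemma sf_A_ge: "(sf_h b c \<tau> - 2 * c) / 2 \<le> sf_A b c \<tau>"
  using sf_r_pos by (simp add: sf_A_def)

lemma sf_A_gt: "\<bar>c\<bar> < sf_A b c \<tau>"
  using sf_r_pos sf_h_gt_4c sf_h_ge(3) by (simp add: sf_A_def abs_if)

lemma sf_A_quad: "(sf_A b c \<tau> + c)\<^sup>2 = sf_h b c \<tau> * sf_A b c \<tau>"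
  using sf_r_sq by (simp add: sf_A_def power2_eq_square field_simps)

lemma spectral_factor_sf_A: "spectral_factor b c \<tau> (sf_A b c \<tau>)"
proof
  let ?A = "sf_A b c \<tau>"
  have A: "0 < ?A" using sf_A_gt by linarith
  have "?A * (\<bar>b\<bar> * (1 + c)) = sf_k b c * ?A" by (simp add: sf_k_def)
  also have "\<dots> < sf_h b c \<tau> * ?A" using A sf_h_ge by simp
  finally show "?A * (\<bar>b\<bar> * (1 + c)) < (?A + c)\<^sup>2" by (simp add: sf_A_quad)
  have k: "(sf_k b c)\<^sup>2 = (b * (1 + c))\<^sup>2" by (simp add: sf_k_def power_mult_distrib)
  show "(1 + c)\<^sup>2 + b\<^sup>2 - \<tau> = (?A + c)\<^sup>2 / ?A + (b * (1 + c))\<^sup>2 * ?A / (?A + c)\<^sup>2"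
    using sf_h_eq A unfolding sf_A_quad k by (simp add: sf_E_def)
qed (use st sf_A_gt in auto)

text \<open>Differentiating along the two quadratic equations gives \<open>h' = - h / s\<close> and
  \<open>A' / A = h' / r\<close>; in the logarithm the factor \<open>A\<close> cancels.\<close>

lemma sf_ln_A_deriv: "((\<lambda>t. ln (sf_A b c t)) has_real_derivative - sf_dl b c \<tau>) (at \<tau>)"
proof -
  let ?s = "sf_s b c \<tau>" and ?h = "sf_h b c \<tau>" and ?r = "sf_r b c \<tau>" and ?A = "sf_A b c \<tau>"
  have A: "0 < ?A" using sf_A_gt by linarith
  have dE: "(sf_E b c has_real_derivative - 1) (at \<tau>)"
    unfolding sf_E_def by (auto intro!: derivative_eq_intros)
  have ds: "(sf_s b c has_real_derivative - sf_E b c \<tau> / ?s) (at \<tau>)"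
    unfolding sf_s_def using sf_disc_pos
    by (auto intro!: derivative_eq_intros dE simp: field_simps)
  have dh: "(sf_h b c has_real_derivative - ?h / ?s) (at \<tau>)"
  proof -
    have "((\<lambda>t. (sf_E b c t + sf_s b c t) / 2) has_real_derivative (- 1 + - sf_E b c \<tau> / ?s) / 2) (at \<tau>)"
      by (intro DERIV_cdivide DERIV_add dE ds)
    moreover have "(- 1 + - sf_E b c \<tau> / ?s) / 2 = - ?h / ?s" using sf_s_pos by (simp add: sf_h_def field_simps)
    ultimately have "((\<lambda>t. (sf_E b c t + sf_s b c t) / 2) has_real_derivative - ?h / ?s) (at \<tau>)" by (simp only:)
    then show ?thesis unfolding sf_h_def[abs_def] .
  qed
  have dr: "(sf_r b c has_real_derivative (?h - 2 * c) * (- ?h / ?s) / ?r) (at \<tau>)"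
  proof -
    have "((\<lambda>t. sf_h b c t - 4 * c) has_real_derivative - ?h / ?s) (at \<tau>)"
      using DERIV_diff[OF dh DERIV_const[of "4 * c"]] by simp
    from DERIV_mult[OF dh this]
    have "((\<lambda>t. sf_h b c t * (sf_h b c t - 4 * c)) has_real_derivative - ?h / ?s * (?h - 4 * c) + - ?h / ?s * ?h) (at \<tau>)" .
    moreover have "0 < ?h * (?h - 4 * c)" using sf_h_gt_4c sf_h_ge(3) by simp
    ultimately have "((\<lambda>t. sqrt (sf_h b c t * (sf_h b c t - 4 * c))) has_real_derivative
        inverse (sqrt (?h * (?h - 4 * c))) / 2 * (- ?h / ?s * (?h - 4 * c) + - ?h / ?s * ?h)) (at \<tau>)"
      by (rule DERIV_chain2[OF DERIV_real_sqrt, rotated])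
    moreover have "inverse (sqrt (?h * (?h - 4 * c))) / 2 * (- ?h / ?s * (?h - 4 * c) + - ?h / ?s * ?h) = (?h - 2 * c) * (- ?h / ?s) / ?r"
      unfolding sf_r_def[symmetric] using sf_r_pos sf_s_pos by (simp add: field_simps)
    ultimately have "((\<lambda>t. sqrt (sf_h b c t * (sf_h b c t - 4 * c))) has_real_derivative (?h - 2 * c) * (- ?h / ?s) / ?r) (at \<tau>)"
      by (simp only:)
    then show ?thesis unfolding sf_r_def[abs_def] .
  qed
  have dA: "(sf_A b c has_real_derivative (- ?h / ?s) * ?A / ?r) (at \<tau>)"
  proof -
    have "((\<lambda>t. (sf_h b c t - 2 * c + sf_r b c t) / 2) has_real_derivative (- ?h / ?s - 0 + (?h - 2 * c) * (- ?h / ?s) / ?r) / 2) (at \<tau>)"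
      by (intro DERIV_cdivide DERIV_add DERIV_diff DERIV_const dh dr)
    moreover have "(- ?h / ?s - 0 + (?h - 2 * c) * (- ?h / ?s) / ?r) / 2 = (- ?h / ?s) * ?A / ?r"
      using sf_r_pos sf_s_pos by (simp add: sf_A_def field_simps)
    ultimately have "((\<lambda>t. (sf_h b c t - 2 * c + sf_r b c t) / 2) has_real_derivative (- ?h / ?s) * ?A / ?r) (at \<tau>)" by (simp only:)
    then show ?thesis unfolding sf_A_def[abs_def] .
  qed
  show ?thesis
  proof -
    have "inverse ?A * ((- ?h / ?s) * ?A / ?r) = - sf_dl b c \<tau>"
      using A sf_r_pos sf_s_pos by (simp add: sf_dl_def field_simps)
    with DERIV_chain2[OF DERIV_ln[OF A] dA] show ?thesis by (simp only:)
  qed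
qed

lemma sf_dl_pos: "0 < sf_dl b c \<tau>"
  using sf_h_ge(3) sf_s_pos sf_r_pos by (simp add: sf_dl_def)

lemma sf_dl_sq: "(sf_dl b c \<tau>)\<^sup>2 = sf_h b c \<tau> / (((sf_E b c \<tau>)\<^sup>2 - 4 * (sf_k b c)\<^sup>2) * (sf_h b c \<tau> - 4 * c))"
  using sf_h_ge(3) sf_h_gt_4c
  by (simp add: sf_dl_def power_divide power_mult_distrib sf_s_sq sf_r_sq) (simp add: power2_eq_square)

text \<open>Only the two factors that can vanish at criticality are kept; the others are compared
  through \<open>E / 2 \<le> h\<close> and \<open>E + 2 * k \<le> 2 * E\<close>.\<close>

lemma sf_dl_sq_ge: "1 / (4 * ((sf_E b c \<tau> - 2 * sf_k b c) * (sf_h b c \<tau> - 4 * c))) \<le> (sf_dl b c \<tau>)\<^sup>2"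
proof -
  let ?E = "sf_E b c \<tau>" and ?k = "sf_k b c" and ?h = "sf_h b c \<tau>"
  have E: "0 < ?E" "0 < ?E - 2 * ?k" "0 < ?h - 4 * c" using sf_E_gt sf_k_nonneg[OF st] sf_h_gt_4c by auto
  have "1 / (4 * ((?E - 2 * ?k) * (?h - 4 * c))) = (?E / 2) / ((?E - 2 * ?k) * (2 * ?E) * (?h - 4 * c))"
  proof -
    have "1 / (4 * (x * y)) = (e / 2) / (x * (2 * e) * y)" if "e > 0" for e x y :: real
      using that by simp
    then show ?thesis using E(1) by blast
  qed
  also have "\<dots> \<le> ?h / ((?E - 2 * ?k) * (?E + 2 * ?k) * (?h - 4 * c))"
    using E sf_h_ge sf_k_nonneg[OF st] by (intro frac_le mult_right_mono mult_left_mono mult_pos_pos) auto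
  also have "\<dots> = (sf_dl b c \<tau>)\<^sup>2" unfolding sf_dl_sq
    by (simp add: power2_eq_square algebra_simps)
  finally show ?thesis .
qed

lemma sf_far:
  assumes far: "\<tau> \<le> - (16 * \<bar>c\<bar>) - 1"
  shows "sf_dl b c \<tau> \<le> 2 / (- \<tau>)" "- \<tau> / 8 \<le> sf_A b c \<tau>"
proof -
  let ?E = "sf_E b c \<tau>" and ?k = "sf_k b c" and ?h = "sf_h b c \<tau>"
  have "?E \<ge> 2 * ?k - \<tau>" using sf_E_crit1[of b c \<tau>] zero_le_power2[of "1 + c - \<bar>b\<bar>"] by linarith
  then have E: "- \<tau> \<le> ?E - 2 * ?k" "- \<tau> \<le> ?E + 2 * ?k" using sf_k_nonneg[OF st] by auto
  \<comment> \<open>The constant 16 yields \<open>h \<ge> 8 * \<bar>c\<bar>\<close>, hence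
    \<open>h - 4 * c \<ge> h / 2\<close>.\<close>
  have h8: "8 * \<bar>c\<bar> \<le> ?h" and h2: "- \<tau> / 2 \<le> ?h" using sf_h_ge(1) E far sf_k_nonneg[OF st] by auto
  have hc: "?h / 2 \<le> ?h - 4 * c" using h8 by linarith
  have "(sf_dl b c \<tau>)\<^sup>2 = ?h / ((?E - 2 * ?k) * (?E + 2 * ?k) * (?h - 4 * c))"
    unfolding sf_dl_sq by (simp add: power2_eq_square algebra_simps)
  also have "\<dots> \<le> ?h / ((- \<tau>) * (- \<tau>) * (?h / 2))"
    using E hc far sf_h_ge(3) by (intro divide_left_mono mult_mono mult_pos_pos) auto
  also have "\<dots> = 2 / (- \<tau>)\<^sup>2" using sf_h_ge(3) by (simp add: power2_eq_square)
  also have "\<dots> \<le> (2 / (- \<tau>))\<^sup>2" by (simp add: power_divide divide_right_mono)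
  finally show "sf_dl b c \<tau> \<le> 2 / (- \<tau>)"
    by (rule power2_le_imp_le) (use far in auto)
  show "- \<tau> / 8 \<le> sf_A b c \<tau>" using sf_A_ge h2 far abs_ge_self[of c] by simp
qed

end

text \<open>In \<open>sf_dl_sq_ge\<close> one factor vanishes linearly at the critical value,
  \<open>h - 4 * c\<close> in the first case and \<open>E - 2 * k\<close> in the second, while
  \<open>W\<close> bounds the other on the unit interval below it. So \<open>sf_dl\<close> blows up
  at least like the inverse square root of the distance.\<close>

lemma sf_steep:
  assumes st: "stable2 b c"
  obtains K where "0 < K" "\<And>\<tau>. \<tau> < sf_crit b c \<Longrightarrow> sf_crit b c - 1 < \<tau> \<Longrightarrow> K / (sf_crit b c - \<tau>) \<le> (sf_dl b c \<tau>)\<^sup>2"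
proof (cases "sf_k b c < 4 * c")
  case True
  have k: "0 \<le> sf_k b c" and c: "0 < c" using sf_k_nonneg[OF st] True by auto
  define w where "w = 1 - (sf_k b c)\<^sup>2 / (16 * c\<^sup>2)"
  define W where "W = 4 * c + (sf_k b c)\<^sup>2 / (4 * c) + 1"
  have "(sf_k b c)\<^sup>2 < (4 * c)\<^sup>2" using True k by (intro power_strict_mono) auto
  then have w: "0 < w" using c by (simp add: w_def power_mult_distrib)
  have W: "0 < W" using c by (simp add: W_def add_pos_nonneg)
  show ?thesis
  proof (rule that[of "w / (4 * W)"])
    fix \<tau> assume \<tau>: "\<tau> < sf_crit b c" "sf_crit b c - 1 < \<tau>"
    note h = sf_h_gt_4c[OF st \<tau>(1)] sf_E_gt[OF st \<tau>(1)]
    have E: "sf_E b c \<tau> - 2 * sf_k b c \<le> W"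
      using sf_E_crit2[OF True st, of \<tau>] \<tau> k by (simp add: W_def)
    have "(sf_k b c)\<^sup>2 / (4 * c * sf_h b c \<tau>) \<le> (sf_k b c)\<^sup>2 / (4 * c * (4 * c))"
      using c h by (intro divide_left_mono mult_left_mono mult_pos_pos) auto
    then have "w \<le> 1 - (sf_k b c)\<^sup>2 / (4 * c * sf_h b c \<tau>)" by (simp add: w_def power2_eq_square)
    then have "(sf_h b c \<tau> - 4 * c) * w \<le> sf_crit b c - \<tau>"
      unfolding sf_h_gap[OF st \<tau>(1) True, symmetric] using h by (intro mult_left_mono) auto
    then have hw: "sf_h b c \<tau> - 4 * c \<le> (sf_crit b c - \<tau>) / w" using w by (simp add: field_simps)
    have "w / (4 * W) / (sf_crit b c - \<tau>) = 1 / (4 * (W * ((sf_crit b c - \<tau>) / w)))" using w by simp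
    also have "\<dots> \<le> 1 / (4 * ((sf_E b c \<tau> - 2 * sf_k b c) * (sf_h b c \<tau> - 4 * c)))"
      using E hw h W w \<tau> by (intro divide_left_mono mult_left_mono mult_mono mult_pos_pos) auto
    also have "\<dots> \<le> (sf_dl b c \<tau>)\<^sup>2" by (rule sf_dl_sq_ge[OF st \<tau>(1)])
    finally show "w / (4 * W) / (sf_crit b c - \<tau>) \<le> (sf_dl b c \<tau>)\<^sup>2" .
  qed (use w W in auto)
next
  case False
  then have crit: "sf_crit b c = (1 + c - \<bar>b\<bar>)\<^sup>2" by (simp add: sf_crit_def)
  define W where "W = 2 * sf_k b c + 1 - 4 * c"
  have W: "0 < W" using False sf_k_nonneg[OF st] by (simp add: W_def)
  show ?thesis
  proof (rule that[of "1 / (4 * W)"])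
    fix \<tau> assume \<tau>: "\<tau> < sf_crit b c" "sf_crit b c - 1 < \<tau>"
    note h = sf_h_gt_4c[OF st \<tau>(1)] sf_E_gt[OF st \<tau>(1)]
    have E: "sf_E b c \<tau> - 2 * sf_k b c = sf_crit b c - \<tau>" using sf_E_crit1[of b c \<tau>] crit by simp
    have "sf_h b c \<tau> \<le> sf_E b c \<tau>" using sf_h_eq[OF st \<tau>(1)]
        divide_nonneg_pos[OF zero_le_power2 sf_h_ge(3)[OF st \<tau>(1)], of "sf_k b c"] by simp
    then have hW: "sf_h b c \<tau> - 4 * c \<le> W" using E \<tau> by (simp add: W_def)
    have "1 / (4 * W) / (sf_crit b c - \<tau>) = 1 / (4 * ((sf_crit b c - \<tau>) * W))" by simp
    also have "\<dots> \<le> 1 / (4 * ((sf_E b c \<tau> - 2 * sf_k b c) * (sf_h b c \<tau> - 4 * c)))"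
      using E hW h W \<tau> by (intro divide_left_mono mult_left_mono mult_pos_pos) auto
    also have "\<dots> \<le> (sf_dl b c \<tau>)\<^sup>2" by (rule sf_dl_sq_ge[OF st \<tau>(1)])
    finally show "1 / (4 * W) / (sf_crit b c - \<tau>) \<le> (sf_dl b c \<tau>)\<^sup>2" .
  qed (use W in auto)
qed

lemma sf_dl_cont:
  assumes st: "stable2 b c"
  shows "continuous_on {..<sf_crit b c} (sf_dl b c)"
proof -
  have s: "continuous_on {..<sf_crit b c} (sf_s b c)"
    unfolding sf_s_def sf_E_def by (intro continuous_intros)
  then have h: "continuous_on {..<sf_crit b c} (sf_h b c)"
    unfolding sf_h_def sf_E_def by (intro continuous_intros) auto
  then have "continuous_on {..<sf_crit b c} (sf_r b c)"
    unfolding sf_r_def by (intro continuous_intros)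
  then have "continuous_on {..<sf_crit b c} (\<lambda>\<tau>. sf_h b c \<tau> / (sf_s b c \<tau> * sf_r b c \<tau>))"
    using s h sf_s_pos[OF st] sf_r_pos[OF st]
    by (intro continuous_on_divide continuous_on_mult) (auto simp: less_imp_neq[symmetric])
  then show ?thesis by (simp add: sf_dl_def[abs_def])
qed

text \<open>The link between the formula for \<open>H_inf\<close> and the factorization:
  \<open>s_tilde\<close> is the minimum of \<open>|p|\<close> on the circle, so
  \<open>\<theta>\<close> becomes critical where the shifted symbol first touches 0.\<close>

lemma s_tilde_crit:
  assumes "stable2 (b_tilde \<alpha> \<beta> \<nu> l) (c_tilde \<alpha> \<beta> \<nu> l)"
  shows "(s_tilde \<alpha> \<beta> \<nu> l)\<^sup>2 = sf_crit (b_tilde \<alpha> \<beta> \<nu> l) (c_tilde \<alpha> \<beta> \<nu> l)" "0 < s_tilde \<alpha> \<beta> \<nu> l"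
proof -
  define b c where "b = b_tilde \<alpha> \<beta> \<nu> l" and "c = c_tilde \<alpha> \<beta> \<nu> l"
  have st: "\<bar>c\<bar> < 1" "\<bar>b\<bar> < 1 + c" using assms by (auto simp: stable2_def b_def c_def)
  have k0: "0 \<le> \<bar>b\<bar> * (1 + c)" using st by auto
  have cond: "(0 < c \<and> \<bar>b\<bar> * (1 + c) / (4 * c) < 1) \<longleftrightarrow> sf_k b c < 4 * c"
    using k0 by (cases "0 < c") (auto simp: sf_k_def field_simps)
  have s: "s_tilde \<alpha> \<beta> \<nu> l = (if sf_k b c < 4 * c then \<bar>1 - c\<bar> * sqrt (1 - b\<^sup>2 / (4 * c)) else \<bar>\<bar>1 + c\<bar> - \<bar>b\<bar>\<bar>)"
    unfolding s_tilde_def Let_def b_def[symmetric] c_def[symmetric] cond ..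
  have pos: "0 < 1 - b\<^sup>2 / (4 * c)" if "sf_k b c < 4 * c"
  proof -
    have "b\<^sup>2 = \<bar>b\<bar> * \<bar>b\<bar>" by (simp add: power2_eq_square)
    also have "\<dots> \<le> \<bar>b\<bar> * (1 + c)" using st by (intro mult_left_mono) auto
    also have "\<dots> < 4 * c" using that by (simp add: sf_k_def)
    finally show ?thesis using that k0 by (simp add: sf_k_def)
  qed
  show "(s_tilde \<alpha> \<beta> \<nu> l)\<^sup>2 = sf_crit (b_tilde \<alpha> \<beta> \<nu> l) (c_tilde \<alpha> \<beta> \<nu> l)"
    unfolding s sf_crit_def b_def[symmetric] c_def[symmetric] using pos st by (auto simp: power_mult_distrib)
  show "0 < s_tilde \<alpha> \<beta> \<nu> l" unfolding s using pos st by auto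
qed

section \<open>Orthogonal diagonalization and isotropic Gaussian densities\<close>

declare transpose_matrix_vector [simp del]

lemma sum_UNIV_Plus:
  fixes g :: "'a::finite + 'b::finite \<Rightarrow> 'c::comm_monoid_add"
  shows "(\<Sum>j\<in>UNIV. g j) = (\<Sum>k\<in>UNIV. g (Inl k)) + (\<Sum>k\<in>UNIV. g (Inr k))"
  by (subst UNIV_Plus_UNIV[symmetric], subst sum.Plus) auto

lemma diag_matrix_mult_vec: "diag_matrix l *v v = (\<chi> i. l i * v $ i)"
  by (simp add: vec_eq_iff matrix_vector_mult_def diag_matrix_def if_distrib[where f="\<lambda>x. x * _"] cong: if_cong)

lemma orthogonal_cancel:
  assumes "orthogonal_matrix (U :: 'a::comm_semiring_1^'n^'n)"
  shows "transpose U *v (U *v v) = v" "U *v (transpose U *v v) = v"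
  using assms by (simp_all add: matrix_vector_mul_assoc orthogonal_matrix_def)

lemma inner_transpose: "x \<bullet> (A *v y) = (transpose A *v x) \<bullet> (y :: real^'n)" for A :: "real^'n^'m"
  by (simp add: dot_lmul_matrix[symmetric] transpose_matrix_vector)

lemma norm_orthogonal:
  assumes "orthogonal_matrix (U :: real^'n^'n)" shows "norm (U *v x) = norm x"
  by (simp add: norm_eq_sqrt_inner inner_transpose orthogonal_cancel[OF assms])

text \<open>Translation invariance forces the image of Lebesgue measure under an isometry to be a multiple
  of it; testing on a ball identifies the factor. (The library's change of variables is only
  stated for well-ordered index types.)\<close>

lemma nn_integral_orthogonal:
  fixes U :: "real^'n^'n"
  assumes U: "orthogonal_matrix U" and [measurable]: "f \<in> borel_measurable borel"
  shows "(\<integral>\<^sup>+ x. f (U *v x) \<partial>lborel) = (\<integral>\<^sup>+ x. f x \<partial>lborel)"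
proof -
  have [measurable]: "(\<lambda>x. A *v x) \<in> borel_measurable borel" for A :: "real^'n^'n"
    by (intro borel_measurable_continuous_onI continuous_intros)
  have trans: "(\<integral>\<^sup>+ x. g (x + a) \<partial>lborel) = (\<integral>\<^sup>+ x. g x \<partial>lborel)"
    if [measurable]: "g \<in> borel_measurable borel" for g and a :: "real^'n"
    by (subst lborel_distr_plus[of a, symmetric]) (simp add: nn_integral_distr add.commute)
  let ?B = "ball (0::real^'n) 1"
  let ?b = "emeasure lborel ?B"
  have [measurable]: "?B \<in> sets borel" by simp
  have ball: "(\<integral>\<^sup>+ x. indicator ?B (x + a) \<partial>lborel) = ?b" for a :: "real^'n"
    by (subst trans) (auto intro!: borel_measurable_indicator)
  \<comment> \<open>The double integral is transformed by shifting \<open>x\<close> by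
    \<open>transpose U *v y\<close> and then \<open>y\<close> by \<open>- U *v x\<close>. This moves
    the rotation into the indicator of the ball, where it disappears by invariance.\<close>
  have "(\<integral>\<^sup>+ x. f (U *v x) \<partial>lborel) * ?b = (\<integral>\<^sup>+ x. \<integral>\<^sup>+ y. f (U *v x) * indicator ?B y \<partial>lborel \<partial>lborel)"
  proof -
    have "(\<integral>\<^sup>+ y. f (U *v x) * indicator ?B y \<partial>lborel) = f (U *v x) * ?b" for x
      by (rule nn_integral_cmult_indicator) simp
    then show ?thesis by (simp only:) (subst nn_integral_multc, measurable)
  qed
  also have "\<dots> = (\<integral>\<^sup>+ y. \<integral>\<^sup>+ x. f (U *v x) * indicator ?B y \<partial>lborel \<partial>lborel)"
    by (rule lborel_pair.Fubini') measurable
  also have "\<dots> = (\<integral>\<^sup>+ y. \<integral>\<^sup>+ x. f (U *v x + y) * indicator ?B y \<partial>lborel \<partial>lborel)"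
  proof (rule nn_integral_cong)
    fix y
    have "(\<integral>\<^sup>+ x. f (U *v (x + transpose U *v y)) * indicator ?B y \<partial>lborel) = (\<integral>\<^sup>+ x. f (U *v x) * indicator ?B y \<partial>lborel)"
      by (rule trans) measurable
    then show "(\<integral>\<^sup>+ x. f (U *v x) * indicator ?B y \<partial>lborel) = (\<integral>\<^sup>+ x. f (U *v x + y) * indicator ?B y \<partial>lborel)"
      by (simp add: matrix_vector_right_distrib orthogonal_cancel[OF U])
  qed
  also have "\<dots> = (\<integral>\<^sup>+ x. \<integral>\<^sup>+ y. f (U *v x + y) * indicator ?B y \<partial>lborel \<partial>lborel)"
    by (rule lborel_pair.Fubini') measurable
  also have "\<dots> = (\<integral>\<^sup>+ x. \<integral>\<^sup>+ y. f y * indicator ?B (y - U *v x) \<partial>lborel \<partial>lborel)"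
  proof (rule nn_integral_cong)
    fix x
    have "(\<integral>\<^sup>+ y. f (y + U *v x) * indicator ?B (y + U *v x - U *v x) \<partial>lborel) = (\<integral>\<^sup>+ y. f y * indicator ?B (y - U *v x) \<partial>lborel)"
      by (rule trans) measurable
    then show "(\<integral>\<^sup>+ y. f (U *v x + y) * indicator ?B y \<partial>lborel) = (\<integral>\<^sup>+ y. f y * indicator ?B (y - U *v x) \<partial>lborel)"
      by (simp add: add.commute)
  qed
  also have "\<dots> = (\<integral>\<^sup>+ y. \<integral>\<^sup>+ x. f y * indicator ?B (y - U *v x) \<partial>lborel \<partial>lborel)"
    by (rule lborel_pair.Fubini') measurable
  also have "\<dots> = (\<integral>\<^sup>+ y. f y * ?b \<partial>lborel)"
  proof (rule nn_integral_cong)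
    fix y
    have "indicator ?B (y - U *v x) = (indicator ?B (x + - (transpose U *v y)) :: ennreal)" for x
    proof -
      have "norm (y - U *v x) = norm (U *v (x + - (transpose U *v y)))"
        by (simp add: matrix_vector_right_distrib matrix_vector_mult_diff_distrib orthogonal_cancel[OF U] norm_minus_commute)
      then show ?thesis unfolding norm_orthogonal[OF U] by (simp add: indicator_def)
    qed
    then show "(\<integral>\<^sup>+ x. f y * indicator ?B (y - U *v x) \<partial>lborel) = f y * ?b"
      by (simp only:) (subst nn_integral_cmult, simp, simp only: ball)
  qed
  also have "\<dots> = (\<integral>\<^sup>+ x. f x \<partial>lborel) * ?b" by (simp add: nn_integral_multc)
  finally have eq: "(\<integral>\<^sup>+ x. f (U *v x) \<partial>lborel) * ?b = (\<integral>\<^sup>+ x. f x \<partial>lborel) * ?b" .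
  have "?b \<noteq> \<infinity>" using emeasure_lborel_ball_finite[of "0::real^'n" 1] by simp
  moreover have "?b \<noteq> 0"
  proof -
    have "0 < Gamma (real CARD('n) / 2 + 1)" by (rule Gamma_real_pos) (simp add: add_pos_nonneg add.commute)
    then have "Gamma (real CARD('n) / 2 + 1) \<noteq> 0" by (rule less_imp_neq[THEN not_sym])
    then show ?thesis by (simp add: emeasure_ball unit_ball_vol_def)
  qed
  ultimately show ?thesis using eq unfolding mult.commute[of _ ?b] ennreal_mult_cancel_left by auto
qed

lemma matrix_inv_eqI:
  assumes "A ** B = mat 1" "B ** A = mat 1" shows "matrix_inv A = (B :: 'a::semiring_1^'n^'n)"
proof -
  have "A ** matrix_inv A = mat 1 \<and> matrix_inv A ** A = mat 1"
    unfolding matrix_inv_def by (rule someI_ex) (use assms in blast)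
  then have "B ** (A ** matrix_inv A) = B" by simp
  then show ?thesis using assms by (simp add: matrix_mul_assoc)
qed

lemma matrix_inv_scaled_identity:
  assumes "v \<noteq> 0" shows "matrix_inv (v *\<^sub>R mat 1 :: real^'n^'n) = (1 / v) *\<^sub>R mat 1"
proof (rule matrix_inv_eqI)
  show "v *\<^sub>R mat 1 ** ((1 / v) *\<^sub>R mat 1 :: real^'n^'n) = mat 1" "(1 / v) *\<^sub>R mat 1 ** (v *\<^sub>R mat 1 :: real^'n^'n) = mat 1"
    using assms by (simp_all add: matrix_scalar_ac scalar_matrix_assoc[symmetric])
qed

lemma mvnormal_density_isotropic:
  assumes v: "0 < v"
  shows "mvnormal_density 0 (v *\<^sub>R mat 1) (y :: real^'n) = (\<Prod>i\<in>UNIV. normal_density 0 (sqrt v) (y $ i))"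
proof -
  have det: "det (v *\<^sub>R mat 1 :: real^'n^'n) = v ^ CARD('n)"
    by (subst det_diagonal) (simp_all add: mat_def)
  have "mvnormal_density 0 (v *\<^sub>R mat 1) y = exp (- (\<Sum>i\<in>UNIV. (y $ i)\<^sup>2) / (2 * v)) / sqrt ((2 * pi * v) ^ CARD('n))"
    using v unfolding mvnormal_density_def matrix_inv_scaled_identity[OF less_imp_neq[OF v, symmetric]] det
    by (simp add: scaleR_matrix_vector_assoc[symmetric] inner_vec_def power2_eq_square power_mult_distrib sum_divide_distrib[symmetric])
  also have "sqrt ((2 * pi * v) ^ CARD('n)) = (\<Prod>i\<in>(UNIV::'n set). sqrt (2 * pi * v))"
    by (simp add: real_sqrt_power)
  also have "exp (- (\<Sum>i\<in>UNIV. (y $ i)\<^sup>2) / (2 * v)) = (\<Prod>i\<in>UNIV. exp (- (y $ i)\<^sup>2 / (2 * v)))"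
    by (subst exp_sum[symmetric]) (auto simp: sum_divide_distrib sum_negf)
  finally show ?thesis using v by (simp add: normal_density_def prod_dividef)
qed

text \<open>Real roots \<open>p\<close> and \<open>q\<close> give
  \<open>1 + b + c = (1 - p) * (1 - q)\<close> and \<open>1 - b + c = (1 + p) * (1 + q)\<close>. For
  a conjugate pair, \<open>c\<close> is the squared modulus and
  \<open>b\<^sup>2 < 4 * c \<le> (1 + c)\<^sup>2\<close>.\<close>

lemma stable2I:
  assumes roots: "\<And>z::complex. z\<^sup>2 + of_real b * z + of_real c = 0 \<Longrightarrow> cmod z < 1"
  shows "stable2 b c"
proof (cases "0 \<le> b\<^sup>2 - 4 * c")
  case True
  define r where "r = sqrt (b\<^sup>2 - 4 * c)"
  have r: "r * r = b * b - 4 * c" using True by (simp add: r_def power2_eq_square)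
  define p q where "p = (- b + r) / 2" and "q = (- b - r) / 2"
  have "p * p + b * p + c = 0" "q * q + b * q + c = 0" using r by (simp_all add: p_def q_def field_simps)
  then have "of_real (p * p + b * p + c) = (0::complex)" "of_real (q * q + b * q + c) = (0::complex)" by simp_all
  then have "cmod (of_real p) < 1" "cmod (of_real q) < 1"
    by (intro roots; simp add: power2_eq_square)+
  then have pq: "\<bar>p\<bar> < 1" "\<bar>q\<bar> < 1" by simp_all
  have c: "c = p * q" and b: "b = - (p + q)" using r by (simp_all add: p_def q_def field_simps)
  have "\<bar>p * q\<bar> < 1" using pq mult_strict_mono'[of "\<bar>p\<bar>" 1 "\<bar>q\<bar>" 1] by (simp add: abs_mult)
  moreover have "0 < (1 - p) * (1 - q)" "0 < (1 + p) * (1 + q)" using pq by (auto intro!: mult_pos_pos)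
  ultimately show ?thesis unfolding stable2_def c b by (auto simp: algebra_simps abs_if)
next
  case False
  then have d: "b\<^sup>2 < 4 * c" by simp
  define r where "r = sqrt (4 * c - b\<^sup>2)"
  have r: "r * r = 4 * c - b * b" using d by (simp add: r_def power2_eq_square)
  define z where "z = Complex (- b / 2) (r / 2)"
  have "z\<^sup>2 + of_real b * z + of_real c = 0"
    using r by (simp add: z_def power2_eq_square complex_eq_iff field_simps)
  then have "(cmod z)\<^sup>2 < 1" using roots[of z] by (simp add: power_less_one_iff abs_square_less_1)
  moreover have "(cmod z)\<^sup>2 = (b / 2)\<^sup>2 + (r / 2)\<^sup>2" by (simp add: z_def cmod_power2)
  then have "(cmod z)\<^sup>2 = c" using r by (simp add: power2_eq_square field_simps)
  ultimately have c: "c < 1" "0 < c" using d zero_le_power2[of b] by linarith+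
  have "0 \<le> (1 - c)\<^sup>2" by simp
  then have "b\<^sup>2 < (1 + c)\<^sup>2" using d by (simp add: power2_eq_square algebra_simps)
  then have "\<bar>b\<bar>\<^sup>2 < (1 + c)\<^sup>2" by (simp only: power2_abs)
  then have "\<bar>b\<bar> < 1 + c" by (rule power2_less_imp_less) (use c in simp)
  then show ?thesis using c by (simp add: stable2_def)
qed

lemma finite_quadratic_roots: "finite {z::complex. z\<^sup>2 + b * z + c = 0}"
proof -
  have "{z::complex. z\<^sup>2 + b * z + c = 0} = {z. poly [:c, b, 1:] z = 0}"
    by (auto simp: power2_eq_square algebra_simps)
  then show ?thesis using poly_roots_finite[of "[:c, b, 1:]"] by simp
qed

lemma cmatrix_mult: "cmatrix (A ** B) = cmatrix A ** cmatrix B"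
  by (simp add: cmatrix_def matrix_matrix_mult_def vec_eq_iff)

lemma cmatrix_transpose: "cmatrix (transpose A) = transpose (cmatrix A)"
  by (simp add: cmatrix_def transpose_def vec_eq_iff)

lemma cmatrix_diag: "cmatrix (diag_matrix l) = diag_matrix (\<lambda>i. of_real (l i))"
  by (simp add: cmatrix_def diag_matrix_def vec_eq_iff)

lemma cmatrix_orthogonal: assumes "orthogonal_matrix U" shows "orthogonal_matrix (cmatrix U)"
proof -
  have "cmatrix (mat 1 :: real^'n^'n) = mat 1" by (simp add: cmatrix_def mat_def vec_eq_iff)
  then show ?thesis using assms
    by (simp add: orthogonal_matrix_def cmatrix_transpose[symmetric] cmatrix_mult[symmetric])
qed

lemma cmatrix_gmm_A_mult:
  fixes w :: "complex^('n::finite + 'n)"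
  defines "u \<equiv> \<chi> i. w $ Inl i" and "v \<equiv> \<chi> i. w $ Inr i"
  shows "(cmatrix (gmm_A \<alpha> \<beta> \<nu> Q) *v w) $ Inl i
      = of_real (1 + \<beta>) * u $ i - of_real (\<alpha> * (1 + \<nu>)) * (cmatrix Q *v u) $ i
        - of_real \<beta> * v $ i + of_real (\<alpha> * \<nu>) * (cmatrix Q *v v) $ i"
    and "(cmatrix (gmm_A \<alpha> \<beta> \<nu> Q) *v w) $ Inr i = u $ i"
proof -
  have d: "(\<Sum>k\<in>UNIV. (if i = k then 1 else 0) * x k) = x i" for x :: "'n \<Rightarrow> complex"
    by (simp add: if_distrib[of "\<lambda>a. a * _"] cong: if_cong)
  have m: "complex_of_real ((mat 1 :: real^'n^'n) $ i $ k) = (if i = k then 1 else 0)" for k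
    by (simp add: mat_def)
  show "(cmatrix (gmm_A \<alpha> \<beta> \<nu> Q) *v w) $ Inl i
      = of_real (1 + \<beta>) * u $ i - of_real (\<alpha> * (1 + \<nu>)) * (cmatrix Q *v u) $ i
        - of_real \<beta> * v $ i + of_real (\<alpha> * \<nu>) * (cmatrix Q *v v) $ i"
    unfolding matrix_vector_mult_def
    by (simp add: sum_UNIV_Plus cmatrix_def gmm_A_def vblock_def hblock_def u_def v_def m left_diff_distrib
        distrib_right sum.distrib sum_subtractf mult.assoc sum_distrib_left[symmetric] d)
  show "(cmatrix (gmm_A \<alpha> \<beta> \<nu> Q) *v w) $ Inr i = u $ i"
    unfolding matrix_vector_mult_def
    by (simp add: sum_UNIV_Plus cmatrix_def gmm_A_def vblock_def hblock_def u_def m d)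
qed

section \<open>The transfer matrix\<close>

lemma decomp_coord:
  fixes U :: "'a::comm_semiring_1^'n^'n"
  assumes "orthogonal_matrix U"
  shows "(transpose U *v ((U ** diag_matrix l ** transpose U) *v x)) $ i = l i * (transpose U *v x) $ i"
  by (simp add: matrix_vector_mul_assoc[symmetric] orthogonal_cancel[OF assms] diag_matrix_mult_vec)

lemma mult_axis: "A *v axis k 1 = column k (A :: 'a::semiring_1^'n^'m)"
  by (simp add: vec_eq_iff matrix_vector_mult_def column_def axis_def if_distrib[where f="\<lambda>x. _ * x"] cong: if_cong)

lemma mat_minus_mult: "(mat z - A) *v w = z *s w - A *v w" for A :: "'a::comm_ring_1^'n^'n"
  by (simp add: matrix_vector_mult_diff_rdistrib)
    (simp add: vec_eq_iff matrix_vector_mult_def mat_def if_distrib[where f="\<lambda>x. x * _"] cong: if_cong)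

locale gmm_quadratic =
  fixes Q U :: "real^'n::finite^'n::finite" and lam :: "'n \<Rightarrow> real" and \<alpha> \<beta> \<nu> :: real
  assumes orth: "orthogonal_matrix U" and decomp: "Q = U ** diag_matrix lam ** transpose U"
    and lam_pos: "\<And>i. 0 < lam i" and \<alpha>_pos: "0 < \<alpha>"
    and spec: "spec_radius (cmatrix (gmm_A \<alpha> \<beta> \<nu> Q)) < 1"
begin

abbreviation "bt i \<equiv> b_tilde \<alpha> \<beta> \<nu> (lam i)"
abbreviation "ct i \<equiv> c_tilde \<alpha> \<beta> \<nu> (lam i)"
abbreviation "Uc \<equiv> cmatrix U"
abbreviation "Ac \<equiv> cmatrix (gmm_A \<alpha> \<beta> \<nu> Q)"

text \<open>On the \<open>i\<close>-th eigendirection of \<open>Q\<close> the system matrix acts as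
  the companion matrix of this polynomial.\<close>

definition pch :: "'n \<Rightarrow> complex \<Rightarrow> complex" where
  "pch i z = z\<^sup>2 + of_real (bt i) * z + of_real (ct i)"

lemma orth_c: "orthogonal_matrix Uc" by (rule cmatrix_orthogonal[OF orth])

lemma Qc_coord: "(transpose Uc *v (cmatrix Q *v x)) $ i = of_real (lam i) * (transpose Uc *v x) $ i"
  unfolding decomp cmatrix_mult cmatrix_diag cmatrix_transpose by (rule decomp_coord[OF orth_c])

lemma A_coord:
  defines "t \<equiv> \<lambda>x. transpose Uc *v x"
  shows "(t (\<chi> i. (Ac *v w) $ Inl i)) $ i
    = - of_real (bt i) * t (\<chi> i. w $ Inl i) $ i - of_real (ct i) * t (\<chi> i. w $ Inr i) $ i"
proof -
  let ?u = "\<chi> i. w $ Inl i" and ?v = "\<chi> i. w $ Inr i"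
  have "(\<chi> i. (Ac *v w) $ Inl i) = of_real (1 + \<beta>) *s ?u - of_real (\<alpha> * (1 + \<nu>)) *s (cmatrix Q *v ?u)
      - of_real \<beta> *s ?v + of_real (\<alpha> * \<nu>) *s (cmatrix Q *v ?v)"
    by (simp add: vec_eq_iff cmatrix_gmm_A_mult distrib_right)
  then have "t (\<chi> i. (Ac *v w) $ Inl i) = of_real (1 + \<beta>) *s t ?u - of_real (\<alpha> * (1 + \<nu>)) *s t (cmatrix Q *v ?u)
      - of_real \<beta> *s t ?v + of_real (\<alpha> * \<nu>) *s t (cmatrix Q *v ?v)"
    unfolding t_def by (simp only: matrix_vector_right_distrib matrix_vector_mult_diff_distrib vector_scalar_commute)
  then have "t (\<chi> i. (Ac *v w) $ Inl i) $ i = of_real (1 + \<beta>) * t ?u $ i - of_real (\<alpha> * (1 + \<nu>)) * (of_real (lam i) * t ?u $ i)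
      - of_real \<beta> * t ?v $ i + of_real (\<alpha> * \<nu>) * (of_real (lam i) * t ?v $ i)"
    using Qc_coord unfolding t_def by (simp add: distrib_right)
  then show ?thesis by (simp add: b_tilde_def c_tilde_def algebra_simps)
qed

lemma vec_Plus_eq_iff: "w = w' \<longleftrightarrow> (\<chi> i. w $ Inl i) = (\<chi> i. w' $ Inl i) \<and> (\<chi> i. w $ Inr i) = (\<chi> i. w' $ Inr i)"
  for w w' :: "'b^('n + 'n)"
  unfolding vec_eq_iff by (auto, metis sum.exhaust)

lemma tU_inj: "transpose Uc *v x = transpose Uc *v y \<longleftrightarrow> x = y"
  by (metis orthogonal_cancel(2)[OF orth_c])

text \<open>The lower block forces \<open>u = z v\<close>, after which the upper block becomes
  scalar in the eigenbasis. With \<open>r = 0\<close> this describes eigenvectors, with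
  \<open>r = - \<alpha> e\<close> the columns of the transfer matrix.\<close>

lemma resolvent_coord:
  fixes r :: "complex^'n"
  assumes w1: "(\<chi> i. (z *s w - Ac *v w) $ Inl i) = r" and w2: "(\<chi> i. (z *s w - Ac *v w) $ Inr i) = 0"
  shows "(\<chi> i. w $ Inl i) = z *s (\<chi> i. w $ Inr i)"
    and "pch i z * (transpose Uc *v (\<chi> i. w $ Inr i)) $ i = (transpose Uc *v r) $ i"
proof -
  let ?u = "\<chi> i. w $ Inl i" and ?v = "\<chi> i. w $ Inr i"
  show u: "?u = z *s ?v" using w2 by (simp add: vec_eq_iff cmatrix_gmm_A_mult)
  have "r = z *s ?u - (\<chi> i. (Ac *v w) $ Inl i)" unfolding w1[symmetric] by (simp add: vec_eq_iff)
  then have "(transpose Uc *v r) $ i = z * (transpose Uc *v ?u) $ i - (transpose Uc *v (\<chi> i. (Ac *v w) $ Inl i)) $ i"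
    by (simp add: matrix_vector_mult_diff_distrib vector_scalar_commute)
  also have "\<dots> = pch i z * (transpose Uc *v ?v) $ i"
    unfolding A_coord unfolding u by (simp add: pch_def vector_scalar_commute power2_eq_square algebra_simps)
  finally show "pch i z * (transpose Uc *v ?v) $ i = (transpose Uc *v r) $ i" ..
qed

lemma eigenvals_A: "eigenvals Ac = {z. \<exists>i. pch i z = 0}"
proof (intro set_eqI iffI)
  fix z assume "z \<in> eigenvals Ac"
  then obtain w where w: "w \<noteq> 0" "Ac *v w = z *s w" by (auto simp: eigenvals_def)
  let ?v = "\<chi> i. w $ Inr i"
  have rc: "(\<chi> i. w $ Inl i) = z *s ?v" "\<And>i. pch i z * (transpose Uc *v ?v) $ i = (transpose Uc *v 0) $ i"
    by (rule resolvent_coord[where r=0]; simp add: w vec_eq_iff)+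
  have "?v \<noteq> 0"
  proof
    assume "?v = 0"
    then have "w = 0" using rc(1) unfolding vec_Plus_eq_iff[of w 0] by (simp add: vec_eq_iff)
    then show False using w by simp
  qed
  then have "transpose Uc *v ?v \<noteq> 0" using tU_inj[of ?v 0] by simp
  then obtain i where "(transpose Uc *v ?v) $ i \<noteq> 0" by (auto simp: vec_eq_iff)
  then show "z \<in> {z. \<exists>i. pch i z = 0}" using rc(2)[of i] by auto
next
  fix z assume "z \<in> {z. \<exists>i. pch i z = 0}"
  then obtain i where i: "pch i z = 0" by auto
  define v where "v = Uc *v axis i 1"
  define w :: "complex^('n + 'n)" where "w = (\<chi> j. case j of Inl k \<Rightarrow> z * v $ k | Inr k \<Rightarrow> v $ k)"
  have wv: "(\<chi> i. w $ Inl i) = z *s v" "(\<chi> i. w $ Inr i) = v" by (simp_all add: w_def vec_eq_iff)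
  have tv: "transpose Uc *v v = axis i 1" by (simp add: v_def orthogonal_cancel[OF orth_c])
  have "v \<noteq> 0" using tv by (metis axis_eq_0_iff matrix_vector_mult_0_right zero_neq_one)
  moreover have "v = 0" if "w = 0" using wv(2) that by (simp add: vec_eq_iff)
  ultimately have "w \<noteq> 0" by blast
  moreover have "Ac *v w = z *s w"
    unfolding vec_Plus_eq_iff
  proof
    show "(\<chi> i. (Ac *v w) $ Inr i) = (\<chi> i. (z *s w) $ Inr i)"
      using wv by (simp add: cmatrix_gmm_A_mult vec_eq_iff)
    have "(transpose Uc *v (\<chi> i. (Ac *v w) $ Inl i)) $ j = (transpose Uc *v (\<chi> i. (z *s w) $ Inl i)) $ j" for j
    proof -
      have zw: "(\<chi> i. (z *s w) $ Inl i) = z *s (z *s v)" using wv(1) by (simp add: vec_eq_iff)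
      have "z * z + of_real (bt i) * z + of_real (ct i) = 0" using i by (simp add: pch_def power2_eq_square)
      then have "z * z = - of_real (bt i) * z - of_real (ct i)" by algebra
      from this[symmetric] show ?thesis unfolding A_coord wv zw
        by (cases "j = i") (simp_all add: vector_scalar_commute tv axis_def)
    qed
    then show "(\<chi> i. (Ac *v w) $ Inl i) = (\<chi> i. (z *s w) $ Inl i)"
      using tU_inj vec_eq_iff by blast
  qed
  ultimately show "z \<in> eigenvals Ac" by (auto simp: eigenvals_def)
qed

text \<open>\<open>spec_radius\<close> is a \<open>Max\<close>, which bounds the moduli of the
  eigenvalues once their set is known to be finite.\<close>

lemma finite_eigenvals: "finite (eigenvals Ac)"
proof -
  have "eigenvals Ac = (\<Union>i. {z. z\<^sup>2 + of_real (bt i) * z + of_real (ct i) = 0})"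
    by (auto simp: eigenvals_A pch_def)
  then show ?thesis using finite_quadratic_roots by simp
qed

lemma eigenval_less_1: assumes "z \<in> eigenvals Ac" shows "cmod z < 1"
proof -
  have "cmod z \<le> spec_radius Ac" unfolding spec_radius_def using finite_eigenvals assms by (intro Max_ge) auto
  then show ?thesis using spec by simp
qed

lemma stable: "stable2 (bt i) (ct i)"
  by (rule stable2I, rule eigenval_less_1) (auto simp: eigenvals_A pch_def)

lemma pch_nonzero: "pch i (cis \<omega>) \<noteq> 0"
  using quadratic_cis_nonzero[OF stable] by (simp add: pch_def)

lemma resolvent_invertible: "invertible (mat (cis \<omega>) - Ac)"
proof -
  have "inj ((*v) (mat (cis \<omega>) - Ac))"
  proof (rule injI)
    fix w w' assume "(mat (cis \<omega>) - Ac) *v w = (mat (cis \<omega>) - Ac) *v w'"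
    then have "cis \<omega> *s w - Ac *v w = cis \<omega> *s w' - Ac *v w'" unfolding mat_minus_mult .
    moreover have "a - b = x - y" if "x - a = y - b" for a b x y :: "complex^('n + 'n)"
      using that by (simp add: algebra_simps)
    ultimately have "Ac *v w - Ac *v w' = cis \<omega> *s w - cis \<omega> *s w'" by blast
    then have "Ac *v (w - w') = cis \<omega> *s (w - w')"
      by (simp only: matrix_vector_mult_diff_distrib vector_ssub_ldistrib)
    then have "cis \<omega> \<in> eigenvals Ac" if "w - w' \<noteq> 0" unfolding eigenvals_def using that by blast
    then show "w = w'" using eigenval_less_1[of "cis \<omega>"] by auto
  qed
  then show ?thesis by (simp add: invertible_left_inverse matrix_left_invertible_injective)
qed

definition gam :: "complex \<Rightarrow> 'n \<Rightarrow> complex" where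
  "gam z i = - (of_real (\<alpha> * sqrt (lam i) / sqrt 2) * z) / pch i z"

text \<open>Applying the transfer matrix to the unit vector \<open>e\<close> reduces an entry to one
  resolvent equation, so the inverse is never computed. \<open>T\<close> rotates into the eigenbasis
  but \<open>B\<close> does not; hence a factor \<open>transpose U\<close> remains on the right,
  which cancels in \<open>GG\<close>.\<close>

lemma G_entry: "gmm_G \<alpha> \<beta> \<nu> Q U lam (cis \<omega>) $ i $ k = gam (cis \<omega>) i * of_real (U $ k $ i)"
proof -
  define z where "z = cis \<omega>"
  define R where "R = mat z - Ac"
  define Bc where "Bc = cmatrix (gmm_B \<alpha> :: real^'n^('n + 'n))"
  define Tc where "Tc = cmatrix (gmm_T U lam)"
  define e where "e = (axis k 1 :: complex^'n)"
  define w where "w = matrix_inv R *v (Bc *v e)"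
  let ?u = "\<chi> i. w $ Inl i" and ?v = "\<chi> i. w $ Inr i"
  have "R ** matrix_inv R = mat 1"
    using resolvent_invertible[of \<omega>] unfolding invertible_def matrix_inv_def R_def z_def by (rule someI2_ex) auto
  then have Rw: "R *v w = Bc *v e" by (simp add: w_def matrix_vector_mul_assoc matrix_mul_assoc)
  have R: "R *v w = z *s w - Ac *v w"
    unfolding R_def by (rule mat_minus_mult)
  have "Bc *v e = column k Bc" by (simp add: e_def mult_axis)
  then have Be: "(\<chi> i. (Bc *v e) $ Inl i) = (- of_real \<alpha>) *s e" "(\<chi> i. (Bc *v e) $ Inr i) = 0"
    by (simp_all add: vec_eq_iff e_def Bc_def column_def cmatrix_def gmm_B_def vblock_def mat_def axis_def)
  have rc: "?u = z *s ?v" "pch i z * (transpose Uc *v ?v) $ i = (transpose Uc *v ((- of_real \<alpha>) *s e)) $ i"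
    by (rule resolvent_coord[where r="(- of_real \<alpha>) *s e"]; simp only: R[symmetric] Rw Be)+
  have te: "(transpose Uc *v e) $ i = of_real (U $ k $ i)"
    by (simp add: e_def mult_axis column_def transpose_def cmatrix_def)
  have v: "(transpose Uc *v ?v) $ i = - of_real \<alpha> * of_real (U $ k $ i) / pch i z"
    using rc(2) pch_nonzero[of i \<omega>] unfolding vector_scalar_commute z_def[symmetric]
    by (simp add: te field_simps)
  have T: "(Tc *v w) $ i = of_real (sqrt (lam i) / sqrt 2) * (transpose Uc *v ?u) $ i"
  proof -
    have row: "(diag_matrix (\<lambda>i. sqrt (lam i)) ** transpose U) $ i $ j = sqrt (lam i) * U $ j $ i" for j
      by (simp add: matrix_matrix_mult_def diag_matrix_def transpose_def if_distrib[where f="\<lambda>x. x * _"] cong: if_cong)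
    have "(transpose Uc *v ?u) $ i = (\<Sum>j\<in>UNIV. of_real (U $ j $ i) * w $ Inl j)"
      by (simp add: matrix_vector_mult_def transpose_def cmatrix_def)
    then show ?thesis
      by (simp add: Tc_def matrix_vector_mult_def sum_UNIV_Plus cmatrix_def gmm_T_def hblock_def row sum_distrib_left mult_ac)
  qed
  have "gmm_G \<alpha> \<beta> \<nu> Q U lam z $ i $ k = (gmm_G \<alpha> \<beta> \<nu> Q U lam z *v e) $ i"
    by (simp add: e_def mult_axis column_def)
  also have "\<dots> = (Tc *v w) $ i"
    by (simp add: gmm_G_def w_def Tc_def R_def Bc_def matrix_vector_mul_assoc matrix_mul_assoc)
  also have "\<dots> = of_real (sqrt (lam i) / sqrt 2) * (z * (- of_real \<alpha> * of_real (U $ k $ i) / pch i z))"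
    unfolding T rc(1) vector_scalar_commute using v by simp
  finally show ?thesis by (simp add: gam_def z_def field_simps)
qed

lemma gam_sq: "gam (cis \<omega>) i * cnj (gam (cis \<omega>) i) = of_real (\<alpha>\<^sup>2 * lam i / 2 / (cmod (pch i (cis \<omega>)))\<^sup>2)"
proof -
  have "cmod (gam (cis \<omega>) i) = \<alpha> * sqrt (lam i) / sqrt 2 / cmod (pch i (cis \<omega>))"
    using \<alpha>_pos lam_pos[of i] by (simp add: gam_def norm_divide norm_mult)
  then have "(cmod (gam (cis \<omega>) i))\<^sup>2 = \<alpha>\<^sup>2 * lam i / 2 / (cmod (pch i (cis \<omega>)))\<^sup>2"
    using lam_pos[of i] by (simp add: power_divide power_mult_distrib)
  then show ?thesis by (metis complex_norm_square)
qed

definition tau :: "real \<Rightarrow> 'n \<Rightarrow> real" where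
  "tau \<theta> i = \<theta> * (\<alpha>\<^sup>2 * lam i / (2 * real CARD('n)))"

lemma GG: "(gmm_G \<alpha> \<beta> \<nu> Q U lam (cis \<omega>) ** conj_transpose (gmm_G \<alpha> \<beta> \<nu> Q U lam (cis \<omega>))) $ i $ j
   = (if i = j then of_real (\<alpha>\<^sup>2 * lam i / 2 / (cmod (pch i (cis \<omega>)))\<^sup>2) else 0)"
proof -
  let ?g = "gam (cis \<omega>)"
  have "(\<Sum>k\<in>UNIV. U $ k $ i * U $ k $ j) = (transpose U ** U) $ i $ j"
    by (simp add: matrix_matrix_mult_def transpose_def)
  also have "\<dots> = (if i = j then 1 else 0)" using orth by (simp add: orthogonal_matrix_def mat_def)
  finally have UU: "(\<Sum>k\<in>UNIV. complex_of_real (U $ k $ i) * of_real (U $ k $ j)) = (if i = j then 1 else 0)"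
    by (simp flip: of_real_mult of_real_sum)
  have "(gmm_G \<alpha> \<beta> \<nu> Q U lam (cis \<omega>) ** conj_transpose (gmm_G \<alpha> \<beta> \<nu> Q U lam (cis \<omega>))) $ i $ j
    = (\<Sum>k\<in>UNIV. (?g i * cnj (?g j)) * (of_real (U $ k $ i) * of_real (U $ k $ j)))"
    by (simp add: matrix_matrix_mult_def conj_transpose_def G_entry mult_ac)
  also have "\<dots> = ?g i * cnj (?g j) * (if i = j then 1 else 0)" by (simp only: sum_distrib_left[symmetric] UU)
  finally show ?thesis using gam_sq by simp
qed

lemma det_risk_matrix:
  "det (risk_matrix (gmm_G \<alpha> \<beta> \<nu> Q U lam) \<theta> \<omega>) = of_real (\<Prod>i\<in>UNIV. 1 - tau \<theta> i / (cmod (pch i (cis \<omega>)))\<^sup>2)"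
proof -
  have "risk_matrix (gmm_G \<alpha> \<beta> \<nu> Q U lam) \<theta> \<omega> $ i $ j
    = (if i = j then of_real (1 - tau \<theta> i / (cmod (pch i (cis \<omega>)))\<^sup>2) else 0)" for i j
    unfolding risk_matrix_def
    by (simp add: GG mat_def tau_def scaleR_conv_of_real[where 'a=complex])
  then show ?thesis by (subst det_diagonal) simp_all
qed

lemma trace_GG:
  "Re (trace (gmm_G \<alpha> \<beta> \<nu> Q U lam (cis \<omega>) ** conj_transpose (gmm_G \<alpha> \<beta> \<nu> Q U lam (cis \<omega>))))
   = (\<Sum>i\<in>UNIV. \<alpha>\<^sup>2 * lam i / 2 / (cmod (pch i (cis \<omega>)))\<^sup>2)"
  by (simp add: trace_def GG flip: of_real_sum of_real_mult of_real_power of_real_divide)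

end

section \<open>Exponential moments of the iterates\<close>

primrec trajectory :: "'s \<Rightarrow> ('s \<Rightarrow> 'w \<Rightarrow> 's) \<Rightarrow> (nat \<Rightarrow> 'w) \<Rightarrow> nat \<Rightarrow> 's" where
  "trajectory s F v 0 = s"
| "trajectory s F v (Suc k) = F (trajectory s F v k) (v (Suc k))"

text \<open>The state at time \<open>k\<close> is a function of the noises up to \<open>k\<close>;
  this separates the past from the next noise in the independence argument.\<close>

lemma trajectory_restrict: "k \<le> n \<Longrightarrow> trajectory s F (restrict v {1..n}) k = trajectory s F v k"
  by (induction k) auto

definition feynman_kac ::
  "('w::euclidean_space \<Rightarrow> ennreal) \<Rightarrow> ('s \<Rightarrow> 'w \<Rightarrow> 's) \<Rightarrow> ('s \<Rightarrow> ennreal) \<Rightarrow> ('s \<Rightarrow> ennreal) \<Rightarrow> 's \<Rightarrow> ennreal" where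
  "feynman_kac p F W \<psi> s = (\<integral>\<^sup>+ y. p y * (W (F s y) * \<psi> (F s y)) \<partial>lborel)"

lemma trajectory_measurable:
  fixes F :: "'s::second_countable_topology \<Rightarrow> 'w::euclidean_space \<Rightarrow> 's"
  assumes F: "case_prod F \<in> borel_measurable (borel \<Otimes>\<^sub>M borel)" and "k \<le> n"
  shows "(\<lambda>v. trajectory s F v k) \<in> borel_measurable (PiM {1..n} (\<lambda>_. borel))"
  using \<open>k \<le> n\<close>
proof (induction k)
  case (Suc k)
  then have "(\<lambda>v. trajectory s F v k) \<in> borel_measurable (PiM {1..n} (\<lambda>_. borel))" by simp
  moreover have "(\<lambda>v. v (Suc k)) \<in> borel_measurable (PiM {1..n} (\<lambda>_. borel :: 'w measure))"
    using Suc.prems by (intro measurable_component_singleton) auto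
  ultimately show ?case
    using measurable_compose[OF measurable_Pair F] by simp
qed simp

text \<open>The last noise is independent of the path up to \<open>n\<close>, and integrating it out
  replaces \<open>\<psi>\<close> by \<open>feynman_kac p F W \<psi>\<close>. The induction therefore
  needs \<open>\<psi>\<close> arbitrary.\<close>

lemma (in prob_space) expectation_feynman_kac:
  fixes F :: "'s::second_countable_topology \<Rightarrow> 'w::euclidean_space \<Rightarrow> 's" and w :: "nat \<Rightarrow> 'a \<Rightarrow> 'w"
  assumes ind: "indep_vars (\<lambda>_. borel) w {1..}"
    and dist: "\<And>k. 1 \<le> k \<Longrightarrow> distributed M lborel (w k) p"
    and F: "case_prod F \<in> borel_measurable (borel \<Otimes>\<^sub>M borel)"
    and W: "W \<in> borel_measurable borel" and \<psi>: "\<psi> \<in> borel_measurable borel"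
  shows "(\<integral>\<^sup>+ \<omega>. (\<Prod>k=1..n. W (trajectory s F (\<lambda>i. w i \<omega>) k)) * \<psi> (trajectory s F (\<lambda>i. w i \<omega>) n) \<partial>M)
    = (feynman_kac p F W ^^ n) \<psi> s"
  using \<psi>
proof (induction n arbitrary: \<psi>)
  case 0
  then show ?case by (simp add: emeasure_space_1)
next
  case (Suc n)
  note [measurable] = W Suc.prems F
  have p[measurable]: "p \<in> borel_measurable borel"
    using distributed_borel_measurable[OF dist[of 1]] by simp
  let ?S = "PiM {1..n} (\<lambda>_. borel :: 'w measure)"
  let ?H = "\<lambda>\<omega>. restrict (\<lambda>i. w i \<omega>) {1..n}"
  let ?w = "w (Suc n)"
  \<comment> \<open>Independence is available for restrictions to blocks of indices, so the single
    noise \<open>w (Suc n)\<close> is viewed as a function on \<open>{Suc n}\<close>;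
    \<open>dw\<close> translates back.\<close>
  let ?T = "PiM {Suc n} (\<lambda>_. borel :: 'w measure)"
  let ?w = "\<lambda>\<omega>. restrict (\<lambda>i. w i \<omega>) {Suc n}"
  have iv: "indep_var ?S ?H ?T ?w"
    by (rule indep_var_restrict[OF ind]) auto
  have H_meas[measurable]: "random_variable ?S ?H" and w_rv[measurable]: "random_variable ?T ?w"
    using iv by (auto dest: indep_var_rv1 indep_var_rv2)
  have pair: "distr M ?S ?H \<Otimes>\<^sub>M distr M ?T ?w = distr M (?S \<Otimes>\<^sub>M ?T) (\<lambda>\<omega>. (?H \<omega>, ?w \<omega>))"
    using iv by (simp add: indep_var_distribution_eq)
  have last[measurable]: "(\<lambda>v. v (Suc n)) \<in> borel_measurable ?T"
    by (rule measurable_component_singleton) simp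
  have dw: "(\<integral>\<^sup>+ y. g (y (Suc n)) \<partial>distr M ?T ?w) = (\<integral>\<^sup>+ y. p y * g y \<partial>lborel)"
    if g: "g \<in> borel_measurable borel" for g
  proof -
    have "(\<integral>\<^sup>+ y. g (y (Suc n)) \<partial>distr M ?T ?w) = (\<integral>\<^sup>+ \<omega>. g (w (Suc n) \<omega>) \<partial>M)"
      using measurable_compose[OF last g] by (subst nn_integral_distr) auto
    also have "\<dots> = (\<integral>\<^sup>+ y. p y * g y \<partial>lborel)"
      using distributed_nn_integral[OF dist[of "Suc n"], of g] g by simp
    finally show ?thesis .
  qed
  let ?h = "\<lambda>v k. trajectory s F v k"
  let ?P = "\<lambda>v. \<Prod>k=1..n. W (?h v k)"
  have [measurable]: "(\<lambda>v. ?h v k) \<in> borel_measurable ?S" if "k \<le> n" for k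
    by (rule trajectory_measurable[OF F that])
  have P[measurable]: "?P \<in> borel_measurable ?S"
    by (rule borel_measurable_prod_ennreal, rule measurable_compose[OF trajectory_measurable[OF F] W], simp)
  have hn[measurable]: "(\<lambda>v. ?h v n) \<in> borel_measurable ?S" by (rule trajectory_measurable[OF F]) simp
  have Fh[measurable]: "(\<lambda>z. F (?h (fst z) n) (snd z (Suc n))) \<in> borel_measurable (?S \<Otimes>\<^sub>M ?T)"
    using measurable_compose[OF measurable_Pair[OF measurable_compose[OF measurable_fst hn] measurable_compose[OF measurable_snd last]] F] by simp
  let ?\<Phi> = "\<lambda>z. ?P (fst z) * (W (F (?h (fst z) n) (snd z (Suc n))) * \<psi> (F (?h (fst z) n) (snd z (Suc n))))"
  have \<Phi>[measurable]: "?\<Phi> \<in> borel_measurable (?S \<Otimes>\<^sub>M ?T)"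
    by (intro borel_measurable_times_ennreal measurable_compose[OF measurable_fst P] measurable_compose[OF Fh W] measurable_compose[OF Fh Suc.prems])
  have Fs: "F s' \<in> borel_measurable borel" for s'
    using measurable_compose[OF measurable_Pair[OF measurable_const[of s' borel borel] measurable_ident] F] by simp
  have fk_meas: "feynman_kac p F W \<psi> \<in> borel_measurable borel"
  proof -
    have "(\<lambda>z. p (snd z) * (W (case_prod F z) * \<psi> (case_prod F z))) \<in> borel_measurable (borel \<Otimes>\<^sub>M lborel)"
      by measurable
    from lborel.borel_measurable_nn_integral_fst[OF this] show ?thesis
      by (simp add: feynman_kac_def[abs_def])
  qed
  have PH: "?P (?H \<omega>) = (\<Prod>k=1..n. W (trajectory s F (\<lambda>i. w i \<omega>) k))" for \<omega>
    by (intro prod.cong refl arg_cong[where f=W] trajectory_restrict) auto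
  have hH: "?h (?H \<omega>) n = trajectory s F (\<lambda>i. w i \<omega>) n" for \<omega>
    by (intro trajectory_restrict) auto
  have split: "(\<Prod>k=1..Suc n. g k) = (\<Prod>k=1..n. g k) * g (Suc n)" for g :: "nat \<Rightarrow> ennreal" by simp
  interpret w: prob_space "distr M ?T ?w" by (rule prob_space_distr) simp
  have "(\<integral>\<^sup>+ \<omega>. (\<Prod>k=1..Suc n. W (trajectory s F (\<lambda>i. w i \<omega>) k)) * \<psi> (trajectory s F (\<lambda>i. w i \<omega>) (Suc n)) \<partial>M)
    = (\<integral>\<^sup>+ \<omega>. ?\<Phi> (?H \<omega>, ?w \<omega>) \<partial>M)"
    unfolding split by (rule nn_integral_cong) (simp only: fst_conv snd_conv PH hH trajectory.simps mult.assoc restrict_apply' insertI1)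
  also have "\<dots> = (\<integral>\<^sup>+ z. ?\<Phi> z \<partial>(distr M ?S ?H \<Otimes>\<^sub>M distr M ?T ?w))"
    unfolding pair
    by (rule nn_integral_distr[symmetric], rule measurable_Pair[OF H_meas w_rv], subst measurable_cong_sets[OF sets_distr refl], rule \<Phi>)
  also have "\<dots> = (\<integral>\<^sup>+ v. \<integral>\<^sup>+ y. ?\<Phi> (v, y) \<partial>distr M ?T ?w \<partial>distr M ?S ?H)"
    by (rule w.nn_integral_fst[symmetric], subst measurable_cong_sets[OF sets_pair_measure_cong[OF sets_distr sets_distr] refl], rule \<Phi>)
  also have "\<dots> = (\<integral>\<^sup>+ v. ?P v * feynman_kac p F W \<psi> (?h v n) \<partial>distr M ?S ?H)"
  proof (rule nn_integral_cong)
    fix v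
    have m: "(\<lambda>y. W (F (?h v n) y) * \<psi> (F (?h v n) y)) \<in> borel_measurable borel"
      using measurable_compose[OF Fs W] measurable_compose[OF Fs Suc.prems] by (intro borel_measurable_times_ennreal)
    have "(\<integral>\<^sup>+ y. ?\<Phi> (v, y) \<partial>distr M ?T ?w) = (\<integral>\<^sup>+ y. p y * (?P v * (W (F (?h v n) y) * \<psi> (F (?h v n) y))) \<partial>lborel)"
      using dw[of "\<lambda>y. ?P v * (W (F (?h v n) y) * \<psi> (F (?h v n) y))"] m by simp
    also have "\<dots> = (\<integral>\<^sup>+ y. ?P v * (p y * (W (F (?h v n) y) * \<psi> (F (?h v n) y))) \<partial>lborel)"
      by (simp add: mult.left_commute)
    also have "\<dots> = ?P v * feynman_kac p F W \<psi> (?h v n)"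
      unfolding feynman_kac_def using m by (intro nn_integral_cmult) auto
    finally show "(\<integral>\<^sup>+ y. ?\<Phi> (v, y) \<partial>distr M ?T ?w) = ?P v * feynman_kac p F W \<psi> (?h v n)" .
  qed
  also have "\<dots> = (\<integral>\<^sup>+ \<omega>. ?P (?H \<omega>) * feynman_kac p F W \<psi> (?h (?H \<omega>) n) \<partial>M)"
    by (rule nn_integral_distr, rule H_meas, subst measurable_cong_sets[OF sets_distr refl],
      rule borel_measurable_times_ennreal[OF P measurable_compose[OF hn fk_meas]])
  also have "\<dots> = (\<integral>\<^sup>+ \<omega>. (\<Prod>k=1..n. W (trajectory s F (\<lambda>i. w i \<omega>) k)) * feynman_kac p F W \<psi> (trajectory s F (\<lambda>i. w i \<omega>) n) \<partial>M)"
    by (simp only: PH hH)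
  also have "\<dots> = (feynman_kac p F W ^^ n) (feynman_kac p F W \<psi>) s"
    by (rule Suc.IH[OF fk_meas])
  finally show ?case by (simp add: funpow_swap1)
qed

lemma nn_integral_lborel_prod_vec:
  fixes f :: "'n::finite \<Rightarrow> real \<Rightarrow> ennreal"
  assumes [measurable]: "\<And>i. f i \<in> borel_measurable borel"
  shows "(\<integral>\<^sup>+ x. (\<Prod>i\<in>UNIV. f i (x $ i)) \<partial>(lborel :: (real^'n) measure)) = (\<Prod>i\<in>UNIV. \<integral>\<^sup>+ y. f i y \<partial>lborel)"
proof -
  have inj: "inj (\<lambda>i::'n. axis i (1::real))" by (auto simp: inj_on_def axis_eq_axis)
  have B: "(Basis :: (real^'n) set) = range (\<lambda>i. axis i 1)" by (auto simp: Basis_vec_def)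
  define g where "g = (\<lambda>b::real^'n. f (the_inv (\<lambda>i. axis i (1::real)) b))"
  have g: "g (axis i 1) = f i" for i by (simp add: g_def the_inv_f_f[OF inj])
  have "(\<integral>\<^sup>+ x. (\<Prod>b\<in>Basis. g b (x \<bullet> b)) \<partial>(lborel :: (real^'n) measure)) = (\<Prod>b\<in>Basis. \<integral>\<^sup>+ y. g b y \<partial>lborel)"
    by (rule nn_integral_lborel_prod) (auto simp: g_def)
  then show ?thesis unfolding B by (simp add: prod.reindex[OF inj] g inner_axis)
qed

text \<open>The substitution \<open>y = - (b * u + c * v) - \<alpha> * \<xi>\<close>. The value of
  \<open>k\<close> makes \<open>k * (\<alpha> * \<xi>)\<^sup>2\<close> the exponent of the normal
  density, and the Jacobian \<open>\<alpha>\<close> matches the normalizations.\<close>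

lemma ar_step_noise:
  assumes \<alpha>: "0 < \<alpha>" and s: "0 < s" and \<phi>: "case_prod \<phi> \<in> borel_measurable (borel \<Otimes>\<^sub>M borel)"
  shows "(\<integral>\<^sup>+ \<xi>. ennreal (normal_density 0 s \<xi> * exp (\<tau> / (2 * \<alpha>\<^sup>2 * s\<^sup>2) * (- (b * u + c * v) - \<alpha> * \<xi>)\<^sup>2)) * \<phi> (- (b * u + c * v) - \<alpha> * \<xi>) u \<partial>lborel)
    = ar_step b c (1 / (2 * \<alpha>\<^sup>2 * s\<^sup>2)) \<tau> \<phi> u v"
proof -
  note [measurable] = measurable_sections[OF \<phi>]
  let ?k = "1 / (2 * \<alpha>\<^sup>2 * s\<^sup>2)" and ?m = "- (b * u + c * v)"
  have "ar_step b c ?k \<tau> \<phi> u v = ennreal \<bar>- \<alpha>\<bar> * (\<integral>\<^sup>+ \<xi>. ennreal (sqrt (?k / pi) *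
     exp (- (?k * ((?m + - \<alpha> * \<xi> + b * u + c * v)\<^sup>2 - \<tau> * (?m + - \<alpha> * \<xi>)\<^sup>2)))) * \<phi> (?m + - \<alpha> * \<xi>) u \<partial>lborel)"
    unfolding ar_step_def using \<alpha> by (intro nn_integral_real_affine) auto
  also have "\<dots> = (\<integral>\<^sup>+ \<xi>. ennreal \<alpha> * (ennreal (sqrt (?k / pi) *
     exp (- (?k * ((?m + - \<alpha> * \<xi> + b * u + c * v)\<^sup>2 - \<tau> * (?m + - \<alpha> * \<xi>)\<^sup>2)))) * \<phi> (?m + - \<alpha> * \<xi>) u) \<partial>lborel)"
    using \<alpha> by (subst nn_integral_cmult) (auto intro!: borel_measurable_times_ennreal measurable_compose[OF _ measurable_sections(1)[OF \<phi>]])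
  also have "\<dots> = (\<integral>\<^sup>+ \<xi>. ennreal (normal_density 0 s \<xi> * exp (\<tau> / (2 * \<alpha>\<^sup>2 * s\<^sup>2) * (?m - \<alpha> * \<xi>)\<^sup>2)) * \<phi> (?m - \<alpha> * \<xi>) u \<partial>lborel)"
  proof (rule nn_integral_cong)
    fix \<xi>
    have e1: "- (?k * ((?m + - \<alpha> * \<xi> + b * u + c * v)\<^sup>2 - \<tau> * (?m + - \<alpha> * \<xi>)\<^sup>2))
       = - (\<xi> - 0)\<^sup>2 / (2 * s\<^sup>2) + \<tau> / (2 * \<alpha>\<^sup>2 * s\<^sup>2) * (?m - \<alpha> * \<xi>)\<^sup>2"
    proof -
      have "?m + - \<alpha> * \<xi> + b * u + c * v = - \<alpha> * \<xi>" by simp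
      moreover have "?k * (- \<alpha> * \<xi>)\<^sup>2 = \<xi>\<^sup>2 / (2 * s\<^sup>2)" using \<alpha> s by (simp add: power_mult_distrib field_simps)
      ultimately show ?thesis by (simp add: right_diff_distrib)
    qed
    have e2: "\<alpha> * sqrt (?k / pi) = 1 / sqrt (2 * pi * s\<^sup>2)"
    proof -
      have "\<alpha> * sqrt (?k / pi) = sqrt (\<alpha>\<^sup>2 * (?k / pi))" using \<alpha> by (subst real_sqrt_mult) simp
      also have "\<alpha>\<^sup>2 * (?k / pi) = 1 / (2 * pi * s\<^sup>2)" using \<alpha> by (simp add: field_simps)
      finally show ?thesis by (simp add: real_sqrt_divide)
    qed
    have "\<alpha> * (sqrt (?k / pi) * exp (- (?k * ((?m + - \<alpha> * \<xi> + b * u + c * v)\<^sup>2 - \<tau> * (?m + - \<alpha> * \<xi>)\<^sup>2))))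
      = normal_density 0 s \<xi> * exp (\<tau> / (2 * \<alpha>\<^sup>2 * s\<^sup>2) * (?m - \<alpha> * \<xi>)\<^sup>2)"
      unfolding e1 exp_add normal_density_def e2[symmetric] by simp
    then show "ennreal \<alpha> * (ennreal (sqrt (?k / pi) * exp (- (?k * ((?m + - \<alpha> * \<xi> + b * u + c * v)\<^sup>2 - \<tau> * (?m + - \<alpha> * \<xi>)\<^sup>2)))) * \<phi> (?m + - \<alpha> * \<xi>) u)
      = ennreal (normal_density 0 s \<xi> * exp (\<tau> / (2 * \<alpha>\<^sup>2 * s\<^sup>2) * (?m - \<alpha> * \<xi>)\<^sup>2)) * \<phi> (?m - \<alpha> * \<xi>) u"
      using \<alpha> s by (simp add: mult.assoc[symmetric] ennreal_mult[symmetric])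
  qed
  finally show ?thesis ..
qed

context gmm_quadratic
begin

text \<open>The recursion for the deviation from the minimizer in eigencoordinates, with the noise
  rotated accordingly; \<open>gmm_state_trajectory\<close> connects it with the iterates.\<close>

definition drift :: "(real^'n) \<times> (real^'n) \<Rightarrow> real^'n \<Rightarrow> (real^'n) \<times> (real^'n)" where
  "drift s y = ((\<chi> i. - (bt i * fst s $ i + ct i * snd s $ i) - \<alpha> * (transpose U *v y) $ i), fst s)"

definition weight :: "real \<Rightarrow> (real^'n) \<times> (real^'n) \<Rightarrow> ennreal" where
  "weight \<eta> s = ennreal (exp (\<eta> * (\<Sum>i\<in>UNIV. lam i / 2 * (fst s $ i)\<^sup>2)))"

lemma drift_measurable: "case_prod drift \<in> borel_measurable (borel \<Otimes>\<^sub>M borel)"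
  unfolding drift_def case_prod_beta borel_prod
  by (intro borel_measurable_continuous_onI continuous_intros bounded_linear.continuous_on[OF matrix_vector_mul_bounded_linear])

lemma weight_measurable: "weight \<eta> \<in> borel_measurable borel"
  unfolding weight_def by (intro measurable_compose[OF _ measurable_ennreal] borel_measurable_continuous_onI continuous_intros)

text \<open>The isotropic Gaussian is rotation invariant, so one may integrate over the rotated
  noise, in whose coordinates density, weight and drift all separate. Products over the modes are
  mapped to products, and the iterates decouple.\<close>

lemma feynman_kac_product:
  fixes \<phi> :: "'n \<Rightarrow> real \<Rightarrow> real \<Rightarrow> ennreal"
  assumes \<phi>: "\<And>i. case_prod (\<phi> i) \<in> borel_measurable (borel \<Otimes>\<^sub>M borel)" and \<sigma>: "0 < \<sigma>"
  defines "p \<equiv> \<lambda>y. ennreal (mvnormal_density 0 ((\<sigma>\<^sup>2 / real CARD('n)) *\<^sub>R mat 1) y)"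
    and "k \<equiv> real CARD('n) / (2 * \<alpha>\<^sup>2 * \<sigma>\<^sup>2)"
  shows "feynman_kac p drift (weight (\<theta> / (2 * \<sigma>\<^sup>2))) (\<lambda>s. \<Prod>i\<in>UNIV. \<phi> i (fst s $ i) (snd s $ i))
    = (\<lambda>s. \<Prod>i\<in>UNIV. ar_step (bt i) (ct i) k (tau \<theta> i) (\<phi> i) (fst s $ i) (snd s $ i))"
proof (rule ext)
  fix s :: "(real^'n) \<times> (real^'n)"
  let ?d = "real CARD('n)" and ?\<eta> = "\<theta> / (2 * \<sigma>\<^sup>2)"
  let ?s = "sqrt (\<sigma>\<^sup>2 / ?d)"
  have d: "0 < ?d" by simp
  have v: "0 < \<sigma>\<^sup>2 / ?d" using \<sigma> by simp
  have s0: "0 < ?s" "?s\<^sup>2 = \<sigma>\<^sup>2 / ?d" using \<sigma> by simp_all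
  have k: "k = 1 / (2 * \<alpha>\<^sup>2 * ?s\<^sup>2)" unfolding s0 k_def by simp
  let ?m = "\<lambda>i. - (bt i * fst s $ i + ct i * snd s $ i)"
  let ?g = "\<lambda>i \<xi>. ennreal (normal_density 0 ?s \<xi> * exp (tau \<theta> i / (2 * \<alpha>\<^sup>2 * ?s\<^sup>2) * (?m i - \<alpha> * \<xi>)\<^sup>2)) * \<phi> i (?m i - \<alpha> * \<xi>) (fst s $ i)"
  have g_meas: "?g i \<in> borel_measurable borel" for i
    using \<phi>[of i] by (intro borel_measurable_times_ennreal measurable_compose[OF _ measurable_sections(1)]) (auto)
  have dens: "normal_density 0 ?s x = exp (- x\<^sup>2 / (2 * ?s\<^sup>2)) / sqrt (2 * pi * ?s\<^sup>2)" for x by (simp add: normal_density_def)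
  have inv: "(\<Prod>i\<in>UNIV. normal_density 0 ?s (y $ i)) = (\<Prod>i\<in>UNIV. normal_density 0 ?s ((transpose U *v y) $ i))" for y :: "real^'n"
  proof -
    have prod: "(\<Prod>i\<in>UNIV. normal_density 0 ?s (x $ i)) = exp (- (norm x)\<^sup>2 / (2 * ?s\<^sup>2)) / (sqrt (2 * pi * ?s\<^sup>2)) ^ CARD('n)" for x :: "real^'n"
    proof -
      have n: "(norm x)\<^sup>2 = (\<Sum>i\<in>UNIV. (x $ i)\<^sup>2)"
        by (simp add: power2_norm_eq_inner inner_vec_def) (simp add: power2_eq_square)
      have "(\<Prod>i\<in>UNIV. exp (- (x $ i)\<^sup>2 / e)) = exp (- (norm x)\<^sup>2 / e)" for e
        unfolding n by (subst exp_sum[symmetric]) (simp_all add: sum_divide_distrib sum_negf)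
      then show ?thesis unfolding dens prod_dividef by (simp only: prod_constant)
    qed
    have "orthogonal_matrix (transpose U)" using orth by (simp add: orthogonal_matrix_def)
    then show ?thesis unfolding prod by (simp add: norm_orthogonal)
  qed
  have "p y * (weight ?\<eta> (drift s y) * (\<Prod>i\<in>UNIV. \<phi> i (fst (drift s y) $ i) (snd (drift s y) $ i)))
     = (\<Prod>i\<in>UNIV. ?g i ((transpose U *v y) $ i))" for y
  proof -
    have c: "?\<eta> * (lam i / 2) = tau \<theta> i / (2 * \<alpha>\<^sup>2 * ?s\<^sup>2)" for i
      unfolding s0 tau_def using \<alpha>_pos \<sigma> d by (simp add: field_simps)
    have "weight ?\<eta> (drift s y) = ennreal (\<Prod>i\<in>UNIV. exp (tau \<theta> i / (2 * \<alpha>\<^sup>2 * ?s\<^sup>2) * (?m i - \<alpha> * (transpose U *v y) $ i)\<^sup>2))"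
      unfolding c[symmetric] by (simp add: weight_def drift_def sum_distrib_left exp_sum mult.assoc)
    moreover have "p y = ennreal (\<Prod>i\<in>UNIV. normal_density 0 ?s ((transpose U *v y) $ i))"
      unfolding p_def mvnormal_density_isotropic[OF v] by (rule arg_cong[OF inv])
    moreover have "(\<Prod>i\<in>UNIV. \<phi> i (fst (drift s y) $ i) (snd (drift s y) $ i)) = (\<Prod>i\<in>UNIV. \<phi> i (?m i - \<alpha> * (transpose U *v y) $ i) (fst s $ i))"
      by (simp add: drift_def)
    ultimately show ?thesis
      by (simp only: prod_ennreal[symmetric] normal_density_nonneg exp_ge_zero ennreal_mult prod.distrib mult.assoc)
  qed
  then have "feynman_kac p drift (weight ?\<eta>) (\<lambda>s. \<Prod>i\<in>UNIV. \<phi> i (fst s $ i) (snd s $ i)) s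
    = (\<integral>\<^sup>+ y. (\<Prod>i\<in>UNIV. ?g i ((transpose U *v y) $ i)) \<partial>lborel)"
    unfolding feynman_kac_def by (simp only:)
  also have "\<dots> = (\<integral>\<^sup>+ y. (\<Prod>i\<in>UNIV. ?g i (y $ i)) \<partial>(lborel :: (real^'n) measure))"
  proof (rule nn_integral_orthogonal)
    show "orthogonal_matrix (transpose U)" using orth by (simp add: orthogonal_matrix_def)
    show "(\<lambda>y. \<Prod>i\<in>UNIV. ?g i (y $ i)) \<in> borel_measurable (borel :: (real^'n) measure)"
      by (intro borel_measurable_prod_ennreal measurable_compose[OF _ g_meas] borel_measurable_continuous_onI continuous_intros)
  qed
  also have "\<dots> = (\<Prod>i\<in>UNIV. \<integral>\<^sup>+ \<xi>. ?g i \<xi> \<partial>lborel)"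
    by (rule nn_integral_lborel_prod_vec) (rule g_meas)
  also have "\<dots> = (\<Prod>i\<in>UNIV. ar_step (bt i) (ct i) k (tau \<theta> i) (\<phi> i) (fst s $ i) (snd s $ i))"
    unfolding k by (intro prod.cong refl ar_step_noise \<alpha>_pos s0 \<phi>)
  finally show "feynman_kac p drift (weight ?\<eta>) (\<lambda>s. \<Prod>i\<in>UNIV. \<phi> i (fst s $ i) (snd s $ i)) s
    = (\<Prod>i\<in>UNIV. ar_step (bt i) (ct i) k (tau \<theta> i) (\<phi> i) (fst s $ i) (snd s $ i))" .
qed

lemma feynman_kac_iterate:
  assumes \<sigma>: "0 < \<sigma>"
  defines "p \<equiv> \<lambda>y. ennreal (mvnormal_density 0 ((\<sigma>\<^sup>2 / real CARD('n)) *\<^sub>R mat 1) y)"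
    and "k \<equiv> real CARD('n) / (2 * \<alpha>\<^sup>2 * \<sigma>\<^sup>2)"
  shows "(feynman_kac p drift (weight (\<theta> / (2 * \<sigma>\<^sup>2))) ^^ n) (\<lambda>_. 1)
    = (\<lambda>s. \<Prod>i\<in>UNIV. (ar_step (bt i) (ct i) k (tau \<theta> i) ^^ n) (\<lambda>_ _. 1) (fst s $ i) (snd s $ i))"
proof (induction n)
  case (Suc n)
  show ?case
    unfolding funpow.simps o_apply Suc unfolding p_def k_def
    by (rule feynman_kac_product[OF _ \<sigma>]) (rule ar_iter_measurable, simp)
qed simp

end

section \<open>The limiting logarithmic moment generating function\<close>

lemma ln_div_lim_of_geometric_bounds:
  fixes e :: "nat \<Rightarrow> real"
  assumes C: "0 < C1" "0 < C2" and R: "0 < R"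
    and bd: "\<And>m. C1 * R ^ m \<le> e (m + 2)" "\<And>m. e (m + 2) \<le> C2 * R ^ m"
  shows "(\<lambda>n. ln (e n) / real n) \<longlonglongrightarrow> ln R"
proof -
  have lim: "(\<lambda>n. ln C * (1 / real n) + ln R - 2 * ln R * (1 / real n)) \<longlonglongrightarrow> ln C * 0 + ln R - 2 * ln R * 0" for C
    by (intro tendsto_intros lim_1_over_n)
  have eq: "ln (C * R ^ m) / real (m + 2) = ln C * (1 / real (m + 2)) + ln R - 2 * ln R * (1 / real (m + 2))" if "0 < C" for C m
  proof -
    have "ln (C * R ^ m) = ln C + real m * ln R" using that R by (simp add: ln_mult ln_realpow)
    moreover have "(x + (N - 2) * y) / N = x * (1 / N) + y - 2 * y * (1 / N)" if "0 < N" for x y N :: real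
      using that by (simp add: add_divide_distrib left_diff_distrib diff_divide_distrib)
    from this[of "real (m + 2)" "ln C" "ln R"]
    have "(ln C + real m * ln R) / real (m + 2) = ln C * (1 / real (m + 2)) + ln R - 2 * ln R * (1 / real (m + 2))" by simp
    ultimately show ?thesis by (simp only:)
  qed
  show ?thesis
  proof (rule tendsto_sandwich)
    show "\<forall>\<^sub>F n in sequentially. ln C1 * (1 / real n) + ln R - 2 * ln R * (1 / real n) \<le> ln (e n) / real n"
      unfolding eventually_sequentially
    proof (intro exI allI impI)
      fix n :: nat assume "2 \<le> n"
      then obtain m where n: "n = m + 2" by (metis add.commute le_Suc_ex)
      have "ln (C1 * R ^ m) \<le> ln (e (m + 2))" using bd(1)[of m] C R by (intro ln_mono) auto
      then have "ln (C1 * R ^ m) / real (m + 2) \<le> ln (e (m + 2)) / real (m + 2)" by (rule divide_right_mono) simp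
      then show "ln C1 * (1 / real n) + ln R - 2 * ln R * (1 / real n) \<le> ln (e n) / real n"
        unfolding n eq[OF C(1)] .
    qed
    show "\<forall>\<^sub>F n in sequentially. ln (e n) / real n \<le> ln C2 * (1 / real n) + ln R - 2 * ln R * (1 / real n)"
      unfolding eventually_sequentially
    proof (intro exI allI impI)
      fix n :: nat assume "2 \<le> n"
      then obtain m where n: "n = m + 2" by (metis add.commute le_Suc_ex)
      have "0 < e (m + 2)" using bd(1)[of m] C R by (meson less_le_trans mult_pos_pos zero_less_power)
      then have "ln (e (m + 2)) \<le> ln (C2 * R ^ m)" using bd(2)[of m] by (intro ln_mono) auto
      then have "ln (e (m + 2)) / real (m + 2) \<le> ln (C2 * R ^ m) / real (m + 2)" by (rule divide_right_mono) simp
      then show "ln (e n) / real n \<le> ln C2 * (1 / real n) + ln R - 2 * ln R * (1 / real n)"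
        unfolding n eq[OF C(2)] .
    qed
  qed (use lim[of C1] lim[of C2] in simp_all)
qed

lemma prod_mono_ennreal: "(\<And>i. f i \<le> g i) \<Longrightarrow> prod f A \<le> (prod g A :: ennreal)"
  by (induction A rule: infinite_finite_induct) (auto intro: mult_mono)

context gmm_quadratic
begin

definition slope :: "'n \<Rightarrow> real" where "slope i = \<alpha>\<^sup>2 * lam i / (2 * real CARD('n))"

lemma tau_slope: "tau \<theta> i = \<theta> * slope i" by (simp add: tau_def slope_def)

lemma slope_pos: "0 < slope i" using \<alpha>_pos lam_pos[of i] by (simp add: slope_def)

abbreviation "crit i \<equiv> sf_crit (bt i) (ct i)"
abbreviation "Aof \<theta> i \<equiv> sf_A (bt i) (ct i) (tau \<theta> i)"

definition theta_c :: real where "theta_c = real CARD('n) / (H_inf \<alpha> \<beta> \<nu> lam)\<^sup>2"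

definition LamF :: "real \<Rightarrow> real" where "LamF \<theta> = - (1/2) * (\<Sum>i\<in>UNIV. ln (Aof \<theta> i))"
definition DLamF :: "real \<Rightarrow> real" where "DLamF \<theta> = (1/2) * (\<Sum>i\<in>UNIV. slope i * sf_dl (bt i) (ct i) (tau \<theta> i))"

lemma crit_eq: "crit i = (s_tilde \<alpha> \<beta> \<nu> (lam i))\<^sup>2" and s_pos: "0 < s_tilde \<alpha> \<beta> \<nu> (lam i)"
  using s_tilde_crit[OF stable[of i]] by auto

text \<open>With \<open>m\<close> the maximum in \<open>H_inf\<close> one has
  \<open>tau theta_c i = lam i / m\<^sup>2\<close>, whereas \<open>crit i\<close> is
  \<open>lam i\<close> divided by the square of the \<open>i\<close>-th quotient. The maximizing
  mode becomes critical exactly at \<open>theta_c\<close>, and it is this mode that later supplies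
  the steepness.\<close>

lemma theta_c_facts:
  shows theta_c_pos: "0 < theta_c"
    and tau_theta_c_le: "tau theta_c i \<le> crit i"
    and tau_theta_c_attained: "\<exists>j. tau theta_c j = crit j"
proof -
  let ?q = "\<lambda>i. sqrt (lam i) / s_tilde \<alpha> \<beta> \<nu> (lam i)"
  define m where "m = Max (range ?q)"
  have q_pos: "0 < ?q i" for i using lam_pos s_pos by simp
  have m_ge: "?q i \<le> m" for i unfolding m_def by (intro Max_ge) auto
  have "m \<in> range ?q" unfolding m_def by (intro Max_in) auto
  then obtain j where j: "m = ?q j" by auto
  have m_pos: "0 < m" using q_pos[of j] j by simp
  have th: "theta_c = 2 * real CARD('n) / (\<alpha>\<^sup>2 * m\<^sup>2)"
    unfolding theta_c_def H_inf_def m_def[symmetric] by (simp add: power_mult_distrib power_divide)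
  show "0 < theta_c" unfolding th using m_pos \<alpha>_pos by simp
  have t: "tau theta_c i = lam i / m\<^sup>2" for i
    unfolding tau_def th using \<alpha>_pos by simp
  have le: "lam i / m\<^sup>2 \<le> lam i / (?q i)\<^sup>2" for i
    using m_ge[of i] q_pos[of i] m_pos lam_pos[of i] by (intro divide_left_mono power_mono mult_pos_pos zero_less_power) auto
  have qq: "lam i / (?q i)\<^sup>2 = crit i" for i
    unfolding crit_eq using lam_pos[of i] by (simp add: power_divide)
  show "tau theta_c i \<le> crit i" unfolding t using le[of i] qq[of i] by simp
  show "\<exists>j. tau theta_c j = crit j" using t[of j] qq[of j] j by auto
qed

lemma tau_less_crit: assumes "\<theta> < theta_c" shows "tau \<theta> i < crit i"
proof -
  have "tau \<theta> i < tau theta_c i" using assms slope_pos[of i] by (simp add: tau_slope)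
  then show ?thesis using tau_theta_c_le[of i] by simp
qed

lemma sfac: "\<theta> < theta_c \<Longrightarrow> spectral_factor (bt i) (ct i) (tau \<theta> i) (Aof \<theta> i)"
  by (rule spectral_factor_sf_A[OF stable tau_less_crit])

lemma Aof_pos: "\<theta> < theta_c \<Longrightarrow> 0 < Aof \<theta> i"
  using spectral_factor.A_pos[OF sfac] .

lemma LamF_deriv:
  assumes \<theta>: "\<theta> < theta_c"
  shows "(LamF has_real_derivative DLamF \<theta>) (at \<theta>)"
proof -
  have "((\<lambda>t. ln (Aof t i)) has_real_derivative - sf_dl (bt i) (ct i) (tau \<theta> i) * slope i) (at \<theta>)" for i
  proof -
    have "((\<lambda>t. tau t i) has_real_derivative slope i) (at \<theta>)"
      unfolding tau_slope using DERIV_cmult_right[OF DERIV_ident, of "slope i"] by simp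
    from DERIV_chain2[OF sf_ln_A_deriv[OF stable tau_less_crit[OF \<theta>]] this] show ?thesis .
  qed
  then have "((\<lambda>t. - (1/2) * (\<Sum>i\<in>UNIV. ln (Aof t i))) has_real_derivative
     - (1/2) * (\<Sum>i\<in>UNIV. - sf_dl (bt i) (ct i) (tau \<theta> i) * slope i)) (at \<theta>)"
    by (intro DERIV_cmult DERIV_sum)
  moreover have "- (1/2) * (\<Sum>i\<in>UNIV. - sf_dl (bt i) (ct i) (tau \<theta> i) * slope i) = DLamF \<theta>"
    by (simp add: DLamF_def sum_negf mult.commute)
  ultimately show ?thesis unfolding LamF_def[abs_def] by (simp only:)
qed

lemma far_negative:
  obtains T where "T < 0" "\<And>\<theta> i. \<theta> \<le> T \<Longrightarrow> tau \<theta> i \<le> - (16 * \<bar>ct i\<bar>) - 1"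
proof -
  define T where "T = - Max (range (\<lambda>i. (16 * \<bar>ct i\<bar> + 1) / slope i))"
  have le: "(16 * \<bar>ct i\<bar> + 1) / slope i \<le> - T" for i
    unfolding T_def minus_minus by (intro Max_ge) auto
  have "0 < (16 * \<bar>ct i\<bar> + 1) / slope i" for i using slope_pos[of i] by (intro divide_pos_pos) auto
  then have T: "T < 0" using le by (metis less_le_trans neg_0_less_iff_less)
  have "tau \<theta> i \<le> - (16 * \<bar>ct i\<bar>) - 1" if "\<theta> \<le> T" for \<theta> i
  proof -
    have "16 * \<bar>ct i\<bar> + 1 \<le> - T * slope i" using le[of i] slope_pos[of i] by (simp add: divide_le_eq)
    also have "\<dots> \<le> - \<theta> * slope i" using that slope_pos[of i] by (intro mult_right_mono) auto
    finally show ?thesis by (simp add: tau_slope)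
  qed
  then show ?thesis using that T by blast
qed

lemma LamF_at_bot: "filterlim LamF at_bot at_bot"
  unfolding filterlim_at_bot
proof
  fix Z :: real
  obtain T where T: "T < 0" "\<And>\<theta> i. \<theta> \<le> T \<Longrightarrow> tau \<theta> i \<le> - (16 * \<bar>ct i\<bar>) - 1" using far_negative by blast
  \<comment> \<open>If every \<open>Aof \<theta> i\<close> is at least \<open>B\<close>, each
    logarithm is at least \<open>2 * \<bar>Z\<bar>\<close>, which offsets the factor 1/2 in
    \<open>LamF\<close>. The 8 in \<open>T2\<close> comes from \<open>sf_far\<close>.\<close>
  define B where "B = exp (2 * \<bar>Z\<bar>)"
  define T2 where "T2 = - Max (range (\<lambda>i. 8 * B / slope i))"
  have le: "8 * B / slope i \<le> - T2" for i
    unfolding T2_def minus_minus by (intro Max_ge) auto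
  show "\<forall>\<^sub>F \<theta> in at_bot. LamF \<theta> \<le> Z"
    using eventually_le_at_bot[of "min T T2"]
  proof eventually_elim
    case (elim \<theta>)
    have th: "\<theta> < theta_c" using elim T(1) theta_c_pos by simp
    have "2 * \<bar>Z\<bar> \<le> ln (Aof \<theta> i)" for i
    proof -
      have "B \<le> - T2 * slope i / 8" using le[of i] slope_pos[of i] by (simp add: divide_le_eq)
      also have "\<dots> \<le> - \<theta> * slope i / 8" using elim slope_pos[of i] by (intro divide_right_mono mult_right_mono) auto
      also have "\<dots> = - tau \<theta> i / 8" by (simp add: tau_slope)
      also have "\<dots> \<le> Aof \<theta> i"
        using sf_far(2)[OF stable tau_less_crit[OF th] T(2)] elim by simp
      finally have "B \<le> Aof \<theta> i" .
      moreover have "0 < B" by (simp add: B_def)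
      ultimately have "ln B \<le> ln (Aof \<theta> i)" by (intro ln_mono) auto
      then show ?thesis by (simp add: B_def)
    qed
    then have "(\<Sum>i\<in>(UNIV::'n set). 2 * \<bar>Z\<bar>) \<le> (\<Sum>i\<in>UNIV. ln (Aof \<theta> i))" by (intro sum_mono)
    then have "real CARD('n) * (2 * \<bar>Z\<bar>) \<le> (\<Sum>i\<in>UNIV. ln (Aof \<theta> i))" by simp
    moreover have "1 * (2 * \<bar>Z\<bar>) \<le> real CARD('n) * (2 * \<bar>Z\<bar>)"
      by (intro mult_right_mono) (auto simp: Suc_le_eq)
    ultimately show ?case by (simp add: LamF_def)
  qed
qed

lemma DLamF_cont: "continuous_on {..<theta_c} DLamF"
proof -
  have "continuous_on {..<theta_c} (\<lambda>\<theta>. sf_dl (bt i) (ct i) (tau \<theta> i))" for i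
    by (rule continuous_on_compose2[OF sf_dl_cont[OF stable]])
      (auto simp: tau_less_crit, simp add: tau_slope, intro continuous_intros)
  then show ?thesis unfolding DLamF_def[abs_def] by (intro continuous_intros)
qed

text \<open>Intermediate value theorem: the slopes tend to 0 at minus infinity by
  \<open>sf_far\<close>, and near \<open>theta_c\<close> the critical mode \<open>j\<close> alone
  makes them exceed \<open>s\<close>, all other summands being positive.\<close>

lemma DLamF_surj:
  assumes s: "0 < s"
  shows "\<exists>\<theta><theta_c. DLamF \<theta> = s"
proof -
  obtain T where T: "T < 0" "\<And>\<theta> i. \<theta> \<le> T \<Longrightarrow> tau \<theta> i \<le> - (16 * \<bar>ct i\<bar>) - 1" using far_negative by blast
  have low: "DLamF \<theta> \<le> real CARD('n) / (- \<theta>)" if \<theta>: "\<theta> \<le> T" for \<theta>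
  proof -
    have th: "\<theta> < theta_c" using \<theta> T(1) theta_c_pos by simp
    have "slope i * sf_dl (bt i) (ct i) (tau \<theta> i) \<le> 2 / (- \<theta>)" for i
    proof -
      have "slope i * sf_dl (bt i) (ct i) (tau \<theta> i) \<le> slope i * (2 / (- tau \<theta> i))"
        using sf_far(1)[OF stable tau_less_crit[OF th] T(2)[OF \<theta>]] slope_pos[of i] by (intro mult_left_mono) auto
      also have "\<dots> = 2 / (- \<theta>)" using slope_pos[of i] by (simp add: tau_slope)
      finally show ?thesis .
    qed
    then have "(\<Sum>i\<in>UNIV. slope i * sf_dl (bt i) (ct i) (tau \<theta> i)) \<le> (\<Sum>i\<in>(UNIV::'n set). 2 / (- \<theta>))"
      by (intro sum_mono)
    then show ?thesis by (simp add: DLamF_def)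
  qed
  obtain j where j: "tau theta_c j = crit j" using tau_theta_c_attained by blast
  obtain K where K: "0 < K" "\<And>\<tau>. \<tau> < crit j \<Longrightarrow> crit j - 1 < \<tau> \<Longrightarrow> K / (crit j - \<tau>) \<le> (sf_dl (bt j) (ct j) \<tau>)\<^sup>2"
    using sf_steep[OF stable[of j]] by blast
  \<comment> \<open>The bound 1/2 keeps \<open>tau \<theta>2 j\<close> in the unit window of
    \<open>sf_steep\<close>; the other bound makes \<open>sf_dl\<close> of mode \<open>j\<close> at
    least \<open>2 * s / slope j\<close>, the 2 compensating the factor 1/2 in
    \<open>DLamF\<close>.\<close>
  define e where "e = min (1/2) (K / (2 * s / slope j)\<^sup>2)"
  have e: "0 < e" "e < 1" "e \<le> K / (2 * s / slope j)\<^sup>2" using K(1) s slope_pos[of j] by (auto simp: e_def)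
  define \<theta>2 where "\<theta>2 = theta_c - e / slope j"
  have \<theta>2: "\<theta>2 < theta_c" using e slope_pos[of j] by (simp add: \<theta>2_def)
  have t2: "crit j - tau \<theta>2 j = e" using slope_pos[of j] by (simp add: j[symmetric] tau_slope \<theta>2_def left_diff_distrib)
  have "(2 * s / slope j)\<^sup>2 \<le> K / e" using e K(1) s slope_pos[of j] by (simp add: field_simps)
  also have "\<dots> \<le> (sf_dl (bt j) (ct j) (tau \<theta>2 j))\<^sup>2"
    using K(2)[of "tau \<theta>2 j"] t2 e tau_less_crit[OF \<theta>2, of j] by simp
  finally have "2 * s / slope j \<le> sf_dl (bt j) (ct j) (tau \<theta>2 j)"
    by (rule power2_le_imp_le) (use sf_dl_pos[OF stable tau_less_crit[OF \<theta>2]] in \<open>simp add: less_imp_le\<close>)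
  then have "2 * s \<le> slope j * sf_dl (bt j) (ct j) (tau \<theta>2 j)" using slope_pos[of j] by (simp add: field_simps)
  also have "\<dots> \<le> (\<Sum>i\<in>UNIV. slope i * sf_dl (bt i) (ct i) (tau \<theta>2 i))"
    using sf_dl_pos[OF stable tau_less_crit[OF \<theta>2]] slope_pos
    by (intro member_le_sum[of j UNIV "\<lambda>i. slope i * sf_dl (bt i) (ct i) (tau \<theta>2 i)"]) (auto intro!: mult_nonneg_nonneg less_imp_le)
  finally have hi: "s \<le> DLamF \<theta>2" by (simp add: DLamF_def)
  define \<theta>1 where "\<theta>1 = min (min T \<theta>2) (- (real CARD('n) / s))"
  have \<theta>1: "\<theta>1 \<le> T" "\<theta>1 \<le> \<theta>2" "\<theta>1 \<le> - (real CARD('n) / s)" by (auto simp: \<theta>1_def)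
  have "0 < real CARD('n) / s" using s by simp
  then have neg: "0 < - \<theta>1" using \<theta>1(3) by linarith
  have "real CARD('n) / s \<le> - \<theta>1" using \<theta>1(3) by linarith
  then have "real CARD('n) \<le> s * (- \<theta>1)" using s by (simp add: divide_le_eq mult.commute)
  then have "real CARD('n) / (- \<theta>1) \<le> s" using neg by (subst divide_le_eq) simp
  then have lo: "DLamF \<theta>1 \<le> s" using low[OF \<theta>1(1)] by simp
  have "continuous_on {\<theta>1..\<theta>2} DLamF" by (rule continuous_on_subset[OF DLamF_cont]) (use \<theta>2 in auto)
  from IVT'[OF lo hi \<theta>1(2) this] obtain \<theta> where "\<theta>1 \<le> \<theta>" "\<theta> \<le> \<theta>2" "DLamF \<theta> = s" by blast
  then show ?thesis using \<theta>2 by (intro exI[of _ \<theta>]) auto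
qed

lemma product_bounds:
  assumes k: "0 < k" and \<theta>: "\<theta> < theta_c"
  shows "\<exists>C1 C2. 0 < C1 \<and> 0 < C2 \<and>
    (\<forall>m. ennreal (C1 * exp (LamF \<theta>) ^ m) \<le> (\<Prod>i\<in>UNIV. (ar_step (bt i) (ct i) k (tau \<theta> i) ^^ (m + 2)) (\<lambda>_ _. 1) (a i) (a' i))) \<and>
    (\<forall>m. (\<Prod>i\<in>UNIV. (ar_step (bt i) (ct i) k (tau \<theta> i) ^^ (m + 2)) (\<lambda>_ _. 1) (a i) (a' i)) \<le> ennreal (C2 * exp (LamF \<theta>) ^ m))"
proof -
  let ?T = "\<lambda>i m. (ar_step (bt i) (ct i) k (tau \<theta> i) ^^ (m + 2)) (\<lambda>_ _. 1) (a i) (a' i)"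
  let ?r = "\<lambda>i. 1 / sqrt (Aof \<theta> i)"
  have "\<exists>K. 0 < K \<and> (\<forall>m. ennreal (K * ?r i ^ m) \<le> ?T i m)" for i
    using spectral_factor.ar_iter_lower[OF sfac[OF \<theta>] k, of i "a i" "a' i"] by blast
  then obtain K1 where K1: "\<And>i. 0 < K1 i" "\<And>i m. ennreal (K1 i * ?r i ^ m) \<le> ?T i m" by metis
  have "\<exists>K. 0 < K \<and> (\<forall>m. ?T i m \<le> ennreal (K * ?r i ^ m))" for i
    using spectral_factor.ar_iter_upper[OF sfac[OF \<theta>] k, of i "a i" "a' i"] by blast
  then obtain K2 where K2: "\<And>i. 0 < K2 i" "\<And>i m. ?T i m \<le> ennreal (K2 i * ?r i ^ m)" by metis
  have R: "exp (LamF \<theta>) = (\<Prod>i\<in>UNIV. ?r i)"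
  proof -
    have "?r i = exp (- (1/2) * ln (Aof \<theta> i))" for i
      using Aof_pos[OF \<theta>, of i] by (simp add: ln_sqrt[symmetric] exp_minus inverse_eq_divide)
    then have "(\<Prod>i\<in>UNIV. ?r i) = (\<Prod>i\<in>UNIV. exp (- (1/2) * ln (Aof \<theta> i)))" by (simp only:)
    also have "\<dots> = exp (LamF \<theta>)" unfolding LamF_def sum_distrib_left by (rule exp_sum[symmetric]) simp
    finally show ?thesis ..
  qed
  have P: "ennreal ((\<Prod>i\<in>UNIV. K i) * exp (LamF \<theta>) ^ m) = (\<Prod>i\<in>UNIV. ennreal (K i * ?r i ^ m))"
    if "\<And>i. 0 < K i" for K m
  proof -
    have "(\<Prod>i\<in>UNIV. ennreal (K i * ?r i ^ m)) = ennreal (\<Prod>i\<in>UNIV. K i * ?r i ^ m)"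
      using that Aof_pos[OF \<theta>] by (intro prod_ennreal) (auto intro!: mult_nonneg_nonneg less_imp_le)
    then show ?thesis unfolding R by (simp only: prod.distrib prod_power_distrib)
  qed
  show ?thesis
  proof (intro exI conjI allI)
    show "0 < (\<Prod>i\<in>UNIV. K1 i)" "0 < (\<Prod>i\<in>UNIV. K2 i)" using K1 K2 by (auto intro: prod_pos)
    show "ennreal ((\<Prod>i\<in>UNIV. K1 i) * exp (LamF \<theta>) ^ m) \<le> (\<Prod>i\<in>UNIV. ?T i m)" for m
      unfolding P[OF K1(1)] by (rule prod_mono_ennreal) (rule K1)
    show "(\<Prod>i\<in>UNIV. ?T i m) \<le> ennreal ((\<Prod>i\<in>UNIV. K2 i) * exp (LamF \<theta>) ^ m)" for m
      unfolding P[OF K2(1)] by (rule prod_mono_ennreal) (rule K2)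
  qed
qed

text \<open>The determinant is a product over the modes, each integrated by
  \<open>log_ratio_integral\<close>; the factor \<open>- 1/2\<close> in \<open>LamF\<close> turns
  \<open>2 * pi\<close> into \<open>- 4 * pi\<close>.\<close>

lemma log_det_integral:
  assumes \<theta>: "\<theta> < theta_c"
  defines "G \<equiv> gmm_G \<alpha> \<beta> \<nu> Q U lam"
  shows "det (risk_matrix G \<theta> \<omega>) \<in> \<real>" "0 < Re (det (risk_matrix G \<theta> \<omega>))"
    "((\<lambda>\<omega>. ln (Re (det (risk_matrix G \<theta> \<omega>)))) has_integral - (4 * pi * LamF \<theta>)) {-pi..pi}"
proof -
  have pos: "0 < 1 - tau \<theta> i / (cmod (pch i (cis \<omega>)))\<^sup>2" for i \<omega>
    using spectral_factor.ratio_pos[OF sfac[OF \<theta>]] by (simp add: pch_def)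
  show "det (risk_matrix G \<theta> \<omega>) \<in> \<real>" unfolding G_def det_risk_matrix by (rule Reals_of_real)
  show "0 < Re (det (risk_matrix G \<theta> \<omega>))" unfolding G_def det_risk_matrix using pos by (simp only: Re_complex_of_real) (intro prod_pos, simp)
  have "ln (Re (det (risk_matrix G \<theta> \<omega>))) = (\<Sum>i\<in>UNIV. ln (1 - tau \<theta> i / (cmod (pch i (cis \<omega>)))\<^sup>2))" for \<omega>
    unfolding G_def det_risk_matrix Re_complex_of_real by (rule ln_prod[OF finite less_imp_neq[OF pos, THEN not_sym]])
  moreover have "((\<lambda>\<omega>. \<Sum>i\<in>UNIV. ln (1 - tau \<theta> i / (cmod (pch i (cis \<omega>)))\<^sup>2)) has_integral (\<Sum>i\<in>UNIV. 2 * pi * ln (Aof \<theta> i))) {-pi..pi}"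
    using spectral_factor.log_ratio_integral[OF sfac[OF \<theta>]]
    by (intro has_integral_sum) (auto simp: pch_def)
  moreover have "(\<Sum>i\<in>UNIV. 2 * pi * ln (Aof \<theta> i)) = - (4 * pi * LamF \<theta>)"
    by (simp add: LamF_def sum_distrib_left sum_negf mult.assoc)
  ultimately show "((\<lambda>\<omega>. ln (Re (det (risk_matrix G \<theta> \<omega>)))) has_integral - (4 * pi * LamF \<theta>)) {-pi..pi}" by simp
qed

end

section \<open>The objective along the iterates\<close>

lemma grad_eqI:
  assumes "GDERIV f x :> D" shows "grad f x = D"
  unfolding grad_def
proof (rule the_equality)
  fix D' assume "GDERIV f x :> D'"
  then have "(\<lambda>h. h \<bullet> D') = (\<lambda>h. h \<bullet> D)"
    using assms unfolding gderiv_def by (rule has_derivative_unique)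
  then have "(D' - D) \<bullet> D' = (D' - D) \<bullet> D" by metis
  then have "(D' - D) \<bullet> (D' - D) = 0" by (simp add: inner_diff_right)
  then show "D' = D" by simp
qed fact

context gmm_quadratic
begin

lemma Q_sym: "x \<bullet> (Q *v y) = y \<bullet> (Q *v x)"
proof -
  have "transpose (diag_matrix lam) = diag_matrix lam" by (auto simp: transpose_def diag_matrix_def vec_eq_iff)
  then have "transpose Q = Q" unfolding decomp by (simp add: matrix_transpose_mul matrix_mul_assoc)
  then show ?thesis using inner_transpose[of x Q y] by (simp add: inner_commute)
qed

lemma Q_coord: "(transpose U *v (Q *v x)) $ i = lam i * (transpose U *v x) $ i"
  unfolding decomp by (rule decomp_coord[OF orth])

lemma Q_form: "v \<bullet> (Q *v v) = (\<Sum>i\<in>UNIV. lam i * ((transpose U *v v) $ i)\<^sup>2)"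
proof -
  have "v \<bullet> (Q *v v) = (transpose U *v v) \<bullet> (transpose U *v (Q *v v))"
    by (simp add: inner_transpose[of _ "transpose U"] orthogonal_cancel[OF orth])
  also have "\<dots> = (\<Sum>i\<in>UNIV. (transpose U *v v) $ i * (lam i * (transpose U *v v) $ i))"
    by (simp add: inner_vec_def Q_coord)
  finally show ?thesis by (simp add: power2_eq_square mult_ac)
qed

lemma tU_real_inj: assumes "transpose U *v x = transpose U *v y" shows "x = y"
  using arg_cong[OF assms, of "\<lambda>x. U *v x"] by (simp only: orthogonal_cancel[OF orth])

lemma Q_solve: obtains z where "Q *v z = - g"
proof -
  define z where "z = U *v (\<chi> i. - (transpose U *v g) $ i / lam i)"
  have "transpose U *v (Q *v z) = transpose U *v (- g)"
    unfolding vec_eq_iff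
  proof
    fix i
    have "lam i \<noteq> 0" using lam_pos[of i] by simp
    then show "(transpose U *v (Q *v z)) $ i = (transpose U *v (- g)) $ i"
      by (simp add: Q_coord z_def orthogonal_cancel[OF orth]) (simp add: matrix_vector_mult_def sum_negf)
  qed
  then have "Q *v z = - g" by (rule tU_real_inj)
  then show ?thesis using that by blast
qed

end

locale gmm_objective = gmm_quadratic Q U lam \<alpha> \<beta> \<nu>
  for Q U :: "real^'n::finite^'n::finite" and lam :: "'n \<Rightarrow> real" and \<alpha> \<beta> \<nu> :: real +
  fixes f :: "real^'n \<Rightarrow> real" and g xstar :: "real^'n" and h :: real
  assumes f: "\<And>y. f y = 1 / 2 * (y \<bullet> (Q *v y)) + g \<bullet> y + h"
    and xstar: "is_arg_min f (\<lambda>_. True) xstar"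
begin

lemma f_gap_at: assumes "Q *v z = - g" shows "f y - f z = 1 / 2 * ((y - z) \<bullet> (Q *v (y - z)))"
proof -
  have "g = - (Q *v z)" using assms by simp
  then show ?thesis
    using Q_sym[of z y]
    by (simp add: f matrix_vector_mult_diff_distrib inner_diff_left inner_diff_right inner_commute[of "Q *v z"] algebra_simps)
qed

text \<open>The minimizer is compared with a stationary point \<open>z\<close> from
  \<open>Q_solve\<close>: the gap between them is a positive definite form in
  \<open>xstar - z\<close>, so the two coincide.\<close>

lemma Q_xstar: "Q *v xstar = - g"
proof -
  obtain z where z: "Q *v z = - g" by (rule Q_solve)
  have "f xstar \<le> f z" using xstar by (auto simp: is_arg_min_def not_less)
  then have "(\<Sum>i\<in>UNIV. lam i * ((transpose U *v (xstar - z)) $ i)\<^sup>2) \<le> 0"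
    using f_gap_at[OF z, of xstar] by (simp add: Q_form)
  moreover have nn: "0 \<le> lam i * ((transpose U *v (xstar - z)) $ i)\<^sup>2" for i
    using lam_pos[of i] by (intro mult_nonneg_nonneg) auto
  ultimately have "(\<Sum>i\<in>UNIV. lam i * ((transpose U *v (xstar - z)) $ i)\<^sup>2) = 0"
    by (intro antisym sum_nonneg) auto
  then have "lam i * ((transpose U *v (xstar - z)) $ i)\<^sup>2 = 0" for i
    using nn by (subst (asm) sum_nonneg_eq_0_iff) auto
  then have "transpose U *v (xstar - z) = 0"
    using lam_pos by (simp add: vec_eq_iff less_imp_neq[THEN not_sym])
  then have "transpose U *v (xstar - z) = transpose U *v 0" by simp
  then have "xstar - z = 0" by (rule tU_real_inj)
  then show ?thesis using z by simp
qed

lemma f_gap: "f y - f xstar = (\<Sum>i\<in>UNIV. lam i / 2 * ((transpose U *v (y - xstar)) $ i)\<^sup>2)"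
  unfolding f_gap_at[OF Q_xstar] Q_form by (simp add: sum_distrib_left)

lemma grad_f: "grad f y = Q *v (y - xstar)"
proof (rule grad_eqI)
  have "(f has_derivative (\<lambda>k. 1 / 2 * (y \<bullet> (Q *v k) + k \<bullet> (Q *v y)) + g \<bullet> k + 0)) (at y)"
    unfolding f[abs_def]
    by (intro has_derivative_add has_derivative_mult_right has_derivative_inner_right has_derivative_inner
        has_derivative_const has_derivative_ident bounded_linear.has_derivative[OF matrix_vector_mul_bounded_linear])
  moreover have "1 / 2 * (y \<bullet> (Q *v k) + k \<bullet> (Q *v y)) + g \<bullet> k + 0 = k \<bullet> (Q *v (y - xstar))" for k
    using Q_sym[of y k] by (simp add: matrix_vector_mult_diff_distrib Q_xstar inner_add_right inner_commute)
  ultimately show "GDERIV f y :> Q *v (y - xstar)" unfolding gderiv_def by simp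
qed

definition zst :: "(real^'n) \<times> (real^'n) \<Rightarrow> (real^'n) \<times> (real^'n)" where
  "zst s = (transpose U *v (fst s - xstar), transpose U *v (snd s - xstar))"

lemma gmm_state_trajectory:
  "zst (gmm_state f \<alpha> \<beta> \<nu> x0 e k) = trajectory (zst (x0, x0)) drift e k"
proof (induction k)
  case (Suc k)
  obtain x xp where s: "gmm_state f \<alpha> \<beta> \<nu> x0 e k = (x, xp)" by (cases "gmm_state f \<alpha> \<beta> \<nu> x0 e k")
  let ?V = "\<lambda>x. transpose U *v x"
  let ?y = "x + \<nu> *\<^sub>R (x - xp)" and ?e = "e (Suc k)"
  let ?z = "?V (x - xstar)" and ?zp = "?V (xp - xstar)"
  have lin: "?V (a - b) = ?V a - ?V b" "?V (a + b) = ?V a + ?V b" "?V (r *\<^sub>R a) = r *\<^sub>R ?V a" for a b r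
    by (simp_all add: matrix_vector_mult_diff_distrib matrix_vector_right_distrib matrix_vector_mult_scaleR)
  have new: "gmm_state f \<alpha> \<beta> \<nu> x0 e (Suc k) = (x - \<alpha> *\<^sub>R (Q *v (?y - xstar) + ?e) + \<beta> *\<^sub>R (x - xp), x)"
    by (simp add: s Let_def grad_f)
  have yz: "?V (?y - xstar) = ?z + \<nu> *\<^sub>R (?z - ?zp)" by (simp add: lin algebra_simps)
  have "?V (x - \<alpha> *\<^sub>R (Q *v (?y - xstar) + ?e) + \<beta> *\<^sub>R (x - xp) - xstar)
    = ?z - \<alpha> *\<^sub>R (?V (Q *v (?y - xstar)) + ?V ?e) + \<beta> *\<^sub>R (?z - ?zp)"
    by (simp only: lin) (simp add: algebra_simps)
  then have "?V (x - \<alpha> *\<^sub>R (Q *v (?y - xstar) + ?e) + \<beta> *\<^sub>R (x - xp) - xstar) $ i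
    = - (bt i * ?z $ i + ct i * ?zp $ i) - \<alpha> * ?V ?e $ i" for i
    by (simp add: Q_coord yz) (simp add: b_tilde_def c_tilde_def algebra_simps)
  then have "zst (gmm_state f \<alpha> \<beta> \<nu> x0 e (Suc k)) = drift (?z, ?zp) ?e"
    unfolding new by (simp add: zst_def drift_def vec_eq_iff)
  also have "(?z, ?zp) = trajectory (zst (x0, x0)) drift e k" unfolding Suc.IH[symmetric] s by (simp add: zst_def)
  finally show ?case by simp
qed simp

definition gap :: "(real^'n) \<times> (real^'n) \<Rightarrow> real" where
  "gap s = (\<Sum>i\<in>UNIV. lam i / 2 * (fst s $ i)\<^sup>2)"

lemma gap_gmm: "f (gmm f \<alpha> \<beta> \<nu> x0 e k) - f xstar = gap (trajectory (zst (x0, x0)) drift e k)"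
  unfolding gmm_state_trajectory[symmetric] f_gap by (simp add: gap_def zst_def gmm_def)

lemma gap_nonneg: "0 \<le> gap s"
  unfolding gap_def using lam_pos by (intro sum_nonneg mult_nonneg_nonneg) (auto intro: less_imp_le)

lemma gap_measurable: "gap \<in> borel_measurable borel"
  unfolding gap_def by (intro borel_measurable_continuous_onI continuous_intros)

lemma weight_gap: "weight \<eta> s = ennreal (exp (\<eta> * gap s))"
  by (simp add: weight_def gap_def)

text \<open>Jensen's inequality for the objective; in eigencoordinates it is Cauchy-Schwarz for each
  coordinate.\<close>

lemma gap_average:
  assumes "finite A" "A \<noteq> {}"
  shows "f ((1 / real (card A)) *\<^sub>R (\<Sum>k\<in>A. x k)) - f xstar \<le> (\<Sum>k\<in>A. f (x k) - f xstar) / real (card A)"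
proof -
  let ?V = "\<lambda>x. transpose U *v x" and ?n = "real (card A)"
  have n: "0 < ?n" using assms by (simp add: card_gt_0_iff)
  have lin: "linear ?V" by (rule matrix_vector_mul_linear)
  have "(1 / ?n) *\<^sub>R (\<Sum>k\<in>A. x k) - xstar = (1 / ?n) *\<^sub>R (\<Sum>k\<in>A. x k - xstar)"
    using n by (simp add: sum_subtractf scaleR_diff_right sum_constant_scaleR del: sum_constant)
  then have V: "?V ((1 / ?n) *\<^sub>R (\<Sum>k\<in>A. x k) - xstar) $ i = (\<Sum>k\<in>A. ?V (x k - xstar) $ i) / ?n" for i
    by (simp add: linear_scale[OF lin] linear_sum[OF lin])
  have "f ((1 / ?n) *\<^sub>R (\<Sum>k\<in>A. x k)) - f xstar = (\<Sum>i\<in>UNIV. lam i / 2 * ((\<Sum>k\<in>A. ?V (x k - xstar) $ i) / ?n)\<^sup>2)"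
    unfolding f_gap V ..
  also have "\<dots> \<le> (\<Sum>i\<in>UNIV. lam i / 2 * ((\<Sum>k\<in>A. (?V (x k - xstar) $ i)\<^sup>2) / ?n))"
  proof (intro sum_mono mult_left_mono)
    fix i
    have "(\<Sum>k\<in>A. ?V (x k - xstar) $ i)\<^sup>2 \<le> (\<Sum>k\<in>A. (?V (x k - xstar) $ i)\<^sup>2) * ?n"
      using sum_squared_le_sum_of_squares[of "\<lambda>k. ?V (x k - xstar) $ i" A] by simp
    then have "(\<Sum>k\<in>A. ?V (x k - xstar) $ i)\<^sup>2 / ?n\<^sup>2 \<le> (\<Sum>k\<in>A. (?V (x k - xstar) $ i)\<^sup>2) * ?n / ?n\<^sup>2"
      by (intro divide_right_mono) auto
    also have "\<dots> = (\<Sum>k\<in>A. (?V (x k - xstar) $ i)\<^sup>2) / ?n" using n by (simp add: power2_eq_square)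
    finally show "((\<Sum>k\<in>A. ?V (x k - xstar) $ i) / ?n)\<^sup>2 \<le> (\<Sum>k\<in>A. (?V (x k - xstar) $ i)\<^sup>2) / ?n"
      by (simp add: power_divide)
  qed (use lam_pos in \<open>simp add: less_imp_le\<close>)
  also have "\<dots> = (\<Sum>k\<in>A. f (x k) - f xstar) / ?n"
    unfolding f_gap by (subst sum.swap) (simp add: sum_divide_distrib sum_distrib_left)
  finally show ?thesis .
qed

end

section \<open>The risk-sensitive index and the rate function\<close>

lemma (in mgf_limit) log_mgf_lim:
  assumes "\<theta> < c"
  shows "(\<lambda>n. ereal (r / real (n + 1)) * eln (\<integral>\<^sup>+ \<omega>. ennreal (exp (\<theta> * S n \<omega>)) \<partial>M)) \<longlonglongrightarrow> ereal (r * \<Lambda> \<theta>)"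
proof -
  have "(\<lambda>n. r * (ln (Z n \<theta>) / real n * (real n / real (n + 1)))) \<longlonglongrightarrow> r * (\<Lambda> \<theta> * 1)"
  proof (intro tendsto_intros ln_Z_lim assms)
    show "(\<lambda>n. real n / real (n + 1)) \<longlonglongrightarrow> 1" using LIMSEQ_n_over_Suc_n by simp
  qed
  then have "(\<lambda>n. ereal (r * (ln (Z n \<theta>) / real n * (real n / real (n + 1))))) \<longlonglongrightarrow> ereal (r * \<Lambda> \<theta>)" by simp
  moreover have "\<forall>\<^sub>F n in sequentially. ereal (r / real (n + 1)) * eln (\<integral>\<^sup>+ \<omega>. ennreal (exp (\<theta> * S n \<omega>)) \<partial>M)
      = ereal (r * (ln (Z n \<theta>) / real n * (real n / real (n + 1))))"
    using mgf_finite[OF assms] eventually_gt_at_top[of 0]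
  proof eventually_elim
    case (elim n)
    have "(\<integral>\<^sup>+ \<omega>. ennreal (exp (\<theta> * S n \<omega>)) \<partial>M) = ennreal (Z n \<theta>)"
      unfolding Z_def using elim by (intro nn_integral_eq_integral) auto
    then show ?case using elim Z_pos[OF elim(1)] by (simp add: eln_ennreal)
  qed
  ultimately show ?thesis by (simp add: tendsto_cong)
qed

locale gmm_noise = gmm_objective Q U lam \<alpha> \<beta> \<nu> f g xstar h + prob_space M
  for Q U :: "real^'n::finite^'n::finite" and lam :: "'n \<Rightarrow> real" and \<alpha> \<beta> \<nu> :: real
    and f :: "real^'n \<Rightarrow> real" and g xstar :: "real^'n" and h :: real and M :: "'a measure" +
  fixes \<sigma> :: real and w x :: "nat \<Rightarrow> 'a \<Rightarrow> real^'n" and x0 :: "real^'n" and S :: "nat \<Rightarrow> 'a \<Rightarrow> real"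
  assumes \<sigma>: "0 < \<sigma>"
    and w_indep: "indep_vars (\<lambda>_. borel) w {1..}"
    and w_normal: "\<And>k. k \<ge> 1 \<Longrightarrow> distributed M lborel (w k)
        (\<lambda>y. ennreal (mvnormal_density 0 ((\<sigma>\<^sup>2 / real CARD('n)) *\<^sub>R mat 1) y))"
    and x: "\<And>k \<omega>. x k \<omega> = gmm f \<alpha> \<beta> \<nu> x0 (\<lambda>j. w j \<omega>) k"
    and S: "\<And>K \<omega>. S K \<omega> = (\<Sum>k=0..K. f (x k \<omega>) - f xstar)"
begin

definition s0 :: "(real^'n) \<times> (real^'n)" where "s0 = zst (x0, x0)"

lemma w_measurable: "1 \<le> k \<Longrightarrow> w k \<in> borel_measurable M"
  using w_indep by (auto simp: indep_vars_def)

lemma x_gap: "f (x k \<omega>) - f xstar = gap (trajectory s0 drift (\<lambda>j. w j \<omega>) k)"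
  unfolding x s0_def by (rule gap_gmm)

lemma trajectory_rv: "(\<lambda>\<omega>. trajectory s0 drift (\<lambda>j. w j \<omega>) k) \<in> borel_measurable M"
proof (induction k)
  case (Suc k)
  show ?case
    using measurable_compose[OF measurable_Pair[OF Suc w_measurable[of "Suc k"]] drift_measurable] by simp
qed simp

lemma S_gap: "S K \<omega> = (\<Sum>k=0..K. gap (trajectory s0 drift (\<lambda>j. w j \<omega>) k))"
  by (simp only: S x_gap)

lemma S_nonneg: "0 \<le> S K \<omega>"
  unfolding S_gap by (intro sum_nonneg gap_nonneg)

lemma S_rv: "S K \<in> borel_measurable M"
  unfolding S_gap[abs_def] by (intro borel_measurable_sum measurable_compose[OF trajectory_rv gap_measurable])

lemma mgf_S:
  "(\<integral>\<^sup>+ \<omega>. ennreal (exp (\<theta> / (2 * \<sigma>\<^sup>2) * S K \<omega>)) \<partial>M) = weight (\<theta> / (2 * \<sigma>\<^sup>2)) s0 *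
    (\<Prod>i\<in>UNIV. (ar_step (bt i) (ct i) (real CARD('n) / (2 * \<alpha>\<^sup>2 * \<sigma>\<^sup>2)) (tau \<theta> i) ^^ K) (\<lambda>_ _. 1) (fst s0 $ i) (snd s0 $ i))"
proof -
  let ?\<eta> = "\<theta> / (2 * \<sigma>\<^sup>2)"
  let ?p = "\<lambda>\<omega> k. trajectory s0 drift (\<lambda>j. w j \<omega>) k"
  have "ennreal (exp (?\<eta> * S K \<omega>)) = weight ?\<eta> s0 * ((\<Prod>k=1..K. weight ?\<eta> (?p \<omega> k)) * 1)" for \<omega>
  proof -
    have "exp (?\<eta> * S K \<omega>) = (\<Prod>k=0..K. exp (?\<eta> * gap (?p \<omega> k)))"
      unfolding S_gap sum_distrib_left by (rule exp_sum) simp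
    then have "ennreal (exp (?\<eta> * S K \<omega>)) = (\<Prod>k=0..K. weight ?\<eta> (?p \<omega> k))"
      unfolding weight_gap by (simp add: prod_ennreal)
    \<comment> \<open>The factor at time 0 is deterministic and leaves the expectation; the operator
      accounts for the times 1 to \<open>K\<close>.\<close>
    also have "\<dots> = weight ?\<eta> (?p \<omega> 0) * (\<Prod>k=Suc 0..K. weight ?\<eta> (?p \<omega> k))"
      by (rule prod.atLeast_Suc_atMost) simp
    finally show ?thesis by simp
  qed
  then have "(\<integral>\<^sup>+ \<omega>. ennreal (exp (?\<eta> * S K \<omega>)) \<partial>M) = (\<integral>\<^sup>+ \<omega>. weight ?\<eta> s0 * ((\<Prod>k=1..K. weight ?\<eta> (?p \<omega> k)) * 1) \<partial>M)"
    by (simp only:)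
  also have "\<dots> = weight ?\<eta> s0 * (\<integral>\<^sup>+ \<omega>. (\<Prod>k=1..K. weight ?\<eta> (?p \<omega> k)) * 1 \<partial>M)"
    by (rule nn_integral_cmult) (intro borel_measurable_times_ennreal borel_measurable_prod_ennreal measurable_compose[OF trajectory_rv weight_measurable], simp)
  also have "(\<integral>\<^sup>+ \<omega>. (\<Prod>k=1..K. weight ?\<eta> (?p \<omega> k)) * 1 \<partial>M)
    = (feynman_kac (\<lambda>y. ennreal (mvnormal_density 0 ((\<sigma>\<^sup>2 / real CARD('n)) *\<^sub>R mat 1) y)) drift (weight ?\<eta>) ^^ K) (\<lambda>_. 1) s0"
    by (rule expectation_feynman_kac[OF w_indep w_normal drift_measurable weight_measurable]) auto
  finally show ?thesis unfolding feynman_kac_iterate[OF \<sigma>] .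
qed

lemma mgf_bounds:
  assumes \<theta>: "\<theta> < theta_c"
  obtains C1 C2 where "0 < C1" "0 < C2"
    "\<And>m. ennreal (C1 * exp (LamF \<theta>) ^ m) \<le> (\<integral>\<^sup>+ \<omega>. ennreal (exp (\<theta> / (2 * \<sigma>\<^sup>2) * S (m + 2) \<omega>)) \<partial>M)"
    "\<And>m. (\<integral>\<^sup>+ \<omega>. ennreal (exp (\<theta> / (2 * \<sigma>\<^sup>2) * S (m + 2) \<omega>)) \<partial>M) \<le> ennreal (C2 * exp (LamF \<theta>) ^ m)"
proof -
  let ?k = "real CARD('n) / (2 * \<alpha>\<^sup>2 * \<sigma>\<^sup>2)"
  let ?P = "\<lambda>m. (\<Prod>i\<in>UNIV. (ar_step (bt i) (ct i) ?k (tau \<theta> i) ^^ (m + 2)) (\<lambda>_ _. 1) (fst s0 $ i) (snd s0 $ i))"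
  have "0 < ?k" using \<alpha>_pos \<sigma> by simp
  from product_bounds[OF this \<theta>, of "\<lambda>i. fst s0 $ i" "\<lambda>i. snd s0 $ i"] obtain C1 C2 where
    C: "0 < C1" "0 < C2" "\<And>m. ennreal (C1 * exp (LamF \<theta>) ^ m) \<le> ?P m" "\<And>m. ?P m \<le> ennreal (C2 * exp (LamF \<theta>) ^ m)" by blast
  define W where "W = exp (\<theta> / (2 * \<sigma>\<^sup>2) * gap s0)"
  have W: "0 < W" "weight (\<theta> / (2 * \<sigma>\<^sup>2)) s0 = ennreal W" by (simp_all add: W_def weight_gap)
  show ?thesis
  proof (rule that[of "W * C1" "W * C2"])
    fix m
    have eq: "ennreal (W * C * exp (LamF \<theta>) ^ m) = ennreal W * ennreal (C * exp (LamF \<theta>) ^ m)" if "0 < C" for C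
      using W that by (simp add: ennreal_mult[symmetric] mult.assoc)
    show "ennreal (W * C1 * exp (LamF \<theta>) ^ m) \<le> (\<integral>\<^sup>+ \<omega>. ennreal (exp (\<theta> / (2 * \<sigma>\<^sup>2) * S (m + 2) \<omega>)) \<partial>M)"
      unfolding mgf_S W(2) eq[OF C(1)] by (intro mult_left_mono C) simp
    show "(\<integral>\<^sup>+ \<omega>. ennreal (exp (\<theta> / (2 * \<sigma>\<^sup>2) * S (m + 2) \<omega>)) \<partial>M) \<le> ennreal (W * C2 * exp (LamF \<theta>) ^ m)"
      unfolding mgf_S W(2) eq[OF C(2)] by (intro mult_left_mono C) simp
  qed (use W C in auto)
qed

text \<open>The exponent of \<open>S\<close> is
  \<open>\<eta> = \<theta> / (2 * \<sigma>\<^sup>2)\<close>, so the limit, its derivative and the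
  critical value are rescaled.\<close>

lemma mgf_limit_gmm: "mgf_limit M S (theta_c / (2 * \<sigma>\<^sup>2)) (\<lambda>\<eta>. LamF (2 * \<sigma>\<^sup>2 * \<eta>)) (\<lambda>\<eta>. 2 * \<sigma>\<^sup>2 * DLamF (2 * \<sigma>\<^sup>2 * \<eta>))"
proof
  have s2: "0 < 2 * \<sigma>\<^sup>2" using \<sigma> by simp
  have th: "2 * \<sigma>\<^sup>2 * \<eta> < theta_c" if "\<eta> < theta_c / (2 * \<sigma>\<^sup>2)" for \<eta>
    using that s2 by (simp add: less_divide_eq mult.commute)
  show "S n \<in> borel_measurable M" for n by (rule S_rv)
  show "0 < theta_c / (2 * \<sigma>\<^sup>2)" using theta_c_pos s2 by simp
  {
    fix \<eta> assume "\<eta> < theta_c / (2 * \<sigma>\<^sup>2)"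
    note th = th[OF this]
    have e: "2 * \<sigma>\<^sup>2 * \<eta> / (2 * \<sigma>\<^sup>2) = \<eta>" using s2 by simp
    obtain C1 C2 where C: "0 < C1" "0 < C2"
      "\<And>m. ennreal (C1 * exp (LamF (2 * \<sigma>\<^sup>2 * \<eta>)) ^ m) \<le> (\<integral>\<^sup>+ \<omega>. ennreal (exp (\<eta> * S (m + 2) \<omega>)) \<partial>M)"
      "\<And>m. (\<integral>\<^sup>+ \<omega>. ennreal (exp (\<eta> * S (m + 2) \<omega>)) \<partial>M) \<le> ennreal (C2 * exp (LamF (2 * \<sigma>\<^sup>2 * \<eta>)) ^ m)"
      using mgf_bounds[OF th] unfolding e by blast
    have int: "integrable M (\<lambda>\<omega>. exp (\<eta> * S (m + 2) \<omega>))" for m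
    proof (rule integrableI_nonneg)
      show "(\<integral>\<^sup>+ \<omega>. ennreal (exp (\<eta> * S (m + 2) \<omega>)) \<partial>M) < \<infinity>"
        using C(4)[of m] by (simp add: le_less_trans)
      show "(\<lambda>\<omega>. exp (\<eta> * S (m + 2) \<omega>)) \<in> borel_measurable M"
        using S_rv[of "m + 2"] by measurable
    qed simp
    show "\<forall>\<^sub>F n in sequentially. integrable M (\<lambda>\<omega>. exp (\<eta> * S n \<omega>))"
      unfolding eventually_sequentially
    proof (intro exI allI impI)
      fix n :: nat assume "2 \<le> n"
      then obtain m where n: "n = m + 2" by (metis add.commute le_Suc_ex)
      show "integrable M (\<lambda>\<omega>. exp (\<eta> * S n \<omega>))" unfolding n by (rule int)
    qed
    have nn: "(\<integral>\<^sup>+ \<omega>. ennreal (exp (\<eta> * S (m + 2) \<omega>)) \<partial>M) = ennreal (expectation (\<lambda>\<omega>. exp (\<eta> * S (m + 2) \<omega>)))" for m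
      by (rule nn_integral_eq_integral[OF int]) simp
    have "(\<lambda>n. ln (expectation (\<lambda>\<omega>. exp (\<eta> * S n \<omega>))) / real n) \<longlonglongrightarrow> ln (exp (LamF (2 * \<sigma>\<^sup>2 * \<eta>)))"
    proof (rule ln_div_lim_of_geometric_bounds[OF C(1,2)])
      fix m
      show "C1 * exp (LamF (2 * \<sigma>\<^sup>2 * \<eta>)) ^ m \<le> expectation (\<lambda>\<omega>. exp (\<eta> * S (m + 2) \<omega>))"
        using C(3)[of m] unfolding nn by (subst (asm) ennreal_le_iff) (auto intro: integral_nonneg)
      show "expectation (\<lambda>\<omega>. exp (\<eta> * S (m + 2) \<omega>)) \<le> C2 * exp (LamF (2 * \<sigma>\<^sup>2 * \<eta>)) ^ m"
        using C(4)[of m] C(2) unfolding nn by (subst (asm) ennreal_le_iff) auto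
    qed simp
    then show "(\<lambda>n. ln (expectation (\<lambda>\<omega>. exp (\<eta> * S n \<omega>))) / real n) \<longlonglongrightarrow> LamF (2 * \<sigma>\<^sup>2 * \<eta>)" by simp
    have "((\<lambda>\<eta>. 2 * \<sigma>\<^sup>2 * \<eta>) has_real_derivative 2 * \<sigma>\<^sup>2) (at \<eta>)"
      using DERIV_cmult[OF DERIV_ident, of "2 * \<sigma>\<^sup>2"] by simp
    from DERIV_chain2[OF LamF_deriv[OF th] this]
    show "((\<lambda>\<eta>. LamF (2 * \<sigma>\<^sup>2 * \<eta>)) has_real_derivative 2 * \<sigma>\<^sup>2 * DLamF (2 * \<sigma>\<^sup>2 * \<eta>)) (at \<eta>)"
      by (simp only: mult.commute)
  }
  show "\<exists>\<eta><theta_c / (2 * \<sigma>\<^sup>2). 2 * \<sigma>\<^sup>2 * DLamF (2 * \<sigma>\<^sup>2 * \<eta>) = s" if s: "0 < s" for s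
  proof -
    obtain \<theta> where "\<theta> < theta_c" "DLamF \<theta> = s / (2 * \<sigma>\<^sup>2)" using DLamF_surj[OF divide_pos_pos[OF s s2]] by blast
    then show ?thesis using s2 \<sigma> by (intro exI[of _ "\<theta> / (2 * \<sigma>\<^sup>2)"]) (auto simp: divide_strict_right_mono)
  qed
  show "filterlim (\<lambda>\<eta>. LamF (2 * \<sigma>\<^sup>2 * \<eta>)) at_bot at_bot"
    by (rule filterlim_compose[OF LamF_at_bot])
      (rule filterlim_tendsto_pos_mult_at_bot[OF tendsto_const s2 filterlim_ident])
qed

sublocale ldp: mgf_limit M S "theta_c / (2 * \<sigma>\<^sup>2)" "\<lambda>\<eta>. LamF (2 * \<sigma>\<^sup>2 * \<eta>)" "\<lambda>\<eta>. 2 * \<sigma>\<^sup>2 * DLamF (2 * \<sigma>\<^sup>2 * \<eta>)"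
  by (rule mgf_limit_gmm)

abbreviation "G \<equiv> gmm_G \<alpha> \<beta> \<nu> Q U lam"

lemma LamF_0: "LamF 0 = 0" using ldp.\<Lambda>_0 by simp

lemma risk_integral_eq: "\<theta> < theta_c \<Longrightarrow> \<theta> \<noteq> 0 \<Longrightarrow> risk_integral G \<sigma> \<theta> = 2 * \<sigma>\<^sup>2 / \<theta> * LamF \<theta>"
  unfolding risk_integral_def integral_unique[OF log_det_integral(3)] by (simp add: field_simps)

lemma risk_K_lim:
  assumes "\<theta> < theta_c" "\<theta> \<noteq> 0"
  shows "limsup (\<lambda>K. risk_K M \<sigma> S K \<theta>) = ereal (risk_integral G \<sigma> \<theta>)"
proof -
  have "2 * \<sigma>\<^sup>2 * (\<theta> / (2 * \<sigma>\<^sup>2)) = \<theta>" using \<sigma> by simp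
  then have "(\<lambda>n. ereal (2 * \<sigma>\<^sup>2 / \<theta> / real (n + 1)) * eln (\<integral>\<^sup>+ \<omega>. ennreal (exp (\<theta> / (2 * \<sigma>\<^sup>2) * S n \<omega>)) \<partial>M)) \<longlonglongrightarrow> ereal (2 * \<sigma>\<^sup>2 / \<theta> * LamF \<theta>)"
    using ldp.log_mgf_lim[of "\<theta> / (2 * \<sigma>\<^sup>2)" "2 * \<sigma>\<^sup>2 / \<theta>"] assms \<sigma> by (simp add: divide_strict_right_mono)
  then have "(\<lambda>K. risk_K M \<sigma> S K \<theta>) \<longlonglongrightarrow> ereal (2 * \<sigma>\<^sup>2 / \<theta> * LamF \<theta>)"
    unfolding risk_K_def divide_divide_eq_left .
  then show ?thesis unfolding risk_integral_eq[OF assms] by (intro lim_imp_Limsup) auto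
qed

lemma risk_index_eq:
  assumes "\<theta> < theta_c" "\<theta> \<noteq> 0"
  shows "risk_index M \<sigma> S \<theta> = ereal (risk_integral G \<sigma> \<theta>)"
  using risk_K_lim[OF assms] assms by (simp add: risk_index_def)

text \<open>\<open>ldp.supercritical\<close> normalizes by \<open>K\<close>, the index by
  \<open>K + 1\<close>. Since \<open>1 / K \<le> 2 / (K + 1)\<close>, half of the prefactor is given
  away, which an infinite limit tolerates. The comparison needs nonnegative logarithms; these follow
  from \<open>S_nonneg\<close> and \<open>\<theta> > 0\<close>.\<close>

lemma risk_index_supercritical:
  assumes \<theta>: "theta_c < \<theta>"
  shows "risk_index M \<sigma> S \<theta> = \<infinity>"
proof -
  have pos: "0 < \<theta>" using \<theta> theta_c_pos by simp
  let ?e = "\<lambda>K. eln (\<integral>\<^sup>+ \<omega>. ennreal (exp (\<theta> / (2 * \<sigma>\<^sup>2) * S K \<omega>)) \<partial>M)"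
  have e: "0 \<le> ?e K" for K
  proof -
    have "(1::ennreal) = (\<integral>\<^sup>+ \<omega>. 1 \<partial>M)" by (simp add: emeasure_space_1)
    also have "\<dots> \<le> (\<integral>\<^sup>+ \<omega>. ennreal (exp (\<theta> / (2 * \<sigma>\<^sup>2) * S K \<omega>)) \<partial>M)"
      using S_nonneg pos by (intro nn_integral_mono) (simp flip: ennreal_1)
    finally have "eln 1 \<le> ?e K" by (rule eln_mono)
    then show ?thesis using eln_ennreal[of 1] by (simp add: zero_ereal_def)
  qed
  have "\<infinity> = ereal (\<sigma>\<^sup>2 / \<theta>) * limsup (\<lambda>K. ereal (1 / real K) * ?e K)"
    using ldp.supercritical[of "\<theta> / (2 * \<sigma>\<^sup>2)"] \<theta> \<sigma> pos by (simp add: divide_strict_right_mono)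
  also have "\<dots> = limsup (\<lambda>K. ereal (\<sigma>\<^sup>2 / \<theta>) * (ereal (1 / real K) * ?e K))"
    using pos by (intro limsup_ereal_mult_left[symmetric]) auto
  also have "\<dots> \<le> limsup (\<lambda>K. risk_K M \<sigma> S K \<theta>)"
  proof (rule Limsup_mono)
    show "\<forall>\<^sub>F K in sequentially. ereal (\<sigma>\<^sup>2 / \<theta>) * (ereal (1 / real K) * ?e K) \<le> risk_K M \<sigma> S K \<theta>"
      using eventually_gt_at_top[of 0]
    proof eventually_elim
      case (elim K)
      have "\<sigma>\<^sup>2 / \<theta> * (1 / real K) \<le> 2 * \<sigma>\<^sup>2 / (\<theta> * real (K + 1))"
      proof -
        have "1 / real K \<le> 2 / real (K + 1)" using elim by (simp add: field_simps)
        then have "\<sigma>\<^sup>2 / \<theta> * (1 / real K) \<le> \<sigma>\<^sup>2 / \<theta> * (2 / real (K + 1))" using pos by (intro mult_left_mono) auto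
        then show ?thesis by (simp add: mult.commute)
      qed
      then have "ereal (\<sigma>\<^sup>2 / \<theta> * (1 / real K)) * ?e K \<le> ereal (2 * \<sigma>\<^sup>2 / (\<theta> * real (K + 1))) * ?e K"
        using e by (intro ereal_mult_right_mono) auto
      then show ?case unfolding risk_K_def by (simp add: mult.assoc[symmetric])
    qed
  qed
  finally show ?thesis using pos by (simp add: risk_index_def)
qed

text \<open>By \<open>ln y \<le> y - 1\<close> the function \<open>LamF\<close> lies above a line through the origin, so
  the slope of that line is its derivative at \<open>0\<close>.\<close>

lemma DLamF_0: "2 * \<sigma>\<^sup>2 * DLamF 0 = risk_integral_0 G \<sigma>"
proof -
  let ?X = "\<lambda>\<omega>. \<Sum>i\<in>UNIV. slope i / (cmod (pch i (cis \<omega>)))\<^sup>2"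
  define D1 where "D1 = integral {-pi..pi} ?X / (4 * pi)"
  have X: "?X integrable_on {-pi..pi}"
    by (intro integrable_continuous_real continuous_intros) (auto simp: quadratic_cis_nonzero[OF stable] pch_def[abs_def] intro!: continuous_intros)
  have ge: "\<theta> * D1 \<le> LamF \<theta>" if \<theta>: "\<theta> < theta_c" for \<theta>
  proof -
    let ?L = "\<lambda>\<omega>. ln (Re (det (risk_matrix G \<theta> \<omega>)))"
    have "?L \<omega> \<le> - \<theta> * ?X \<omega>" for \<omega>
    proof -
      have pos: "0 < 1 - tau \<theta> i / (cmod (pch i (cis \<omega>)))\<^sup>2" for i
        using spectral_factor.ratio_pos[OF sfac[OF \<theta>]] by (simp add: pch_def)
      have "?L \<omega> = (\<Sum>i\<in>UNIV. ln (1 - tau \<theta> i / (cmod (pch i (cis \<omega>)))\<^sup>2))"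
        unfolding det_risk_matrix Re_complex_of_real by (rule ln_prod[OF finite less_imp_neq[OF pos, THEN not_sym]])
      also have "\<dots> \<le> (\<Sum>i\<in>UNIV. - \<theta> * (slope i / (cmod (pch i (cis \<omega>)))\<^sup>2))"
        using ln_le_minus_one[OF pos] by (intro sum_mono) (simp add: tau_slope)
      finally show ?thesis by (simp only: sum_distrib_left)
    qed
    then have "- (4 * pi * LamF \<theta>) \<le> - \<theta> * integral {-pi..pi} ?X"
      by (intro has_integral_le[OF log_det_integral(3)[OF \<theta>] has_integral_mult_right[OF integrable_integral[OF X]]])
    then show ?thesis by (simp add: D1_def field_simps)
  qed
  have "((\<lambda>\<theta>. LamF \<theta> - \<theta> * D1) has_real_derivative DLamF 0 - 1 * D1) (at 0)"
    by (intro DERIV_diff LamF_deriv DERIV_cmult_right DERIV_ident theta_c_pos)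
  then have "DLamF 0 - 1 * D1 = 0"
    by (rule DERIV_local_min[OF _ theta_c_pos]) (use ge LamF_0 in auto)
  then have "2 * \<sigma>\<^sup>2 * DLamF 0 = \<sigma>\<^sup>2 / (2 * pi) * integral {-pi..pi} ?X" by (simp add: D1_def)
  also have "\<dots> = risk_integral_0 G \<sigma>"
  proof -
    have "Re (trace (G (cis \<omega>) ** conj_transpose (G (cis \<omega>)))) = real CARD('n) * ?X \<omega>" for \<omega>
      unfolding trace_GG by (simp add: slope_def sum_distrib_left)
    then show ?thesis by (simp add: risk_integral_0_def)
  qed
  finally show ?thesis .
qed

lemma risk_integral_tendsto: "(risk_integral G \<sigma> \<longlongrightarrow> risk_integral_0 G \<sigma>) (at 0)"
proof -
  have "((\<lambda>h. (LamF (0 + h) - LamF 0) / h) \<longlongrightarrow> DLamF 0) (at 0)"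
    using LamF_deriv[OF theta_c_pos] by (simp only: DERIV_def)
  then have "((\<lambda>h. 2 * \<sigma>\<^sup>2 * (LamF h / h)) \<longlongrightarrow> 2 * \<sigma>\<^sup>2 * DLamF 0) (at 0)"
    by (intro tendsto_mult_left) (simp add: LamF_0)
  moreover have "\<forall>\<^sub>F h in at 0. 2 * \<sigma>\<^sup>2 * (LamF h / h) = risk_integral G \<sigma> h"
    unfolding eventually_at using theta_c_pos
    by (intro exI[of _ theta_c]) (auto simp: risk_integral_eq dist_real_def)
  ultimately show ?thesis unfolding DLamF_0 by (rule Lim_transform_eventually)
qed

lemma risk_index_0: "risk_index M \<sigma> S 0 = ereal (risk_integral_0 G \<sigma>)"
proof -
  have "((\<lambda>t. ereal (risk_integral G \<sigma> t)) \<longlongrightarrow> ereal (risk_integral_0 G \<sigma>)) (at 0)"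
    using risk_integral_tendsto by simp
  moreover have "\<forall>\<^sub>F t in at 0. ereal (risk_integral G \<sigma> t) = limsup (\<lambda>K. risk_K M \<sigma> S K t)"
    unfolding eventually_at using theta_c_pos
    by (intro exI[of _ theta_c]) (auto simp: risk_K_lim dist_real_def)
  ultimately have "((\<lambda>t. limsup (\<lambda>K. risk_K M \<sigma> S K t)) \<longlongrightarrow> ereal (risk_integral_0 G \<sigma>)) (at 0)"
    by (rule Lim_transform_eventually)
  then show ?thesis unfolding risk_index_def by (simp add: tendsto_Lim)
qed

lemma risk_rate_eq: "risk_rate \<sigma> theta_c (risk_index M \<sigma> S) = ldp.rate"
proof
  fix s
  have s2: "0 < 2 * \<sigma>\<^sup>2" using \<sigma> by simp
  have im: "{..<theta_c} = (\<lambda>\<eta>. 2 * \<sigma>\<^sup>2 * \<eta>) ` {..<theta_c / (2 * \<sigma>\<^sup>2)}"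
  proof (intro set_eqI iffI)
    fix t assume "t \<in> {..<theta_c}"
    then show "t \<in> (\<lambda>\<eta>. 2 * \<sigma>\<^sup>2 * \<eta>) ` {..<theta_c / (2 * \<sigma>\<^sup>2)}"
      using s2 \<sigma> by (intro image_eqI[of _ _ "t / (2 * \<sigma>\<^sup>2)"]) (auto simp: divide_strict_right_mono)
  qed (use s2 in \<open>auto simp: less_divide_eq mult.commute\<close>)
  have "ereal (2 * \<sigma>\<^sup>2 * \<eta> / (2 * \<sigma>\<^sup>2)) * (ereal s - risk_index M \<sigma> S (2 * \<sigma>\<^sup>2 * \<eta>)) = ereal (\<eta> * s - LamF (2 * \<sigma>\<^sup>2 * \<eta>))"
    if "\<eta> < theta_c / (2 * \<sigma>\<^sup>2)" for \<eta>
  proof (cases "\<eta> = 0")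
    \<comment> \<open>Both sides vanish: multiplication by 0 in \<open>ereal\<close> gives 0, and
      \<open>LamF 0 = 0\<close>.\<close>
    case True then show ?thesis by (simp add: LamF_0 zero_ereal_def[symmetric])
  next
    case False
    have "2 * \<sigma>\<^sup>2 * \<eta> < theta_c" "2 * \<sigma>\<^sup>2 * \<eta> \<noteq> 0" using that s2 False \<sigma> by (auto simp: less_divide_eq mult.commute)
    then show ?thesis using False \<sigma> by (simp add: risk_index_eq risk_integral_eq right_diff_distrib)
  qed
  then show "risk_rate \<sigma> theta_c (risk_index M \<sigma> S) s = ldp.rate s"
    unfolding risk_rate_def ldp.rate_def im image_image by (intro SUP_cong) auto
qed

lemma averaged_iterate_bound:
  assumes xbar: "\<And>K \<omega>. xbar K \<omega> = (1 / real (K + 1)) *\<^sub>R (\<Sum>k=0..K. x k \<omega>)"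
  shows "limsup (log_prob_rate M (\<lambda>K. {\<omega> \<in> space M. f (xbar K \<omega>) - f xstar > t}))
    \<le> limsup (log_prob_rate M (\<lambda>K. {\<omega> \<in> space M. S K \<omega> / real (K + 1) \<ge> t}))"
proof (intro Limsup_mono always_eventually allI)
  fix K
  have "f (xbar K \<omega>) - f xstar \<le> S K \<omega> / real (K + 1)" for \<omega>
    using gap_average[of "{0..K}" "\<lambda>k. x k \<omega>"] by (simp add: xbar S)
  moreover have "{\<omega> \<in> space M. t \<le> S K \<omega> / real (K + 1)} \<in> sets M"
    using S_rv[of K] by measurable
  ultimately have "emeasure M {\<omega> \<in> space M. f (xbar K \<omega>) - f xstar > t} \<le> emeasure M {\<omega> \<in> space M. S K \<omega> / real (K + 1) \<ge> t}"
    by (intro emeasure_mono) (auto intro: order.trans[OF less_imp_le])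
  then show "log_prob_rate M (\<lambda>K. {\<omega> \<in> space M. f (xbar K \<omega>) - f xstar > t}) K
     \<le> log_prob_rate M (\<lambda>K. {\<omega> \<in> space M. S K \<omega> / real (K + 1) \<ge> t}) K"
    unfolding log_prob_rate_def by (intro ereal_mult_left_mono eln_mono) auto
qed

end

text \<open>The quadratic form is evaluated at the eigenvector \<open>U *v axis i 1\<close>.\<close>

lemma sym_pos_def_eigenvalues_pos:
  assumes Q: "sym_pos_def Q" and U: "orthogonal_matrix U"
    and decomp: "Q = U ** diag_matrix lam ** transpose U"
  shows "0 < lam i"
proof -
  let ?v = "U *v axis i 1"
  have tv: "transpose U *v ?v = axis i 1" by (rule orthogonal_cancel(1)[OF U])
  have "?v \<noteq> 0" using tv by (metis axis_eq_0_iff matrix_vector_mult_0_right zero_neq_one)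
  then have "0 < ?v \<bullet> (Q *v ?v)" using Q by (simp add: sym_pos_def_def)
  also have "?v \<bullet> (Q *v ?v) = (transpose U *v ?v) \<bullet> (transpose U *v (Q *v ?v))"
    unfolding inner_transpose[of _ "transpose U"] by (simp only: transpose_transpose orthogonal_cancel(2)[OF U])
  also have "\<dots> = (transpose U *v (Q *v ?v)) $ i" unfolding tv by (simp add: inner_axis')
  also have "\<dots> = lam i" unfolding decomp decomp_coord[OF U] tv by simp
  finally show ?thesis .
qed

theorem proposition4p4:
  fixes Q U :: "real^'n::{finite,linorder}^'n::{finite,linorder}"
    and lam :: "'n::{finite,linorder} \<Rightarrow> real"
    and g x0 xstar :: "real^'n::{finite,linorder}"
    and h \<alpha> \<beta> \<nu> \<sigma> \<theta>\<^sub>c :: real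
    and f :: "real^'n::{finite,linorder} \<Rightarrow> real"
    and M :: "'a measure"
    and w x xbar :: "nat \<Rightarrow> 'a \<Rightarrow> real^'n::{finite,linorder}"
    and S :: "nat \<Rightarrow> 'a \<Rightarrow> real"
    and G :: "complex \<Rightarrow> complex^'n::{finite,linorder}^'n::{finite,linorder}"
    and R I :: "real \<Rightarrow> ereal"
  assumes Q: "sym_pos_def Q"
    and U: "orthogonal_matrix U"
    and Q_decomp: "Q = U ** diag_matrix lam ** transpose U"
    and lam_sorted: "mono lam"
    and mu_less_L: "lam (Min UNIV) < lam (Max UNIV)"
    and f: "\<And>y. f y = 1 / 2 * (y \<bullet> (Q *v y)) + g \<bullet> y + h"
    and xstar: "is_arg_min f (\<lambda>_. True) xstar"
    and \<alpha>: "\<alpha> > 0" and \<beta>: "\<beta> \<ge> 0" and \<nu>: "\<nu> \<ge> 0" and \<sigma>: "\<sigma> > 0"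
    and M: "prob_space M"
    and w_indep: "prob_space.indep_vars M (\<lambda>_. borel) w {1..}"
    and w_normal: "\<And>k. k \<ge> 1 \<Longrightarrow> distributed M lborel (w k)
        (\<lambda>y. ennreal (mvnormal_density 0 ((\<sigma>\<^sup>2 / real CARD('n)) *\<^sub>R mat 1) y))"
    and x: "\<And>k \<omega>. x k \<omega> = gmm f \<alpha> \<beta> \<nu> x0 (\<lambda>j. w j \<omega>) k"
    and stable: "spec_radius (cmatrix (gmm_A \<alpha> \<beta> \<nu> Q)) < 1"
    and S: "\<And>K \<omega>. S K \<omega> = (\<Sum>k=0..K. f (x k \<omega>) - f xstar)"
    and xbar: "\<And>K \<omega>. xbar K \<omega> = (1 / real (K + 1)) *\<^sub>R (\<Sum>k=0..K. x k \<omega>)"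
    and G: "G = gmm_G \<alpha> \<beta> \<nu> Q U lam"
    and \<theta>\<^sub>c: "\<theta>\<^sub>c = real CARD('n) / (H_inf \<alpha> \<beta> \<nu> lam)\<^sup>2"
    and R: "R = risk_index M \<sigma> S"
    and I: "I = risk_rate \<sigma> \<theta>\<^sub>c R"
  shows
    "satisfies_LDP M (\<lambda>K \<omega>. S K \<omega> / real (K + 1)) I
     \<and> good_rate_function I
     \<and> (\<forall>\<theta> < \<theta>\<^sub>c. (\<forall>\<omega>. det (risk_matrix G \<theta> \<omega>) \<in> \<real> \<and> Re (det (risk_matrix G \<theta> \<omega>)) > 0)
          \<and> (\<lambda>\<omega>. ln (Re (det (risk_matrix G \<theta> \<omega>)))) integrable_on {-pi..pi})
     \<and> (\<forall>\<theta> < \<theta>\<^sub>c. \<theta> \<noteq> 0 \<longrightarrow> R \<theta> = ereal (risk_integral G \<sigma> \<theta>))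
     \<and> (\<forall>\<theta> > \<theta>\<^sub>c. R \<theta> = \<infinity>)
     \<and> (risk_integral G \<sigma> \<longlongrightarrow> risk_integral_0 G \<sigma>) (at 0)
     \<and> R 0 = ereal (risk_integral_0 G \<sigma>)
     \<and> (\<forall>t > 0.
          limsup (log_prob_rate M (\<lambda>K. {\<omega> \<in> space M. f (xbar K \<omega>) - f xstar > t}))
            \<le> lim (log_prob_rate M (\<lambda>K. {\<omega> \<in> space M. S K \<omega> / real (K + 1) \<ge> t}))
          \<and> (log_prob_rate M (\<lambda>K. {\<omega> \<in> space M. S K \<omega> / real (K + 1) \<ge> t}))
              \<longlonglongrightarrow> - (INF s \<in> {t..}. I s))"
proof -
  interpret prob_space M by (rule M)
  interpret gmm_noise Q U lam \<alpha> \<beta> \<nu> f g xstar h M \<sigma> w x x0 S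
    by unfold_locales
      (use U Q_decomp sym_pos_def_eigenvalues_pos[OF Q U Q_decomp] \<alpha> stable f xstar \<sigma> w_indep w_normal x S in auto)
  have \<theta>\<^sub>c': "\<theta>\<^sub>c = theta_c" unfolding \<theta>\<^sub>c theta_c_def ..
  have I': "I = ldp.rate" unfolding I R \<theta>\<^sub>c' by (rule risk_rate_eq)
  have tail: "limsup (log_prob_rate M (\<lambda>K. {\<omega> \<in> space M. f (xbar K \<omega>) - f xstar > t}))
            \<le> lim (log_prob_rate M (\<lambda>K. {\<omega> \<in> space M. S K \<omega> / real (K + 1) \<ge> t}))
          \<and> (log_prob_rate M (\<lambda>K. {\<omega> \<in> space M. S K \<omega> / real (K + 1) \<ge> t}))
              \<longlonglongrightarrow> - (INF s \<in> {t..}. I s)" if "0 < t" for t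
  proof -
    let ?A = "log_prob_rate M (\<lambda>K. {\<omega> \<in> space M. S K \<omega> / real (K + 1) \<ge> t})"
    have conv: "?A \<longlonglongrightarrow> - (INF s \<in> {t..}. I s)" unfolding I' by (rule ldp.tail_limit[OF that])
    \<comment> \<open>\<open>lim\<close> has its intended value once convergence is known, and then
      agrees with the limsup that bounds the averaged iterate.\<close>
    have "lim ?A = limsup ?A" using limI[OF conv] lim_imp_Limsup[OF _ conv] by simp
    then show ?thesis using averaged_iterate_bound[OF xbar, of t] conv by simp
  qed
  show ?thesis
    unfolding G
  proof (intro conjI allI impI)
    show "satisfies_LDP M (\<lambda>K \<omega>. S K \<omega> / real (K + 1)) I" unfolding I' by (rule ldp.LDP)
    show "good_rate_function I" unfolding I' by (rule ldp.good_rate)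
    fix \<theta> assume "\<theta> < \<theta>\<^sub>c"
    then have \<theta>: "\<theta> < theta_c" by (simp add: \<theta>\<^sub>c')
    show "det (risk_matrix (gmm_G \<alpha> \<beta> \<nu> Q U lam) \<theta> \<omega>) \<in> \<real>" "0 < Re (det (risk_matrix (gmm_G \<alpha> \<beta> \<nu> Q U lam) \<theta> \<omega>))" for \<omega>
      by (rule log_det_integral[OF \<theta>])+
    show "(\<lambda>\<omega>. ln (Re (det (risk_matrix (gmm_G \<alpha> \<beta> \<nu> Q U lam) \<theta> \<omega>)))) integrable_on {-pi..pi}"
      using log_det_integral(3)[OF \<theta>] by blast
    show "R \<theta> = ereal (risk_integral (gmm_G \<alpha> \<beta> \<nu> Q U lam) \<sigma> \<theta>)" if "\<theta> \<noteq> 0"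
      unfolding R by (rule risk_index_eq[OF \<theta> that])
  next
    show "R \<theta> = \<infinity>" if "\<theta>\<^sub>c < \<theta>" for \<theta>
      unfolding R using risk_index_supercritical that by (simp add: \<theta>\<^sub>c')
    show "(risk_integral (gmm_G \<alpha> \<beta> \<nu> Q U lam) \<sigma> \<longlongrightarrow> risk_integral_0 (gmm_G \<alpha> \<beta> \<nu> Q U lam) \<sigma>) (at 0)" by (rule risk_integral_tendsto)
    show "R 0 = ereal (risk_integral_0 (gmm_G \<alpha> \<beta> \<nu> Q U lam) \<sigma>)" unfolding R by (rule risk_index_0)
  qed (use tail in blast)+
qed

end
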